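(* Let $g_1,g_2\in\mathcal{S}([0,\infty))$ and $h_1\in C^\infty([0,\infty))$, and let $\psi_1(x,t),\psi_2(x,t)$ be the functions defined in the context for $x>0$, $t>0$, $x\neq t$. Then for every $T>0$, $$\lim_{x\to+\infty}\left[x^E\frac{\partial^{n+l}\psi_1(x,t)}{\partial x^n\partial t^l}\right]=0\quad\text{and}\quad\lim_{x\to+\infty}\left[x^E\frac{\partial^{n+l}\psi_2(x,t)}{\partial x^n\partial t^l}\right]=0,$$ for all nonnegative integers $n$, $l$ and $E$, uniformly for $0<t\le T$.
   Context: Fix a real number $m\ge 0$. $\mathcal{S}([0,\infty))$ is the space of (complex-valued) $C^\infty$ functions $g$ on $[0,\infty)$ with $\sup_{x\ge0}x^a|g^{(b)}(x)|<\infty$ for all nonnegative integers $a,b$. For $\lambda\in\mathbb{R}$: $\rho(\lambda)=\sqrt{\lambda^2+m^2}$ (nonnegative root), $\omega_1(\lambda)=i\rho(\lambda)$, $\omega_2(\lambda)=-i\rho(\lambda)$, and $\hat g_j(\lambda)=\int_0^\infty e^{-i\lambda y}g_j(y)\,dy$ ($j=1,2$). For $x>0$, $t>0$, $x\ne t$ set $$\mathcal{G}_{1,1}=\int_{-\infty}^{\infty}e^{i\lambda x-\omega_1(\lambda)t}\{\lambda\hat g_2(\lambda)+[i\omega_2(\lambda)+m]\hat g_1(\lambda)\}\tfrac{d\lambda}{2\rho(\lambda)},\quad \mathcal{G}_{1,2}=\int_{-\infty}^{\infty}e^{i\lambda x-\omega_1(\lambda)t}\{\lambda\hat g_2(-\lambda)-[i\omega_2(\lambda)+m]\hat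 g_1(-\lambda)\}\tfrac{d\lambda}{2\rho(\lambda)},$$ $$\mathcal{G}_{1,3}=\int_{-\infty}^{\infty}e^{i\lambda x-\omega_2(\lambda)t}\{\lambda\hat g_2(\lambda)+[i\omega_1(\lambda)+m]\hat g_1(\lambda)\}\tfrac{d\lambda}{2\rho(\lambda)},\quad \mathcal{G}_{1,4}=\int_{-\infty}^{\infty}e^{i\lambda x-\omega_2(\lambda)t}\{\lambda\hat g_2(-\lambda)-[i\omega_1(\lambda)+m]\hat g_1(-\lambda)\}\tfrac{d\lambda}{2\rho(\lambda)},$$ $$\mathcal{G}_{2,1}=\int_{-\infty}^{\infty}e^{i\lambda x-\omega_1(\lambda)t}\{\lambda\hat g_1(\lambda)-[i\omega_1(\lambda)+m]\hat g_2(\lambda)\}\tfrac{d\lambda}{2\rho(\lambda)},\quad \mathcal{G}_{2,2}=\int_{-\infty}^{\infty}e^{i\lambda x-\omega_1(\lambda)t}\{\lambda\hat g_1(-\lambda)+[i\omega_1(\lambda)+m]\hat g_2(-\lambda)\}\tfrac{d\lambda}{2\rho(\lambda)},$$ $$\mathcal{G}_{2,3}=\int_{-\infty}^{\infty}e^{i\lambda x-\omega_2(\lambda)t}\{\lambda\hat g_1(\lambda)-[i\omega_2(\lambda)+m]\hat g_2(\lambda)\}\tfrac{d\lambda}{2\rho(\lambda)},\quad \mathcal{G}_{2,4}=\int_{-\infty}^{\infty}e^{i\lambda x-\omega_2(\lambda)t}\{\lambda\hat g_1(-\lambda)+[i\omega_2(\lambda)+m]\hat g_2(-\lambda)\}\tfrac{d\lambda}{2\rho(\lambda)},$$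 and, for $s=1,2$, $$\mathcal{H}_{1,s}=\int_{-\infty}^{\infty}e^{i\lambda x-\omega_s(\lambda)t}\Big[\int_0^t h_1(\tau)e^{\omega_s(\lambda)\tau}d\tau\Big]\tfrac{\lambda\,d\lambda}{\rho(\lambda)},\quad \mathcal{H}_{2,s}=\int_{-\infty}^{\infty}e^{i\lambda x-\omega_s(\lambda)t}\Big[\int_0^t h_1(\tau)e^{\omega_s(\lambda)\tau}d\tau\Big]\tfrac{[i\omega_s(\lambda)+m]\,d\lambda}{\rho(\lambda)}.$$ All integrals $\int_{-\infty}^\infty$ are understood in the generalized sense $\lim_{A\to\infty}\int_0^A+\lim_{A\to\infty}\int_{-A}^0$. The functions $\psi_1,\psi_2$ are defined by $$2\pi\psi_1=\mathcal{G}_{1,1}+\mathcal{G}_{1,2}-\mathcal{G}_{1,3}-\mathcal{G}_{1,4}+\mathcal{H}_{1,1}-\mathcal{H}_{1,2},\qquad 2\pi\psi_2=\mathcal{G}_{2,1}-\mathcal{G}_{2,2}-\mathcal{G}_{2,3}+\mathcal{G}_{2,4}-\mathcal{H}_{2,1}+\mathcal{H}_{2,2}.$$ *)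

theory Defs
  imports "HOL-Analysis.Analysis"
begin

text \<open>Derivatives on the closed half-line are one-sided at the endpoint 0; values of \<open>g\<close> at
  negative arguments are irrelevant.\<close>

definition halfline_deriv :: "nat \<Rightarrow> (real \<Rightarrow> complex) \<Rightarrow> real \<Rightarrow> complex" where
  "halfline_deriv b g = ((\<lambda>f x. vector_derivative f (at x within {0..})) ^^ b) g"

definition smooth_halfline :: "(real \<Rightarrow> complex) \<Rightarrow> bool" where
  "smooth_halfline g \<longleftrightarrow> (\<forall>b. halfline_deriv b g differentiable_on {0..})"

definition schwartz_halfline :: "(real \<Rightarrow> complex) \<Rightarrow> bool" where
  "schwartz_halfline g \<longleftrightarrow>
     smooth_halfline g \<and> (\<forall>a b. bounded ((\<lambda>x. x ^ a *\<^sub>R halfline_deriv b g x) ` {0..}))"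

definition rho :: "real \<Rightarrow> real \<Rightarrow> real" where
  "rho m k = sqrt (k\<^sup>2 + m\<^sup>2)"

definition omega1 :: "real \<Rightarrow> real \<Rightarrow> complex" where
  "omega1 m k = \<i> * of_real (rho m k)"

definition omega2 :: "real \<Rightarrow> real \<Rightarrow> complex" where
  "omega2 m k = - \<i> * of_real (rho m k)"

definition halfline_fourier :: "(real \<Rightarrow> complex) \<Rightarrow> real \<Rightarrow> complex" where
  "halfline_fourier g k = integral {0..} (\<lambda>y. exp (- \<i> * of_real k * of_real y) * g y)"

text \<open>The generalized integral over the line: the two half-lines converge separately.
  \<open>gen_integral f\<close> is only meaningful when \<open>gen_integrable f\<close> holds.\<close>

definition gen_integrable :: "(real \<Rightarrow> complex) \<Rightarrow> bool" where
  "gen_integrable f \<longleftrightarrow>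
     (\<forall>A>0. f integrable_on {0..A} \<and> f integrable_on {-A..0}) \<and>
     (\<exists>I. ((\<lambda>A. integral {0..A} f) \<longlongrightarrow> I) at_top) \<and>
     (\<exists>J. ((\<lambda>A. integral {-A..0} f) \<longlongrightarrow> J) at_top)"

definition gen_integral :: "(real \<Rightarrow> complex) \<Rightarrow> complex" where
  "gen_integral f = Lim at_top (\<lambda>A. integral {0..A} f) + Lim at_top (\<lambda>A. integral {-A..0} f)"

text \<open>Integrands, as functions of the spectral variable \<open>k\<close>. At \<open>k = 0\<close> with \<open>m = 0\<close> the division
  by \<open>rho m k = 0\<close> yields \<open>0\<close>; this single point does not affect the integrals.\<close>

definition G11 :: "real \<Rightarrow> (real \<Rightarrow> complex) \<Rightarrow> (real \<Rightarrow> complex) \<Rightarrow> real \<Rightarrow> real \<Rightarrow> real \<Rightarrow> complex" where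
  "G11 m g1 g2 x t k =
     exp (\<i> * of_real k * of_real x - omega1 m k * of_real t) *
     (of_real k * halfline_fourier g2 k + (\<i> * omega2 m k + of_real m) * halfline_fourier g1 k) /
     of_real (2 * rho m k)"

definition G12 :: "real \<Rightarrow> (real \<Rightarrow> complex) \<Rightarrow> (real \<Rightarrow> complex) \<Rightarrow> real \<Rightarrow> real \<Rightarrow> real \<Rightarrow> complex" where
  "G12 m g1 g2 x t k =
     exp (\<i> * of_real k * of_real x - omega1 m k * of_real t) *
     (of_real k * halfline_fourier g2 (- k) - (\<i> * omega2 m k + of_real m) * halfline_fourier g1 (- k)) /
     of_real (2 * rho m k)"

definition G13 :: "real \<Rightarrow> (real \<Rightarrow> complex) \<Rightarrow> (real \<Rightarrow> complex) \<Rightarrow> real \<Rightarrow> real \<Rightarrow> real \<Rightarrow> complex" where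
  "G13 m g1 g2 x t k =
     exp (\<i> * of_real k * of_real x - omega2 m k * of_real t) *
     (of_real k * halfline_fourier g2 k + (\<i> * omega1 m k + of_real m) * halfline_fourier g1 k) /
     of_real (2 * rho m k)"

definition G14 :: "real \<Rightarrow> (real \<Rightarrow> complex) \<Rightarrow> (real \<Rightarrow> complex) \<Rightarrow> real \<Rightarrow> real \<Rightarrow> real \<Rightarrow> complex" where
  "G14 m g1 g2 x t k =
     exp (\<i> * of_real k * of_real x - omega2 m k * of_real t) *
     (of_real k * halfline_fourier g2 (- k) - (\<i> * omega1 m k + of_real m) * halfline_fourier g1 (- k)) /
     of_real (2 * rho m k)"

definition G21 :: "real \<Rightarrow> (real \<Rightarrow> complex) \<Rightarrow> (real \<Rightarrow> complex) \<Rightarrow> real \<Rightarrow> real \<Rightarrow> real \<Rightarrow> complex" where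
  "G21 m g1 g2 x t k =
     exp (\<i> * of_real k * of_real x - omega1 m k * of_real t) *
     (of_real k * halfline_fourier g1 k - (\<i> * omega1 m k + of_real m) * halfline_fourier g2 k) /
     of_real (2 * rho m k)"

definition G22 :: "real \<Rightarrow> (real \<Rightarrow> complex) \<Rightarrow> (real \<Rightarrow> complex) \<Rightarrow> real \<Rightarrow> real \<Rightarrow> real \<Rightarrow> complex" where
  "G22 m g1 g2 x t k =
     exp (\<i> * of_real k * of_real x - omega1 m k * of_real t) *
     (of_real k * halfline_fourier g1 (- k) + (\<i> * omega1 m k + of_real m) * halfline_fourier g2 (- k)) /
     of_real (2 * rho m k)"

definition G23 :: "real \<Rightarrow> (real \<Rightarrow> complex) \<Rightarrow> (real \<Rightarrow> complex) \<Rightarrow> real \<Rightarrow> real \<Rightarrow> real \<Rightarrow> complex" where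
  "G23 m g1 g2 x t k =
     exp (\<i> * of_real k * of_real x - omega2 m k * of_real t) *
     (of_real k * halfline_fourier g1 k - (\<i> * omega2 m k + of_real m) * halfline_fourier g2 k) /
     of_real (2 * rho m k)"

definition G24 :: "real \<Rightarrow> (real \<Rightarrow> complex) \<Rightarrow> (real \<Rightarrow> complex) \<Rightarrow> real \<Rightarrow> real \<Rightarrow> real \<Rightarrow> complex" where
  "G24 m g1 g2 x t k =
     exp (\<i> * of_real k * of_real x - omega2 m k * of_real t) *
     (of_real k * halfline_fourier g1 (- k) + (\<i> * omega2 m k + of_real m) * halfline_fourier g2 (- k)) /
     of_real (2 * rho m k)"

definition H11 :: "real \<Rightarrow> (real \<Rightarrow> complex) \<Rightarrow> real \<Rightarrow> real \<Rightarrow> real \<Rightarrow> complex" where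
  "H11 m h1 x t k =
     exp (\<i> * of_real k * of_real x - omega1 m k * of_real t) *
     integral {0..t} (\<lambda>\<tau>. h1 \<tau> * exp (omega1 m k * of_real \<tau>)) *
     of_real k / of_real (rho m k)"

definition H12 :: "real \<Rightarrow> (real \<Rightarrow> complex) \<Rightarrow> real \<Rightarrow> real \<Rightarrow> real \<Rightarrow> complex" where
  "H12 m h1 x t k =
     exp (\<i> * of_real k * of_real x - omega2 m k * of_real t) *
     integral {0..t} (\<lambda>\<tau>. h1 \<tau> * exp (omega2 m k * of_real \<tau>)) *
     of_real k / of_real (rho m k)"

definition H21 :: "real \<Rightarrow> (real \<Rightarrow> complex) \<Rightarrow> real \<Rightarrow> real \<Rightarrow> real \<Rightarrow> complex" where
  "H21 m h1 x t k =
     exp (\<i> * of_real k * of_real x - omega1 m k * of_real t) *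
     integral {0..t} (\<lambda>\<tau>. h1 \<tau> * exp (omega1 m k * of_real \<tau>)) *
     (\<i> * omega1 m k + of_real m) / of_real (rho m k)"

definition H22 :: "real \<Rightarrow> (real \<Rightarrow> complex) \<Rightarrow> real \<Rightarrow> real \<Rightarrow> real \<Rightarrow> complex" where
  "H22 m h1 x t k =
     exp (\<i> * of_real k * of_real x - omega2 m k * of_real t) *
     integral {0..t} (\<lambda>\<tau>. h1 \<tau> * exp (omega2 m k * of_real \<tau>)) *
     (\<i> * omega2 m k + of_real m) / of_real (rho m k)"

definition psi1 :: "real \<Rightarrow> (real \<Rightarrow> complex) \<Rightarrow> (real \<Rightarrow> complex) \<Rightarrow> (real \<Rightarrow> complex) \<Rightarrow> real \<Rightarrow> real \<Rightarrow> complex" where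
  "psi1 m g1 g2 h1 x t =
     (gen_integral (G11 m g1 g2 x t)
      + gen_integral (G12 m g1 g2 x t)
      - gen_integral (G13 m g1 g2 x t)
      - gen_integral (G14 m g1 g2 x t)
      + gen_integral (H11 m h1 x t)
      - gen_integral (H12 m h1 x t))
     / of_real (2 * pi)"

definition psi2 :: "real \<Rightarrow> (real \<Rightarrow> complex) \<Rightarrow> (real \<Rightarrow> complex) \<Rightarrow> (real \<Rightarrow> complex) \<Rightarrow> real \<Rightarrow> real \<Rightarrow> complex" where
  "psi2 m g1 g2 h1 x t =
     (gen_integral (G21 m g1 g2 x t)
      - gen_integral (G22 m g1 g2 x t)
      - gen_integral (G23 m g1 g2 x t)
      + gen_integral (G24 m g1 g2 x t)
      - gen_integral (H21 m h1 x t)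
      + gen_integral (H22 m h1 x t))
     / of_real (2 * pi)"

definition psi_well_defined :: "real \<Rightarrow> (real \<Rightarrow> complex) \<Rightarrow> (real \<Rightarrow> complex) \<Rightarrow> (real \<Rightarrow> complex) \<Rightarrow> real \<Rightarrow> real \<Rightarrow> bool" where
  "psi_well_defined m g1 g2 h1 x t \<longleftrightarrow>
     gen_integrable (G11 m g1 g2 x t) \<and>
     gen_integrable (G12 m g1 g2 x t) \<and>
     gen_integrable (G13 m g1 g2 x t) \<and>
     gen_integrable (G14 m g1 g2 x t) \<and>
     gen_integrable (G21 m g1 g2 x t) \<and>
     gen_integrable (G22 m g1 g2 x t) \<and>
     gen_integrable (G23 m g1 g2 x t) \<and>
     gen_integrable (G24 m g1 g2 x t) \<and>
     gen_integrable (H11 m h1 x t) \<and>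
     gen_integrable (H12 m h1 x t) \<and>
     gen_integrable (H21 m h1 x t) \<and>
     gen_integrable (H22 m h1 x t)"

definition partial_x :: "(real \<Rightarrow> real \<Rightarrow> complex) \<Rightarrow> real \<Rightarrow> real \<Rightarrow> complex" where
  "partial_x f x t = vector_derivative (\<lambda>y. f y t) (at x)"

definition partial_t :: "(real \<Rightarrow> real \<Rightarrow> complex) \<Rightarrow> real \<Rightarrow> real \<Rightarrow> complex" where
  "partial_t f x t = vector_derivative (\<lambda>s. f x s) (at t)"

text \<open>\<open>mixed_deriv n l f\<close> is $\partial^{n+l} f/\partial x^n \partial t^l$, the \<open>t\<close>-derivatives being
  taken first. As \<open>vector_derivative\<close> is total, \<open>mixed_deriv_exists\<close> records that every
  differentiation performed at the point \<open>(x, t)\<close> is legitimate.\<close>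

definition mixed_deriv :: "nat \<Rightarrow> nat \<Rightarrow> (real \<Rightarrow> real \<Rightarrow> complex) \<Rightarrow> real \<Rightarrow> real \<Rightarrow> complex" where
  "mixed_deriv n l f = (partial_x ^^ n) ((partial_t ^^ l) f)"

definition mixed_deriv_exists :: "nat \<Rightarrow> nat \<Rightarrow> (real \<Rightarrow> real \<Rightarrow> complex) \<Rightarrow> real \<Rightarrow> real \<Rightarrow> bool" where
  "mixed_deriv_exists n l f x t \<longleftrightarrow>
     (\<forall>j<l. (\<lambda>s. mixed_deriv 0 j f x s) differentiable (at t)) \<and>
     (\<forall>j<n. (\<lambda>y. mixed_deriv j l f y t) differentiable (at x))"

end

theory Submission
  imports Defs "HOL-Probability.Sinc_Integral"
begin

text \<open>Write \<open>\<rho> = sqrt (k\<^sup>2 + m\<^sup>2)\<close>. Taken one by one, the integrals contain the branches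
  \<open>exp (\<plusminus> \<i> \<rho> t)\<close> and the factor \<open>1/\<rho>\<close>, but in the combinations that define the two fields only
  the multipliers \<open>cos (\<rho> t)\<close>, \<open>sin (\<rho> t) / \<rho>\<close> and \<open>k sin (\<rho> t) / \<rho>\<close> survive
  (\<open>initial_integrands_sum\<close>, \<open>boundary_integrands_sum\<close>). These are entire in \<open>k\<close> and of exponential
  type \<open>t\<close>, so they are Fourier transforms of distributions on \<open>[-t, t]\<close>: this is finite speed of
  propagation. The lemma \<open>propagator_wave\<close> makes it explicit by writing each multiplier, times
  \<open>exp (\<i> k x)\<close>, as a combination of the plane waves \<open>exp (\<i> k (x + t s))\<close> with \<open>-1 \<le> s \<le> 1\<close>: the two
  waves \<open>s = \<plusminus>1\<close>, plus an average over \<open>s\<close> whose weight is built from the Bessel function \<open>J\<^sub>0\<close>.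

  Integrated against the transform of \<open>g\<close> over \<open>[-A, A]\<close>, such a combination becomes the same
  combination of the truncated Fourier inversions of \<open>g\<close> at the points \<open>x + t s\<close>. For \<open>x > t\<close> all these
  points are positive. There, by \<open>fourier_inversion\<close>, the transform at \<open>k\<close> gives back \<open>g\<close> and the
  reflected transform at \<open>-k\<close> gives \<open>0\<close>. The boundary datum acts as a source at the origin,
  whose influence has not yet reached \<open>x\<close>, and contributes \<open>0\<close> as well (\<open>wave_op_source_vanishes\<close>).
  So for \<open>x > t\<close> both fields are given by d'Alembert formulas with Bessel corrections
  (\<open>psi_explicit\<close>), which involve only values of \<open>g\<^sub>1\<close> and \<open>g\<^sub>2\<close> on \<open>[x - t, x + t]\<close>.

  Expressions of this type form a class that is closed under both partial derivatives
  (\<open>kg_class_deriv_x\<close>, \<open>kg_class_deriv_t\<close>) and whose members decay faster than every power of \<open>x\<close>,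
  uniformly for \<open>0 < t \<le> T\<close>, because the data do (\<open>kg_class_decay\<close>). That proves the limits.

  There remains the convergence of each of the twelve integrals. Integration by parts shows that on
  either half-line the integrands are sums of terms \<open>c exp (\<i> \<alpha> k) / k + O(1/k\<^sup>2)\<close> with \<open>\<alpha>\<close> one of
  \<open>\<plusminus>x\<close>, \<open>\<plusminus>x \<plusminus> t\<close>. No such \<open>\<alpha>\<close> vanishes for \<open>0 < t < x\<close>, so the oscillation makes the integrals
  converge (\<open>convergent_tail_oscillating\<close>).\<close>

section \<open>Functions on the half-line\<close>

lemma halfline_deriv_shift: "halfline_deriv b (halfline_deriv c g) = halfline_deriv (b + c) g"
  by (simp add: halfline_deriv_def funpow_add)

lemma smooth_halfline_deriv: "smooth_halfline g \<Longrightarrow> smooth_halfline (halfline_deriv c g)"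
  unfolding smooth_halfline_def by (simp add: halfline_deriv_shift)

lemma schwartz_halfline_deriv: "schwartz_halfline g \<Longrightarrow> schwartz_halfline (halfline_deriv c g)"
  unfolding schwartz_halfline_def by (simp add: halfline_deriv_shift smooth_halfline_deriv)

lemma smooth_halfline_has_deriv_within:
  assumes "smooth_halfline g" "y \<ge> 0"
  shows "(g has_vector_derivative halfline_deriv 1 g y) (at y within {0..})"
proof -
  have "halfline_deriv 0 g differentiable_on {0..}"
    using assms(1) unfolding smooth_halfline_def by blast
  then have "g differentiable (at y within {0..})"
    using assms(2) by (auto simp: halfline_deriv_def differentiable_on_def)
  then show ?thesis
    by (simp add: halfline_deriv_def vector_derivative_works)
qed

lemma smooth_halfline_has_deriv:
  assumes "smooth_halfline g" "y > 0"
  shows "(g has_vector_derivative halfline_deriv 1 g y) (at y)"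
proof -
  have "at y within {0..} = at y"
    using assms(2) by (intro at_within_interior) simp
  then show ?thesis
    using smooth_halfline_has_deriv_within[of g y] assms by simp
qed

lemma smooth_halfline_continuous: "smooth_halfline g \<Longrightarrow> continuous_on {0..} g"
  by (meson atLeast_iff continuous_on_eq_continuous_within has_vector_derivative_continuous
      smooth_halfline_has_deriv_within)

lemma schwartz_halfline_smooth: "schwartz_halfline g \<Longrightarrow> smooth_halfline g"
  by (simp add: schwartz_halfline_def)

lemma schwartz_halfline_power_bound:
  assumes "schwartz_halfline g"
  obtains C where "C \<ge> 0" "\<And>y. y \<ge> 0 \<Longrightarrow> y ^ a * norm (g y) \<le> C"
proof -
  have "bounded ((\<lambda>x. x ^ a *\<^sub>R halfline_deriv 0 g x) ` {0..})"
    using assms unfolding schwartz_halfline_def by blast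
  then obtain C where "\<And>y. y \<ge> 0 \<Longrightarrow> norm (y ^ a *\<^sub>R g y) \<le> C"
    by (auto simp: bounded_iff halfline_deriv_def)
  then have C: "\<And>y. y \<ge> 0 \<Longrightarrow> y ^ a * norm (g y) \<le> C"
    by simp
  then have "0 \<le> C"
    by (meson norm_ge_zero order.trans order_refl mult_nonneg_nonneg zero_le_power)
  with C show ?thesis by (rule that[rotated])
qed

lemma schwartz_halfline_quadratic_decay:
  assumes "schwartz_halfline g"
  obtains C where "C \<ge> 0" "\<And>y. y \<ge> 0 \<Longrightarrow> norm (g y) \<le> C * inverse (1 + y\<^sup>2)"
proof -
  obtain A where A: "A \<ge> 0" "\<And>y. y \<ge> 0 \<Longrightarrow> y ^ 0 * norm (g y) \<le> A"
    using schwartz_halfline_power_bound[OF assms] by blast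
  obtain B where B: "B \<ge> 0" "\<And>y. y \<ge> 0 \<Longrightarrow> y ^ 2 * norm (g y) \<le> B"
    using schwartz_halfline_power_bound[OF assms] by blast
  have "norm (g y) \<le> (A + B) * inverse (1 + y\<^sup>2)" if "y \<ge> 0" for y
  proof -
    have "0 < 1 + y\<^sup>2" by (simp add: add_pos_nonneg)
    moreover have "(1 + y\<^sup>2) * norm (g y) \<le> A + B"
      using A(2)[OF that] B(2)[OF that] by (simp add: distrib_right)
    ultimately show ?thesis by (simp add: field_simps)
  qed
  with A(1) B(1) show ?thesis by (intro that[of "A + B"]) auto
qed

text \<open>Dominated convergence applied to the truncations of \<open>f\<close> to \<open>{a..A}\<close>.\<close>

lemma integrable_on_halfline_dominated:
  fixes f :: "real \<Rightarrow> 'b::euclidean_space"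
  assumes f: "\<And>A. A \<ge> a \<Longrightarrow> f integrable_on {a..A}"
    and h: "h integrable_on {a..}" and le: "\<And>y. y \<ge> a \<Longrightarrow> norm (f y) \<le> h y"
  shows "f integrable_on {a..}"
    and "((\<lambda>A. integral {a..A} f) \<longlongrightarrow> integral {a..} f) at_top"
    and "norm (integral {a..} f) \<le> integral {a..} h"
proof -
  have main: "f integrable_on {a..} \<and> (\<lambda>n. integral {a..X n} f) \<longlonglongrightarrow> integral {a..} f"
    if X: "filterlim X at_top sequentially" for X :: "nat \<Rightarrow> real"
  proof -
    \<comment> \<open>The truncations are extended by zero, so that they live on the fixed set \<open>{a..}\<close>.\<close>
    define fk where "fk = (\<lambda>k y. if y \<in> {a..X k} then f y else 0)"
    have int: "fk k integrable_on {a..}" for k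
    proof (cases "a \<le> X k")
      case True
      then show ?thesis using f[OF True] unfolding fk_def
        by (subst integrable_restrict_Int) (simp add: Int_absorb2 Icc_subset_Ici_iff)
    next
      case False
      then have "fk k = (\<lambda>y. 0)" by (auto simp: fk_def fun_eq_iff)
      then show ?thesis using integrable_0 by metis
    qed
    have eq: "integral {a..} (fk k) = integral {a..X k} f" for k
      unfolding fk_def by (subst integral_restrict_Int) (simp add: Int_absorb2 Icc_subset_Ici_iff)
    have lim: "(\<lambda>k. fk k y) \<longlonglongrightarrow> f y" if "y \<in> {a..}" for y
    proof (rule tendsto_eventually)
      have "\<forall>\<^sub>F k in sequentially. y \<le> X k"
        using X by (simp add: filterlim_at_top)
      then show "\<forall>\<^sub>F k in sequentially. fk k y = f y"
        by eventually_elim (use that in \<open>auto simp: fk_def\<close>)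
    qed
    have bd: "norm (fk k y) \<le> h y" if "y \<in> {a..}" for k y
      using le[of y] norm_ge_zero[of "f y"] that by (auto simp: fk_def simp del: norm_ge_zero)
    from dominated_convergence[of fk "{a..}" h f, OF int h bd lim] show ?thesis
      by (simp add: eq)
  qed
  show int: "f integrable_on {a..}"
    using main[OF filterlim_real_sequentially] by simp
  show "((\<lambda>A. integral {a..A} f) \<longlongrightarrow> integral {a..} f) at_top"
    by (rule tendsto_at_topI_sequentially) (use main in blast)
  show "norm (integral {a..} f) \<le> integral {a..} h"
    by (rule integral_norm_bound_integral[OF int h]) (use le in auto)
qed

lemma inverse_1_plus_square_integrable_on: "(\<lambda>y::real. inverse (1 + y\<^sup>2)) integrable_on {a..}"
proof -
  have "set_integrable lborel (einterval (-\<infinity>) \<infinity>) (\<lambda>y::real. inverse (1 + y\<^sup>2))"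
    by (rule integrable_inverse_1_plus_square)
  then have "set_integrable lborel {a..} (\<lambda>y::real. inverse (1 + y\<^sup>2))"
    by (rule set_integrable_subset) auto
  then show ?thesis by (rule set_borel_integral_eq_integral)
qed

lemma schwartz_halfline_norm_integrable:
  assumes f: "schwartz_halfline f"
  shows "(\<lambda>y. norm (f y)) integrable_on {0..}"
proof -
  obtain D where D: "D \<ge> 0" "\<And>y. y \<ge> 0 \<Longrightarrow> norm (f y) \<le> D * inverse (1 + y\<^sup>2)"
    using schwartz_halfline_quadratic_decay[OF f] by blast
  have fc: "continuous_on {0..} f"
    by (intro smooth_halfline_continuous schwartz_halfline_smooth f)
  have "(\<lambda>y. norm (f y)) integrable_on {0..A}" for A
    by (intro integrable_continuous_real continuous_on_norm continuous_on_subset[OF fc]) auto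
  moreover have "(\<lambda>y. D * inverse (1 + y\<^sup>2)) integrable_on {0..}"
    using integrable_on_cmult_left[OF inverse_1_plus_square_integrable_on, of D] by simp
  ultimately show ?thesis
    by (rule integrable_on_halfline_dominated(1)) (use D in auto)
qed

lemma schwartz_halfline_norm_integrable_cmult:
  assumes "schwartz_halfline f"
  shows "(\<lambda>y. B * norm (f y)) integrable_on {0..}"
  using integrable_on_cmult_left[OF schwartz_halfline_norm_integrable[OF assms], of B] by simp

lemma schwartz_halfline_L1_nonneg:
  "schwartz_halfline f \<Longrightarrow> 0 \<le> integral {0..} (\<lambda>y. norm (f y))"
  by (simp add: integral_nonneg schwartz_halfline_norm_integrable)

text \<open>The \<open>L\<^sup>1\<close> norm of \<open>f\<close> controls every integral against a bounded continuous factor, uniformly in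
  the upper limit. In applications \<open>u\<close> is an exponential or the primitive of the Dirichlet kernel.\<close>

lemma schwartz_halfline_integral:
  fixes f u :: "real \<Rightarrow> complex"
  assumes f: "schwartz_halfline f"
    and u: "continuous_on {0..} u" and bd: "\<And>y. y \<ge> 0 \<Longrightarrow> norm (u y) \<le> B"
  shows "(\<lambda>y. u y * f y) integrable_on {0..}"
    and "((\<lambda>A. integral {0..A} (\<lambda>y. u y * f y)) \<longlongrightarrow> integral {0..} (\<lambda>y. u y * f y)) at_top"
    and "norm (integral {0..} (\<lambda>y. u y * f y)) \<le> B * integral {0..} (\<lambda>y. norm (f y))"
    and "norm (integral {0..A} (\<lambda>y. u y * f y)) \<le> B * integral {0..} (\<lambda>y. norm (f y))"
proof -
  note fc = smooth_halfline_continuous[OF schwartz_halfline_smooth[OF f]]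
  have int: "(\<lambda>y. u y * f y) integrable_on {0..A}" for A
    by (intro integrable_continuous_real continuous_on_mult
        continuous_on_subset[OF u] continuous_on_subset[OF fc]) auto
  have le: "norm (u y * f y) \<le> B * norm (f y)" if "y \<ge> 0" for y
    using bd[OF that] by (simp add: norm_mult mult_right_mono)
  note h = schwartz_halfline_norm_integrable_cmult[OF f, of B]
  note * = integrable_on_halfline_dominated[OF int h le]
  show "(\<lambda>y. u y * f y) integrable_on {0..}" using *(1) by simp
  show "((\<lambda>A. integral {0..A} (\<lambda>y. u y * f y)) \<longlongrightarrow> integral {0..} (\<lambda>y. u y * f y)) at_top"
    using *(2) by simp
  show "norm (integral {0..} (\<lambda>y. u y * f y)) \<le> B * integral {0..} (\<lambda>y. norm (f y))"
    using *(3) by simp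
  have hA: "(\<lambda>y. B * norm (f y)) integrable_on {0..A}"
    by (intro integrable_continuous_real continuous_intros continuous_on_subset[OF fc]) auto
  have "norm (integral {0..A} (\<lambda>y. u y * f y)) \<le> integral {0..A} (\<lambda>y. B * norm (f y))"
    by (rule integral_norm_bound_integral[OF int hA]) (use le in auto)
  also have "\<dots> \<le> integral {0..} (\<lambda>y. B * norm (f y))"
    using order_trans[OF norm_ge_zero bd[of 0]] by (intro integral_subset_le[OF _ hA h]) auto
  finally show "norm (integral {0..A} (\<lambda>y. u y * f y)) \<le> B * integral {0..} (\<lambda>y. norm (f y))"
    by simp
qed

section \<open>The Dirichlet kernel\<close>

text \<open>This is the integral of \<open>exp (\<i> k v)\<close> over \<open>-A \<le> k \<le> A\<close> for \<open>A \<ge> 0\<close>, see \<open>integral_exp_eq_dirichlet_kernel\<close>;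
  in this form it is visibly the derivative of twice the sine integral \<open>Si (A v)\<close>.\<close>

definition dirichlet_kernel :: "real \<Rightarrow> real \<Rightarrow> complex" where
  "dirichlet_kernel A v = of_real (2 * A * sinc (A * v))"

definition dirichlet_primitive :: "real \<Rightarrow> real \<Rightarrow> complex" where
  "dirichlet_primitive A v = of_real (2 * Si (A * v))"

lemma dirichlet_kernel_continuous [continuous_intros]:
  "continuous_on S f \<Longrightarrow> continuous_on S (\<lambda>x. dirichlet_kernel A (f x))"
  unfolding dirichlet_kernel_def by (intro continuous_intros)

lemma dirichlet_primitive_deriv:
  "(dirichlet_primitive A has_vector_derivative dirichlet_kernel A v) (at v)"
proof -
  have "((\<lambda>v. 2 * Si (A * v)) has_real_derivative 2 * A * sinc (A * v)) (at v)"
  proof (rule DERIV_cong)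
    show "((\<lambda>v. 2 * Si (A * v)) has_real_derivative 2 * (sinc (A * v) * A)) (at v)"
      by (rule DERIV_cmult[OF DERIV_chain2[where f = Si and g = "\<lambda>v. A * v", OF DERIV_Si DERIV_cmult_Id]])
  qed simp
  then have "((\<lambda>v. complex_of_real (2 * Si (A * v))) has_vector_derivative of_real (2 * A * sinc (A * v))) (at v)"
    by (intro has_vector_derivative_of_real) (simp add: has_real_derivative_iff_has_vector_derivative)
  then show ?thesis
    unfolding dirichlet_primitive_def[abs_def] dirichlet_kernel_def .
qed

lemma dirichlet_primitive_continuous [continuous_intros]:
  "continuous_on S f \<Longrightarrow> continuous_on S (\<lambda>x. dirichlet_primitive A (f x))"
  unfolding dirichlet_primitive_def
  by (intro continuous_intros continuous_on_compose2[of UNIV Si S "\<lambda>x. A * f x"])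
    (auto intro: continuous_at_imp_continuous_on isCont_Si)

text \<open>The kernel itself has no limit as \<open>A\<close> grows and its \<open>L\<^sup>1\<close> norm is unbounded. Its primitive is bounded
  uniformly in \<open>A\<close> and converges pointwise to \<open>\<pi> sgn v\<close>. For this reason every limit below is
  taken after an integration by parts that puts the primitive in place of the kernel.\<close>

lemma dirichlet_primitive_bounded:
  obtains B where "B \<ge> 0" "\<And>A v. norm (dirichlet_primitive A v) \<le> B"
proof -
  obtain B where "\<And>T. \<bar>Si T\<bar> \<le> B" using bounded_Si by blast
  then have B: "\<And>A v. norm (dirichlet_primitive A v) \<le> 2 * B"
    by (auto simp: dirichlet_primitive_def norm_mult)
  moreover have "0 \<le> 2 * B"
    using order_trans[OF norm_ge_zero B] .
  ultimately show ?thesis using that by blast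
qed

lemma dirichlet_primitive_pos:
  assumes "v > 0"
  shows "((\<lambda>A. dirichlet_primitive A v) \<longlongrightarrow> of_real pi) at_top"
proof -
  have "filterlim (\<lambda>A. A * v) at_top at_top"
    using assms by (simp add: filterlim_at_top_mult_tendsto_pos[OF tendsto_const] filterlim_ident mult.commute)
  from filterlim_compose[OF Si_at_top this]
  have "((\<lambda>A. 2 * Si (A * v)) \<longlongrightarrow> 2 * (pi / 2)) at_top"
    by (intro tendsto_intros)
  then have "((\<lambda>A. complex_of_real (2 * Si (A * v))) \<longlongrightarrow> of_real (2 * (pi / 2))) at_top"
    by (rule tendsto_of_real)
  then show ?thesis unfolding dirichlet_primitive_def by simp
qed

lemma dirichlet_primitive_minus:
  assumes "A \<ge> 0" shows "dirichlet_primitive A (- v) = - dirichlet_primitive A v"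
proof (cases "v \<ge> 0")
  case True
  then show ?thesis using Si_neg[of "A * v"] assms by (simp add: dirichlet_primitive_def)
next
  case False
  then show ?thesis using Si_neg[of "A * (-v)"] assms by (simp add: dirichlet_primitive_def mult_nonneg_nonpos)
qed

lemma dirichlet_primitive_0: "dirichlet_primitive A 0 = 0"
  using Si_neg[of 0] by (simp add: dirichlet_primitive_def)

lemma dirichlet_primitive_neg:
  assumes "v < 0"
  shows "((\<lambda>A. dirichlet_primitive A v) \<longlongrightarrow> - of_real pi) at_top"
proof (rule Lim_transform_eventually)
  show "((\<lambda>A. - dirichlet_primitive A (- v)) \<longlongrightarrow> - of_real pi) at_top"
    using assms by (intro tendsto_minus dirichlet_primitive_pos) simp
  show "\<forall>\<^sub>F A in at_top. - dirichlet_primitive A (- v) = dirichlet_primitive A v"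
    using eventually_ge_at_top[of 0] by eventually_elim (simp add: dirichlet_primitive_minus)
qed

text \<open>Away from the singular point the kernel is bounded independently of \<open>A\<close>; this provides the
  majorant for the sources, which stay at distance at least \<open>x - t\<close> from it.\<close>

lemma dirichlet_kernel_bound:
  assumes "d > 0" "v \<ge> d"
  shows "norm (dirichlet_kernel A v) \<le> 2 / d"
proof (cases "A = 0")
  case True
  then show ?thesis using assms by (simp add: dirichlet_kernel_def)
next
  case False
  then have "norm (dirichlet_kernel A v) = \<bar>2 * sin (A * v) / v\<bar>"
    using assms by (simp only: dirichlet_kernel_def norm_of_real) (simp add: abs_mult)
  also have "\<dots> \<le> 2 / v"
    using assms by (simp add: abs_mult divide_right_mono)
  also have "\<dots> \<le> 2 / d"
    using assms by (intro divide_left_mono) auto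
  finally show ?thesis .
qed

lemma integral_exp_eq_dirichlet_kernel:
  assumes A: "A \<ge> 0"
  shows "integral {-A..A} (\<lambda>k. exp (\<i> * of_real k * of_real v)) = dirichlet_kernel A v"
proof (cases "v = 0")
  case True
  then show ?thesis using A by (simp add: dirichlet_kernel_def scaleR_conv_of_real)
next
  case False
  define F where "F = (\<lambda>k::real. exp (\<i> * of_real k * of_real v) / (\<i> * of_real v))"
  have "((\<lambda>k. exp (\<i> * of_real k * of_real v)) has_integral F A - F (-A)) {-A..A}"
  proof (rule fundamental_theorem_of_calculus)
    show "-A \<le> A" using A by simp
    fix k assume "k \<in> {-A..A}"
    have "((\<lambda>k. exp (\<i> * k * of_real v) / (\<i> * of_real v)) has_field_derivative
        exp (\<i> * of_real k * of_real v)) (at (of_real k))"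
      using False by (auto intro!: derivative_eq_intros)
    from has_vector_derivative_real_field[OF this]
    show "(F has_vector_derivative exp (\<i> * of_real k * of_real v)) (at k within {-A..A})"
      unfolding F_def by simp
  qed
  then have "integral {-A..A} (\<lambda>k. exp (\<i> * of_real k * of_real v)) = F A - F (-A)"
    by (rule integral_unique)
  also have "\<dots> = of_real (2 * sin (A * v) / v)"
  proof -
    have 1: "exp (\<i> * of_real A * of_real v) = cis (A * v)" "exp (\<i> * of_real (-A) * of_real v) = cis (- (A * v))"
      by (simp_all add: cis_conv_exp mult_ac)
    show ?thesis unfolding F_def 1 using False
      by (simp add: complex_eq_iff Re_divide Im_divide power2_eq_square)
  qed
  also have "\<dots> = dirichlet_kernel A v"
    using False by (simp add: dirichlet_kernel_def)
  finally show ?thesis .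
qed

section \<open>Fourier inversion on the half-line\<close>

abbreviation fourier_kernel :: "real \<Rightarrow> real \<Rightarrow> complex" where
  "fourier_kernel k y \<equiv> exp (- \<i> * of_real k * of_real y)"

lemma norm_fourier_kernel: "norm (fourier_kernel k y) \<le> 1"
proof -
  have "fourier_kernel k y = cis (- (k * y))" by (simp add: cis_conv_exp mult.assoc)
  then show ?thesis by simp
qed

lemma fourier_kernel_continuous: "continuous_on S (fourier_kernel k)"
  by (intro continuous_intros)

lemma halfline_fourier_bounded:
  assumes f: "schwartz_halfline f"
  shows "norm (halfline_fourier f k) \<le> integral {0..} (\<lambda>y. norm (f y))"
    and "norm (integral {0..A} (\<lambda>y. fourier_kernel k y * f y)) \<le> integral {0..} (\<lambda>y. norm (f y))"
  using schwartz_halfline_integral(3,4)[OF f fourier_kernel_continuous norm_fourier_kernel] by (simp_all add: halfline_fourier_def)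

lemma halfline_fourier_continuous:
  assumes f: "schwartz_halfline f"
  shows "continuous_on UNIV (halfline_fourier f)"
proof -
  have "halfline_fourier f \<midarrow>k\<rightarrow> halfline_fourier f k" for k
  proof (rule LIM_offset_zero_cancel, rule tendsto_at_iff_sequentially[THEN iffD2], intro allI impI)
    fix X :: "nat \<Rightarrow> real" assume X: "X \<longlonglongrightarrow> 0"
    have "(\<lambda>n. integral {0..} (\<lambda>y. fourier_kernel (k + X n) y * f y)) \<longlonglongrightarrow> integral {0..} (\<lambda>y. fourier_kernel k y * f y)"
    proof (rule dominated_convergence(2))
      show "(\<lambda>y. fourier_kernel (k + X n) y * f y) integrable_on {0..}" for n
        by (rule schwartz_halfline_integral[OF f fourier_kernel_continuous norm_fourier_kernel])
      show "(\<lambda>y. norm (f y)) integrable_on {0..}"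
        by (rule schwartz_halfline_norm_integrable[OF f])
      show "norm (fourier_kernel (k + X n) y * f y) \<le> norm (f y)" if "y \<in> {0..}" for n y
        using mult_right_mono[OF norm_fourier_kernel norm_ge_zero] by (simp add: norm_mult)
      show "(\<lambda>n. fourier_kernel (k + X n) y * f y) \<longlonglongrightarrow> fourier_kernel k y * f y" if "y \<in> {0..}" for y
        using X by (auto intro!: tendsto_eq_intros)
    qed
    then show "((\<lambda>h. halfline_fourier f (k + h)) \<circ> X) \<longlonglongrightarrow> halfline_fourier f k"
      by (simp add: halfline_fourier_def o_def)
  qed
  then show ?thesis by (simp add: continuous_on_def)
qed

lemma schwartz_halfline_tendsto_0:
  assumes f: "schwartz_halfline f"
  shows "(f \<longlongrightarrow> 0) at_top"
proof -
  obtain C where C: "C \<ge> 0" "\<And>y. y \<ge> 0 \<Longrightarrow> norm (f y) \<le> C * inverse (1 + y\<^sup>2)"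
    by (rule schwartz_halfline_quadratic_decay[OF f], rule that)
  have "((\<lambda>y::real. C * inverse (1 + y\<^sup>2)) \<longlongrightarrow> C * 0) at_top"
    by (intro tendsto_mult tendsto_const tendsto_inverse_0_at_top filterlim_tendsto_add_at_top
        filterlim_pow_at_top filterlim_ident) auto
  then have "((\<lambda>y::real. C * inverse (1 + y\<^sup>2)) \<longlongrightarrow> 0) at_top" by simp
  moreover have "\<forall>\<^sub>F y in at_top. norm (f y) \<le> C * inverse (1 + y\<^sup>2)"
    using eventually_ge_at_top[of 0] by eventually_elim (rule C(2))
  ultimately show ?thesis
    by (rule Lim_null_comparison[rotated])
qed

text \<open>The improper integral of \<open>q f\<close> is stated as a limit because \<open>q\<close> is not assumed bounded; only its
  primitive \<open>p\<close> is.\<close>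

lemma halfline_integration_by_parts:
  fixes f p q :: "real \<Rightarrow> complex"
  assumes f: "schwartz_halfline f"
    and p: "\<And>y. (p has_vector_derivative q y) (at y)"
    and q: "continuous_on UNIV q"
    and bd: "\<And>y. y \<ge> 0 \<Longrightarrow> norm (p y) \<le> B"
  shows "((\<lambda>Y. integral {0..Y} (\<lambda>y. q y * f y)) \<longlongrightarrow>
      - p 0 * f 0 - integral {0..} (\<lambda>y. p y * halfline_deriv 1 f y)) at_top"
proof -
  note f' = schwartz_halfline_deriv[OF f, of 1]
  have pc: "continuous_on S p" for S
    by (meson p continuous_at_imp_continuous_on has_vector_derivative_continuous)
  have fc: "continuous_on {0..} f" "continuous_on {0..} (halfline_deriv 1 f)"
    by (intro smooth_halfline_continuous schwartz_halfline_smooth f f')+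
  have lim: "((\<lambda>Y. p Y * f Y) \<longlongrightarrow> 0) at_top"
  proof (rule Lim_null_comparison[where g = "\<lambda>Y. B * norm (f Y)"])
    show "\<forall>\<^sub>F Y in at_top. norm (p Y * f Y) \<le> B * norm (f Y)"
      using eventually_ge_at_top[of 0]
      by eventually_elim (auto simp: norm_mult intro!: mult_right_mono bd)
    show "((\<lambda>Y. B * norm (f Y)) \<longlongrightarrow> 0) at_top"
      using schwartz_halfline_tendsto_0[OF f] by (auto intro!: tendsto_eq_intros)
  qed
  have eq: "integral {0..Y} (\<lambda>y. q y * f y) = p Y * f Y - p 0 * f 0
      - integral {0..Y} (\<lambda>y. p y * halfline_deriv 1 f y)" if "Y \<ge> 0" for Y
  proof -
    have "((\<lambda>y. p y * halfline_deriv 1 f y + q y * f y) has_integral p Y * f Y - p 0 * f 0) {0..Y}"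
    proof (rule fundamental_theorem_of_calculus[OF that])
      fix y assume y: "y \<in> {0..Y}"
      have "(f has_vector_derivative halfline_deriv 1 f y) (at y within {0..Y})"
        using y by (intro has_vector_derivative_within_subset[OF smooth_halfline_has_deriv_within]
            schwartz_halfline_smooth f) auto
      then show "((\<lambda>y. p y * f y) has_vector_derivative p y * halfline_deriv 1 f y + q y * f y)
          (at y within {0..Y})"
        by (intro has_vector_derivative_mult has_vector_derivative_at_within[OF p])
    qed
    moreover have "(\<lambda>y. p y * halfline_deriv 1 f y) integrable_on {0..Y}"
      by (intro integrable_continuous_real continuous_on_mult pc continuous_on_subset[OF fc(2)]) auto
    moreover have "(\<lambda>y. q y * f y) integrable_on {0..Y}"
      by (intro integrable_continuous_real continuous_on_mult continuous_on_subset[OF q]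
          continuous_on_subset[OF fc(1)]) auto
    ultimately show ?thesis
      by (simp add: integral_unique integral_add[symmetric] algebra_simps eq_diff_eq)
  qed
  have "((\<lambda>Y. p Y * f Y - p 0 * f 0 - integral {0..Y} (\<lambda>y. p y * halfline_deriv 1 f y)) \<longlongrightarrow>
     0 - p 0 * f 0 - integral {0..} (\<lambda>y. p y * halfline_deriv 1 f y)) at_top"
    by (intro tendsto_diff lim tendsto_const schwartz_halfline_integral(2)[OF f' pc bd])
  then have "((\<lambda>Y. p Y * f Y - p 0 * f 0 - integral {0..Y} (\<lambda>y. p y * halfline_deriv 1 f y)) \<longlongrightarrow>
     - p 0 * f 0 - integral {0..} (\<lambda>y. p y * halfline_deriv 1 f y)) at_top"
    by simp
  then show ?thesis
    by (rule Lim_transform_eventually)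
      (rule eventually_mono[OF eventually_ge_at_top[of 0]], simp add: eq)
qed

lemma halfline_fourier_by_parts:
  assumes f: "schwartz_halfline f" and k: "k \<noteq> 0"
  shows "halfline_fourier f k = (f 0 + halfline_fourier (halfline_deriv 1 f) k) / (\<i> * of_real k)"
proof -
  define p where "p = (\<lambda>y. fourier_kernel k y / (- \<i> * of_real k))"
  have p: "(p has_vector_derivative fourier_kernel k y) (at y)" for y
  proof -
    have "((\<lambda>y. exp (- \<i> * of_real k * y) / (- \<i> * of_real k)) has_field_derivative fourier_kernel k y) (at (of_real y))"
      using k by (auto intro!: derivative_eq_intros)
    from has_vector_derivative_real_field[OF this] show ?thesis unfolding p_def by simp
  qed
  have bd: "norm (p y) \<le> 1 / \<bar>k\<bar>" for y
    using norm_fourier_kernel[of k y] by (simp add: p_def norm_divide norm_mult divide_right_mono)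
  have "halfline_fourier f k = - p 0 * f 0 - integral {0..} (\<lambda>y. p y * halfline_deriv 1 f y)"
  proof (rule tendsto_unique[OF trivial_limit_at_top_linorder])
    show "((\<lambda>Y. integral {0..Y} (\<lambda>y. fourier_kernel k y * f y)) \<longlongrightarrow> halfline_fourier f k) at_top"
      unfolding halfline_fourier_def
      by (rule schwartz_halfline_integral(2)[OF f fourier_kernel_continuous norm_fourier_kernel])
    show "((\<lambda>Y. integral {0..Y} (\<lambda>y. fourier_kernel k y * f y)) \<longlongrightarrow>
        - p 0 * f 0 - integral {0..} (\<lambda>y. p y * halfline_deriv 1 f y)) at_top"
      by (rule halfline_integration_by_parts[OF f p fourier_kernel_continuous bd])
  qed
  also have "integral {0..} (\<lambda>y. p y * halfline_deriv 1 f y)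
      = integral {0..} (\<lambda>y. fourier_kernel k y * halfline_deriv 1 f y) / (- \<i> * of_real k)"
    unfolding integral_divide[symmetric] by (simp add: p_def)
  finally show ?thesis
    using k by (simp add: p_def halfline_fourier_def divide_simps)
qed

text \<open>The Fourier inversion integral truncated to \<open>-A \<le> k \<le> A\<close>, without the factor \<open>1/(2 \<pi>)\<close>.\<close>

definition partial_inversion :: "real \<Rightarrow> (real \<Rightarrow> complex) \<Rightarrow> real \<Rightarrow> complex" where
  "partial_inversion A f z = integral {-A..A} (\<lambda>k. exp (\<i> * of_real k * of_real z) * halfline_fourier f k)"

text \<open>By Fubini on \<open>[-A, A] \<times> [0, Y]\<close> the truncated inversion is the convolution of \<open>f\<close> with the
  Dirichlet kernel. Integrating by parts trades the kernel for its bounded primitive, at the cost of a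
  derivative on \<open>f\<close> and of a boundary term from the jump of the zero extension of \<open>f\<close> at the origin.\<close>

lemma partial_inversion_eq:
  assumes f: "schwartz_halfline f" and A: "A \<ge> 0"
  shows "partial_inversion A f z = dirichlet_primitive A z * f 0 +
     integral {0..} (\<lambda>y. dirichlet_primitive A (z - y) * halfline_deriv 1 f y)"
proof -
  obtain B where B: "B \<ge> 0" "\<And>A v. norm (dirichlet_primitive A v) \<le> B"
    by (rule dirichlet_primitive_bounded, rule that)
  define C where "C = integral {0..} (\<lambda>y. norm (f y))"
  have C: "\<And>k Y. norm (integral {0..Y} (\<lambda>y. fourier_kernel k y * f y)) \<le> C"
    unfolding C_def by (rule halfline_fourier_bounded[OF f])
  have fc: "continuous_on {0..} f"
    by (intro smooth_halfline_continuous schwartz_halfline_smooth f)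
  have swap: "integral {-A..A} (\<lambda>k. exp (\<i> * of_real k * of_real z) * integral {0..Y} (\<lambda>y. fourier_kernel k y * f y))
      = integral {0..Y} (\<lambda>y. dirichlet_kernel A (z - y) * f y)" for Y
  proof -
    have "integral {-A..A} (\<lambda>k. exp (\<i> * of_real k * of_real z) * integral {0..Y} (\<lambda>y. fourier_kernel k y * f y))
       = integral (cbox (-A) A) (\<lambda>k. integral (cbox 0 Y) (\<lambda>y. exp (\<i> * of_real k * of_real z) * (fourier_kernel k y * f y)))"
      by simp
    also have "\<dots> = integral (cbox 0 Y) (\<lambda>y. integral (cbox (-A) A) (\<lambda>k. exp (\<i> * of_real k * of_real z) * (fourier_kernel k y * f y)))"
      by (rule integral_swap_continuous)
        (auto simp: case_prod_unfold cbox_Pair_eq intro!: continuous_intros continuous_on_compose2[OF fc])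
    also have "\<dots> = integral {0..Y} (\<lambda>y. dirichlet_kernel A (z - y) * f y)"
    proof (simp only: cbox_interval, rule integral_cong)
      fix y
      have "integral {-A..A} (\<lambda>k. exp (\<i> * of_real k * of_real z) * (fourier_kernel k y * f y))
          = integral {-A..A} (\<lambda>k. exp (\<i> * of_real k * of_real (z - y)) * f y)"
        by (rule integral_cong) (simp add: exp_add[symmetric] algebra_simps)
      then show "integral {-A..A} (\<lambda>k. exp (\<i> * of_real k * of_real z) * (fourier_kernel k y * f y))
          = dirichlet_kernel A (z - y) * f y"
        by (simp only: integral_mult_left integral_exp_eq_dirichlet_kernel[OF A])
    qed
    finally show ?thesis .
  qed
  have lim1: "(\<lambda>n. integral {-A..A} (\<lambda>k. exp (\<i> * of_real k * of_real z) *
      integral {0..real n} (\<lambda>y. fourier_kernel k y * f y))) \<longlonglongrightarrow> partial_inversion A f z"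
    unfolding partial_inversion_def
  proof (rule dominated_convergence(2))
    have "continuous_on {-A..A} (\<lambda>k. integral (cbox 0 (real n)) (\<lambda>y. fourier_kernel k y * f y))" for n
      by (rule integral_continuous_on_param)
        (auto simp: case_prod_unfold intro!: continuous_intros continuous_on_compose2[OF fc])
    then show "(\<lambda>k. exp (\<i> * of_real k * of_real z) * integral {0..real n} (\<lambda>y. fourier_kernel k y * f y))
        integrable_on {-A..A}" for n
      by (intro integrable_continuous_real continuous_intros) simp
    show "(\<lambda>k. C) integrable_on {-A..A}" by (rule integrable_continuous_real) simp
    show "norm (exp (\<i> * of_real k * of_real z) * integral {0..real n} (\<lambda>y. fourier_kernel k y * f y)) \<le> C" for k n
      using C by (simp add: norm_mult)
    show "(\<lambda>n. exp (\<i> * of_real k * of_real z) * integral {0..real n} (\<lambda>y. fourier_kernel k y * f y))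
        \<longlonglongrightarrow> exp (\<i> * of_real k * of_real z) * halfline_fourier f k" for k
      unfolding halfline_fourier_def
      by (intro tendsto_mult tendsto_const filterlim_compose[OF _ filterlim_real_sequentially]
          schwartz_halfline_integral(2)[OF f fourier_kernel_continuous norm_fourier_kernel])
  qed
  have p: "((\<lambda>y. - dirichlet_primitive A (z - y)) has_vector_derivative dirichlet_kernel A (z - y)) (at y)" for y
  proof -
    have "((\<lambda>y. z - y) has_vector_derivative - 1) (at y)"
      by (auto intro!: derivative_eq_intros)
    from has_vector_derivative_minus[OF vector_diff_chain_at[OF this dirichlet_primitive_deriv[of A]]]
    show ?thesis by (simp add: o_def)
  qed
  have "((\<lambda>Y. integral {0..Y} (\<lambda>y. dirichlet_kernel A (z - y) * f y)) \<longlongrightarrow>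
      - (- dirichlet_primitive A (z - 0)) * f 0 -
      integral {0..} (\<lambda>y. - dirichlet_primitive A (z - y) * halfline_deriv 1 f y)) at_top"
    by (rule halfline_integration_by_parts[OF f p, of B])
      (use B in \<open>auto intro!: continuous_intros\<close>)
  from filterlim_compose[OF this filterlim_real_sequentially]
  have "(\<lambda>n. integral {0..real n} (\<lambda>y. dirichlet_kernel A (z - y) * f y)) \<longlonglongrightarrow>
      dirichlet_primitive A z * f 0 + integral {0..} (\<lambda>y. dirichlet_primitive A (z - y) * halfline_deriv 1 f y)"
    by simp
  with lim1 show ?thesis
    unfolding swap by (rule LIMSEQ_unique)
qed

text \<open>Uniformity in \<open>z\<close> holds across the jump at \<open>z = 0\<close> too; it gives the majorant under which averages
  of truncated inversions converge.\<close>

lemma partial_inversion_bounded: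
  assumes f: "schwartz_halfline f"
  obtains B where "B \<ge> 0" "\<And>A z. A \<ge> 0 \<Longrightarrow> norm (partial_inversion A f z) \<le> B"
proof -
  note f' = schwartz_halfline_deriv[OF f, of 1]
  obtain B where B: "B \<ge> 0" "\<And>A v. norm (dirichlet_primitive A v) \<le> B"
    by (rule dirichlet_primitive_bounded, rule that)
  define C where "C = integral {0..} (\<lambda>y. norm (halfline_deriv 1 f y))"
  have C: "C \<ge> 0" unfolding C_def by (rule schwartz_halfline_L1_nonneg[OF f'])
  have "norm (partial_inversion A f z) \<le> B * norm (f 0) + B * C" if "A \<ge> 0" for A z
    unfolding partial_inversion_eq[OF f that] C_def
    by (intro order_trans[OF norm_triangle_ineq] add_mono schwartz_halfline_integral(3)[OF f'])
      (use B in \<open>auto simp: norm_mult intro!: continuous_intros mult_right_mono\<close>)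
  then show ?thesis using B(1) C by (intro that[of "B * norm (f 0) + B * C"]) auto
qed

lemma dominated_convergence_at_top:
  fixes F :: "real \<Rightarrow> real \<Rightarrow> complex"
  assumes int: "\<And>A. A \<ge> 0 \<Longrightarrow> F A integrable_on S" and h: "h integrable_on S"
    and le: "\<And>A y. A \<ge> 0 \<Longrightarrow> y \<in> S \<Longrightarrow> norm (F A y) \<le> h y"
    and lim: "\<And>y. y \<in> S \<Longrightarrow> ((\<lambda>A. F A y) \<longlongrightarrow> g y) at_top"
  shows "((\<lambda>A. integral S (F A)) \<longlongrightarrow> integral S g) at_top"
proof (rule tendsto_at_topI_sequentially)
  fix X :: "nat \<Rightarrow> real" assume X: "filterlim X at_top sequentially"
  then obtain N where N: "\<And>n. n \<ge> N \<Longrightarrow> X n \<ge> 0"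
    by (auto simp: filterlim_at_top eventually_sequentially)
  have X': "filterlim (\<lambda>n. X (n + N)) at_top sequentially"
    by (rule filterlim_compose[OF X filterlim_add_const_nat_at_top])
  show "(\<lambda>n. integral S (F (X n))) \<longlonglongrightarrow> integral S g"
    by (rule LIMSEQ_offset[of _ N], rule dominated_convergence(2)[OF _ h])
      (use int le N in \<open>auto intro!: filterlim_compose[OF lim X']\<close>)
qed

lemma fourier_inversion_sgn:
  assumes f: "schwartz_halfline f"
  shows "((\<lambda>A. partial_inversion A f z) \<longlongrightarrow> of_real pi * (of_real (sgn z) * f 0 +
     integral {0..} (\<lambda>y. of_real (sgn (z - y)) * halfline_deriv 1 f y))) at_top"
proof -
  note f' = schwartz_halfline_deriv[OF f, of 1]
  obtain B where B: "B \<ge> 0" "\<And>A v. norm (dirichlet_primitive A v) \<le> B"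
    by (rule dirichlet_primitive_bounded, rule that)
  have lim: "((\<lambda>A. dirichlet_primitive A v) \<longlongrightarrow> of_real (pi * sgn v)) at_top" for v
    using dirichlet_primitive_pos[of v] dirichlet_primitive_neg[of v]
    by (cases v "0 :: real" rule: linorder_cases)
      (simp_all add: dirichlet_primitive_0)
  have "((\<lambda>A. integral {0..} (\<lambda>y. dirichlet_primitive A (z - y) * halfline_deriv 1 f y)) \<longlongrightarrow>
     integral {0..} (\<lambda>y. of_real (pi * sgn (z - y)) * halfline_deriv 1 f y)) at_top"
  proof (rule dominated_convergence_at_top)
    show "(\<lambda>y. dirichlet_primitive A (z - y) * halfline_deriv 1 f y) integrable_on {0..}" for A
      by (rule schwartz_halfline_integral(1)[OF f' _ B(2)]) (intro continuous_intros)
    show "(\<lambda>y. B * norm (halfline_deriv 1 f y)) integrable_on {0..}"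
      by (rule schwartz_halfline_norm_integrable_cmult[OF f'])
    show "norm (dirichlet_primitive A (z - y) * halfline_deriv 1 f y) \<le> B * norm (halfline_deriv 1 f y)" for A y
      unfolding norm_mult by (intro mult_right_mono B norm_ge_zero)
    show "((\<lambda>A. dirichlet_primitive A (z - y) * halfline_deriv 1 f y) \<longlongrightarrow>
        of_real (pi * sgn (z - y)) * halfline_deriv 1 f y) at_top" for y
      by (intro tendsto_mult lim tendsto_const)
  qed
  also have "integral {0..} (\<lambda>y. of_real (pi * sgn (z - y)) * halfline_deriv 1 f y)
      = of_real pi * integral {0..} (\<lambda>y. of_real (sgn (z - y)) * halfline_deriv 1 f y)"
    by (simp add: mult.assoc)
  finally have "((\<lambda>A. dirichlet_primitive A z * f 0 +
      integral {0..} (\<lambda>y. dirichlet_primitive A (z - y) * halfline_deriv 1 f y)) \<longlongrightarrow>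
      of_real (pi * sgn z) * f 0 +
      of_real pi * integral {0..} (\<lambda>y. of_real (sgn (z - y)) * halfline_deriv 1 f y)) at_top"
    by (intro tendsto_add tendsto_mult lim tendsto_const)
  then have "((\<lambda>A. partial_inversion A f z) \<longlongrightarrow> of_real (pi * sgn z) * f 0 +
      of_real pi * integral {0..} (\<lambda>y. of_real (sgn (z - y)) * halfline_deriv 1 f y)) at_top"
    by (rule Lim_transform_eventually)
      (rule eventually_mono[OF eventually_ge_at_top[of 0]], simp add: partial_inversion_eq[OF f])
  then show ?thesis by (simp add: algebra_simps)
qed

lemma schwartz_halfline_FTC:
  assumes f: "schwartz_halfline f" and ab: "0 \<le> a" "a \<le> b"
  shows "(halfline_deriv 1 f has_integral f b - f a) {a..b}"
  using ab by (intro fundamental_theorem_of_calculus has_vector_derivative_within_subset[OF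
        smooth_halfline_has_deriv_within[OF schwartz_halfline_smooth[OF f]]]) auto

text \<open>Pointwise Fourier inversion for the extension of \<open>f\<close> by zero. Off the origin the limit
  \<open>\<pi> sgn\<close> of the primitive splits the integral of \<open>f'\<close> at \<open>z\<close>, and the fundamental theorem of calculus
  evaluates the two parts.\<close>

lemma fourier_inversion:
  assumes f: "schwartz_halfline f"
  shows "z > 0 \<Longrightarrow> ((\<lambda>A. partial_inversion A f z) \<longlongrightarrow> of_real (2 * pi) * f z) at_top"
    and "z < 0 \<Longrightarrow> ((\<lambda>A. partial_inversion A f z) \<longlongrightarrow> 0) at_top"
proof -
  note f' = schwartz_halfline_deriv[OF f, of 1]
  note f0 = schwartz_halfline_tendsto_0[OF f]
  note h = schwartz_halfline_norm_integrable[OF f']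
  have bd: "norm (of_real (sgn (z - y)) * halfline_deriv 1 f y) \<le> norm (halfline_deriv 1 f y)" for y
    by (auto simp: norm_mult sgn_if)
  show "((\<lambda>A. partial_inversion A f z) \<longlongrightarrow> of_real (2 * pi) * f z) at_top" if z: "z > 0"
  proof -
    have split: "((\<lambda>y. of_real (sgn (z - y)) * halfline_deriv 1 f y) has_integral
        (f z - f 0) + - (f Y - f z)) {0..Y}" if Y: "Y \<ge> z" for Y
    proof (rule has_integral_combine)
      show "0 \<le> z" "z \<le> Y" using z Y by auto
      show "((\<lambda>y. of_real (sgn (z - y)) * halfline_deriv 1 f y) has_integral f z - f 0) {0..z}"
        by (rule has_integral_spike_finite[OF _ _ schwartz_halfline_FTC[OF f], of "{z}"])
          (use z in \<open>auto simp: sgn_if\<close>)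
      show "((\<lambda>y. of_real (sgn (z - y)) * halfline_deriv 1 f y) has_integral - (f Y - f z)) {z..Y}"
        by (rule has_integral_spike_finite[OF _ _ has_integral_neg[OF schwartz_halfline_FTC[OF f]], of "{z}"])
          (use z Y in \<open>auto simp: sgn_if\<close>)
    qed
    have int: "(\<lambda>y. of_real (sgn (z - y)) * halfline_deriv 1 f y) integrable_on {0..A}" if "A \<ge> 0" for A
    proof (rule integrable_subinterval_real)
      show "(\<lambda>y. of_real (sgn (z - y)) * halfline_deriv 1 f y) integrable_on {0..max z A}"
        using split[of "max z A"] by (auto simp: integrable_on_def)
    qed simp
    have "((\<lambda>Y. integral {0..Y} (\<lambda>y. of_real (sgn (z - y)) * halfline_deriv 1 f y)) \<longlongrightarrow>
         (f z - f 0) + - (0 - f z)) at_top"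
    proof (rule Lim_transform_eventually)
      show "((\<lambda>Y. (f z - f 0) + - (f Y - f z)) \<longlongrightarrow> (f z - f 0) + - (0 - f z)) at_top"
        by (intro tendsto_intros f0)
      show "\<forall>\<^sub>F Y in at_top. (f z - f 0) + - (f Y - f z)
          = integral {0..Y} (\<lambda>y. of_real (sgn (z - y)) * halfline_deriv 1 f y)"
        using eventually_ge_at_top[of z] by eventually_elim (rule integral_unique[OF split, symmetric])
    qed
    from tendsto_unique[OF trivial_limit_at_top_linorder
        integrable_on_halfline_dominated(2)[OF int h bd] this]
    show ?thesis
      using fourier_inversion_sgn[OF f, of z] z by (simp add: algebra_simps)
  qed
  show "((\<lambda>A. partial_inversion A f z) \<longlongrightarrow> 0) at_top" if z: "z < 0"
  proof -
    have split: "((\<lambda>y. of_real (sgn (z - y)) * halfline_deriv 1 f y) has_integral - (f Y - f 0)) {0..Y}"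
      if Y: "Y \<ge> 0" for Y
      by (rule has_integral_eq[OF _ has_integral_neg[OF schwartz_halfline_FTC[OF f]]])
        (use z Y in \<open>auto simp: sgn_if\<close>)
    have int: "(\<lambda>y. of_real (sgn (z - y)) * halfline_deriv 1 f y) integrable_on {0..A}" if "A \<ge> 0" for A
      using split[OF that] by (auto simp: integrable_on_def)
    have "((\<lambda>Y. integral {0..Y} (\<lambda>y. of_real (sgn (z - y)) * halfline_deriv 1 f y)) \<longlongrightarrow>
         - (0 - f 0)) at_top"
    proof (rule Lim_transform_eventually)
      show "((\<lambda>Y. - (f Y - f 0)) \<longlongrightarrow> - (0 - f 0)) at_top"
        by (intro tendsto_intros f0)
      show "\<forall>\<^sub>F Y in at_top. - (f Y - f 0)
          = integral {0..Y} (\<lambda>y. of_real (sgn (z - y)) * halfline_deriv 1 f y)"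
        using eventually_ge_at_top[of 0] by eventually_elim (rule integral_unique[OF split, symmetric])
    qed
    from tendsto_unique[OF trivial_limit_at_top_linorder
        integrable_on_halfline_dominated(2)[OF int h bd] this]
    show ?thesis
      using fourier_inversion_sgn[OF f, of z] z by (simp add: algebra_simps)
  qed
qed

section \<open>Bessel averages over the light cone\<close>

text \<open>With the Bessel function \<open>J\<^sub>0\<close> one has \<open>bessel m 0 (v\<^sup>2) = J\<^sub>0 (m v)\<close>, and \<open>bessel m r\<close> is the \<open>r\<close>-th
  derivative of \<open>bessel m 0\<close>. Taking the square of the argument of \<open>J\<^sub>0\<close> as the variable makes these
  functions entire, so that no square root of \<open>t\<^sup>2 - s\<^sup>2\<close> appears at the edge of the light cone.\<close>

definition bessel :: "real \<Rightarrow> nat \<Rightarrow> real \<Rightarrow> real" where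
  "bessel m r u = (\<Sum>n. (- (m\<^sup>2) / 4) ^ (n + r) / (fact n * fact (n + r)) * u ^ n)"

lemma bessel_summable:
  "summable (\<lambda>n. (- (m\<^sup>2) / 4 :: real) ^ (n + r) / (fact n * fact (n + r)) * u ^ n)"
proof (rule summable_comparison_test)
  let ?w = "- (m\<^sup>2) / 4 :: real"
  show "summable (\<lambda>n. \<bar>?w\<bar> ^ r * (inverse (fact n) * \<bar>?w * u\<bar> ^ n))"
    by (intro summable_mult summable_exp)
  have "norm (?w ^ (n + r) / (fact n * fact (n + r)) * u ^ n) \<le> \<bar>?w\<bar> ^ r * (inverse (fact n) * \<bar>?w * u\<bar> ^ n)" for n
  proof -
    have "norm (?w ^ (n + r) / (fact n * fact (n + r)) * u ^ n)
        = \<bar>?w\<bar> ^ r * (inverse (fact n) * \<bar>?w * u\<bar> ^ n) / fact (n + r)"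
      by (simp add: abs_mult power_abs power_mult_distrib power_add divide_simps)
    also have "\<dots> \<le> \<bar>?w\<bar> ^ r * (inverse (fact n) * \<bar>?w * u\<bar> ^ n) / 1"
      by (intro divide_left_mono fact_ge_1) auto
    finally show ?thesis by simp
  qed
  then show "\<exists>N. \<forall>n\<ge>N. norm (?w ^ (n + r) / (fact n * fact (n + r)) * u ^ n)
      \<le> \<bar>?w\<bar> ^ r * (inverse (fact n) * \<bar>?w * u\<bar> ^ n)" by blast
qed

lemma bessel_deriv: "(bessel m r has_real_derivative bessel m (Suc r) u) (at u)"
proof -
  let ?c = "\<lambda>r n. (- (m\<^sup>2) / 4 :: real) ^ (n + r) / (fact n * fact (n + r))"
  have "diffs (?c r) = ?c (Suc r)"
    by (auto simp: diffs_def fun_eq_iff divide_simps)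
  then show ?thesis
    using termdiffs_strong_converges_everywhere[OF bessel_summable[of m r], of u]
    unfolding bessel_def[abs_def] by simp
qed

lemma bessel_deriv_chain [derivative_intros]:
  "(f has_real_derivative f') (at x within S) \<Longrightarrow>
    ((\<lambda>x. bessel m r (f x)) has_real_derivative bessel m (Suc r) (f x) * f') (at x within S)"
  by (rule DERIV_chain2[OF bessel_deriv])

lemma bessel_continuous [continuous_intros]:
  "continuous_on S f \<Longrightarrow> continuous_on S (\<lambda>x. bessel m r (f x))"
  by (rule continuous_on_compose2[of UNIV "bessel m r"])
    (auto intro: DERIV_isCont[OF bessel_deriv] continuous_at_imp_continuous_on)

lemma bessel_0_0: "bessel m 0 0 = 1"
proof -
  have "bessel m 0 0 = (\<Sum>n. ((- (m\<^sup>2) / 4) ^ n / (fact n * fact n)) * 0 ^ n)"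
    by (simp add: bessel_def)
  also have "\<dots> = 1" by (subst powser_zero) simp
  finally show ?thesis .
qed

text \<open>Bessel's equation in the squared variable. It expresses that \<open>bessel m 0 (t\<^sup>2 - y\<^sup>2)\<close>, the Riemann
  function of the Klein-Gordon operator, solves \<open>u\<^sub>t\<^sub>t - u\<^sub>y\<^sub>y + m\<^sup>2 u = 0\<close>.\<close>

lemma bessel_ode: "u * bessel m (Suc (Suc 0)) u + bessel m (Suc 0) u = - (m\<^sup>2 / 4) * bessel m 0 u"
proof -
  define w :: real where "w = - (m\<^sup>2) / 4"
  have K: "(\<lambda>n. w ^ (n + r) / (fact n * fact (n + r)) * u ^ n) sums bessel m r u" for r
    using summable_sums[OF bessel_summable[of m r u]] by (simp add: bessel_def w_def)
  \<comment> \<open>The series of \<open>u * bessel m 2 u\<close>, shifted by one; the factor \<open>n\<close> makes its term at \<open>0\<close> vanish.\<close>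
  define d where "d = (\<lambda>n. of_nat n * w ^ (n + 1) / (fact n * fact (n + 1)) * u ^ n)"
  have "d (Suc n) = u * (w ^ (n + Suc (Suc 0)) / (fact n * fact (n + Suc (Suc 0))) * u ^ n)" for n
    by (simp add: d_def divide_simps)
  then have "(\<lambda>n. d (Suc n)) = (\<lambda>n. u * (w ^ (n + Suc (Suc 0)) / (fact n * fact (n + Suc (Suc 0))) * u ^ n))"
    by (rule ext)
  then have "(\<lambda>n. d (Suc n)) sums (u * bessel m (Suc (Suc 0)) u)"
    using sums_mult[OF K[of "Suc (Suc 0)"], of u] by metis
  moreover have "d 0 = 0" by (simp add: d_def)
  ultimately have "d sums (u * bessel m (Suc (Suc 0)) u)"
    using sums_Suc_iff[of d "u * bessel m (Suc (Suc 0)) u"] by (simp only: add_0_right)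
  from sums_add[OF this K[of "Suc 0"]]
  have "(\<lambda>n. d n + w ^ (n + 1) / (fact n * fact (n + 1)) * u ^ n) sums
      (u * bessel m (Suc (Suc 0)) u + bessel m (Suc 0) u)" by simp
  moreover have "d n + w ^ (n + 1) / (fact n * fact (n + 1)) * u ^ n = w * (w ^ (n + 0) / (fact n * fact (n + 0)) * u ^ n)" for n
  proof -
    have "fact (n + 1) = (of_nat n + 1 :: real) * fact n" by simp
    moreover have "(of_nat n + 1 :: real) \<noteq> 0" by (metis of_nat_Suc of_nat_neq_0 add.commute)
    ultimately show ?thesis
      by (simp only: d_def) (simp add: divide_simps, simp add: algebra_simps)
  qed
  ultimately have "(\<lambda>n. w * (w ^ (n + 0) / (fact n * fact (n + 0)) * u ^ n)) sums
      (u * bessel m (Suc (Suc 0)) u + bessel m (Suc 0) u)" by simp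
  moreover have "(\<lambda>n. w * (w ^ (n + 0) / (fact n * fact (n + 0)) * u ^ n)) sums (w * bessel m 0 u)"
    by (rule sums_mult[OF K])
  ultimately show ?thesis by (simp add: sums_unique2 w_def)
qed

abbreviation cone_bessel :: "real \<Rightarrow> nat \<Rightarrow> real \<Rightarrow> real \<Rightarrow> real" where
  "cone_bessel m r t s \<equiv> bessel m r (t\<^sup>2 * (1 - s\<^sup>2))"

text \<open>A weighted integral of \<open>\<phi>\<close> over the interval \<open>[x - t, x + t]\<close> cut out by the light cone, rescaled to
  \<open>[-1, 1]\<close> so that its domain does not depend on \<open>t\<close>; at the point \<open>x + y\<close> the Bessel argument is
  \<open>t\<^sup>2 - y\<^sup>2\<close>. The same operator is applied to plane waves,
  to truncated inversions, to Dirichlet kernels and to the data themselves.\<close>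

definition bessel_avg :: "real \<Rightarrow> nat \<Rightarrow> (real \<Rightarrow> complex) \<Rightarrow> (real \<Rightarrow> complex) \<Rightarrow> real \<Rightarrow> real \<Rightarrow> complex" where
  "bessel_avg m r b \<phi> x t = integral {-1..1} (\<lambda>s. b s * of_real (cone_bessel m r t s) * \<phi> (x + t * s))"

lemma bessel_avg_integrand_continuous:
  fixes b \<phi> :: "real \<Rightarrow> complex"
  assumes "continuous_on {-1..1} b" "continuous_on D \<phi>" "\<And>s. s \<in> {-1..1} \<Longrightarrow> x + t * s \<in> D"
  shows "continuous_on {-1..1} (\<lambda>s. b s * of_real (cone_bessel m r t s) * \<phi> (x + t * s))"
proof -
  have "continuous_on {-1..1} (\<lambda>s. \<phi> (x + t * s))"
    using assms(3) by (intro continuous_on_compose2[OF assms(2)] continuous_intros) auto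
  then show ?thesis by (intro continuous_intros assms(1))
qed

lemma has_vector_derivative_chain_real:
  fixes \<phi> :: "real \<Rightarrow> complex"
  assumes "(\<phi> has_vector_derivative \<phi>') (at (u t))" "(u has_real_derivative c) (at t within S)"
  shows "((\<lambda>t. \<phi> (u t)) has_vector_derivative of_real c * \<phi>') (at t within S)"
proof -
  have "(u has_vector_derivative c) (at t within S)"
    using assms(2) by (simp add: has_real_derivative_iff_has_vector_derivative)
  from vector_diff_chain_within[OF this has_vector_derivative_at_within[OF assms(1)]]
  show ?thesis by (simp add: o_def scaleR_conv_of_real)
qed

lemma of_real_power_deriv:
  "((\<lambda>t. of_real t ^ n :: complex) has_vector_derivative of_nat n * of_real t ^ (n - 1)) (at t)"
proof -
  have "((\<lambda>t. t ^ n :: complex) has_field_derivative of_nat n * of_real t ^ (n - 1)) (at (of_real t))"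
    by (auto intro!: derivative_eq_intros)
  from has_vector_derivative_real_field[OF this] show ?thesis by simp
qed

text \<open>Differentiation under the integral sign. One term has a raised Bessel index and the other one
  contains \<open>\<phi>'\<close>, both with a weight changed by a polynomial: averages reproduce averages.\<close>

lemma bessel_avg_has_deriv_t:
  assumes b: "continuous_on {-1..1} b"
    and \<phi>: "\<And>z. z \<in> D \<Longrightarrow> (\<phi> has_vector_derivative \<phi>' z) (at z)" and \<phi>': "continuous_on D \<phi>'"
    and U: "open U" "convex U" "t \<in> U"
    and D: "\<And>t s. t \<in> U \<Longrightarrow> s \<in> {-1..1} \<Longrightarrow> x + t * s \<in> D"
  shows "((\<lambda>t. bessel_avg m r b \<phi> x t) has_vector_derivative
      of_real (2 * t) * bessel_avg m (Suc r) (\<lambda>s. b s * of_real (1 - s\<^sup>2)) \<phi> x t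
       + bessel_avg m r (\<lambda>s. b s * of_real s) \<phi>' x t) (at t)"
proof -
  have \<phi>c: "continuous_on D \<phi>"
    by (meson \<phi> continuous_at_imp_continuous_on has_vector_derivative_continuous)
  define F where "F = (\<lambda>t s. b s * of_real (cone_bessel m r t s) * \<phi> (x + t * s))"
  define F' where "F' = (\<lambda>t s.
     of_real (2 * t) * (b s * of_real (1 - s\<^sup>2) * of_real (cone_bessel m (Suc r) t s) * \<phi> (x + t * s))
     + b s * of_real s * of_real (cone_bessel m r t s) * \<phi>' (x + t * s))"
  have "((\<lambda>t. integral (cbox (-1) 1) (F t)) has_vector_derivative integral (cbox (-1) 1) (F' t)) (at t within U)"
  proof (rule leibniz_rule_vector_derivative[OF _ _ _ U(3,2)])
    fix t s :: real assume t: "t \<in> U" and s: "s \<in> cbox (-1) 1"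
    have K: "((\<lambda>t. cone_bessel m r t s) has_real_derivative
        cone_bessel m (Suc r) t s * (2 * t * (1 - s\<^sup>2))) (at t within U)"
      by (auto intro!: derivative_eq_intros)
    have ph: "((\<lambda>t. \<phi> (x + t * s)) has_vector_derivative of_real s * \<phi>' (x + t * s)) (at t within U)"
      by (rule has_vector_derivative_chain_real[where u = "\<lambda>t. x + t * s"]) (use t s in \<open>auto intro!: derivative_eq_intros \<phi> D\<close>)
    have "((\<lambda>t. b s * (of_real (cone_bessel m r t s) * \<phi> (x + t * s))) has_vector_derivative
       b s * (of_real (cone_bessel m r t s) * (of_real s * \<phi>' (x + t * s)) +
         of_real (cone_bessel m (Suc r) t s * (2 * t * (1 - s\<^sup>2))) * \<phi> (x + t * s))) (at t within U)"
      by (intro has_vector_derivative_mult_right has_vector_derivative_mult has_vector_derivative_of_real ph K)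
    then show "((\<lambda>t. F t s) has_vector_derivative F' t s) (at t within U)"
      by (simp add: F_def F'_def algebra_simps)
  next
    fix t assume t: "t \<in> U"
    show "F t integrable_on cbox (- 1) 1"
      unfolding F_def cbox_interval
      by (intro integrable_continuous_real bessel_avg_integrand_continuous[OF b \<phi>c] D[OF t])
  next
    have "continuous_on (U \<times> {-1..1}) (\<lambda>p. \<phi> (x + fst p * snd p))"
      "continuous_on (U \<times> {-1..1}) (\<lambda>p. \<phi>' (x + fst p * snd p))"
      "continuous_on (U \<times> {-1..1}) (\<lambda>p. b (snd p))"
      by (intro continuous_on_compose2[OF \<phi>c] continuous_on_compose2[OF \<phi>'] continuous_on_compose2[OF b]
          continuous_intros; use D in auto)+
    then show "continuous_on (U \<times> cbox (- 1) 1) (\<lambda>(t, s). F' t s)"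
      by (auto simp: case_prod_unfold F'_def intro!: continuous_intros)
  qed
  moreover have "integral (cbox (-1) 1) (F' t) =
     of_real (2 * t) * bessel_avg m (Suc r) (\<lambda>s. b s * of_real (1 - s\<^sup>2)) \<phi> x t + bessel_avg m r (\<lambda>s. b s * of_real s) \<phi>' x t"
    unfolding F'_def bessel_avg_def cbox_interval
  proof (rule trans[OF integral_add])
    have b': "continuous_on {-1..1} (\<lambda>s. b s * of_real (1 - s\<^sup>2))" "continuous_on {-1..1} (\<lambda>s. b s * of_real s)"
      by (intro continuous_intros b)+
    show "(\<lambda>s. of_real (2 * t) * (b s * of_real (1 - s\<^sup>2) * of_real (cone_bessel m (Suc r) t s) * \<phi> (x + t * s)))
        integrable_on {-1..1}"
      by (rule integrable_continuous_real, rule continuous_on_mult_left,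
          rule bessel_avg_integrand_continuous[OF b'(1) \<phi>c D[OF U(3)]])
    show "(\<lambda>s. b s * of_real s * of_real (cone_bessel m r t s) * \<phi>' (x + t * s)) integrable_on {-1..1}"
      by (rule integrable_continuous_real, rule bessel_avg_integrand_continuous[OF b'(2) \<phi>' D[OF U(3)]])
  qed (rule arg_cong2[where f = "(+)"], rule integral_mult_right, rule refl)
  moreover have "at t within U = at t" by (rule at_within_open[OF U(3,1)])
  moreover have "(\<lambda>t. bessel_avg m r b \<phi> x t) = (\<lambda>t. integral (cbox (-1) 1) (F t))"
    by (simp only: bessel_avg_def F_def cbox_interval)
  ultimately show ?thesis by (simp only:)
qed

lemma bessel_avg_has_deriv_x:
  assumes b: "continuous_on {-1..1} b"
    and \<phi>: "\<And>z. z \<in> D \<Longrightarrow> (\<phi> has_vector_derivative \<phi>' z) (at z)" and \<phi>': "continuous_on D \<phi>'"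
    and U: "open U" "convex U" "x \<in> U"
    and D: "\<And>x s. x \<in> U \<Longrightarrow> s \<in> {-1..1} \<Longrightarrow> x + t * s \<in> D"
  shows "((\<lambda>x. bessel_avg m r b \<phi> x t) has_vector_derivative bessel_avg m r b \<phi>' x t) (at x)"
proof -
  have \<phi>c: "continuous_on D \<phi>"
    by (meson \<phi> continuous_at_imp_continuous_on has_vector_derivative_continuous)
  define F where "F = (\<lambda>\<phi> x s. b s * of_real (cone_bessel m r t s) * (\<phi> (x + t * s) :: complex))"
  have "((\<lambda>x. integral (cbox (-1) 1) (F \<phi> x)) has_vector_derivative integral (cbox (-1) 1) (F \<phi>' x)) (at x within U)"
  proof (rule leibniz_rule_vector_derivative[OF _ _ _ U(3,2)])
    fix x s :: real assume x: "x \<in> U" and s: "s \<in> cbox (-1) 1"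
    have ph: "((\<lambda>x. \<phi> (x + t * s)) has_vector_derivative of_real 1 * \<phi>' (x + t * s)) (at x within U)"
      by (rule has_vector_derivative_chain_real[where u = "\<lambda>x. x + t * s"]) (use x s in \<open>auto intro!: derivative_eq_intros \<phi> D\<close>)
    show "((\<lambda>x. F \<phi> x s) has_vector_derivative F \<phi>' x s) (at x within U)"
      unfolding F_def using has_vector_derivative_mult_right[OF ph] by simp
  next
    fix x assume x: "x \<in> U"
    show "F \<phi> x integrable_on cbox (- 1) 1"
      unfolding F_def cbox_interval
      by (intro integrable_continuous_real bessel_avg_integrand_continuous[OF b \<phi>c] D[OF x])
  next
    have "continuous_on (U \<times> {-1..1}) (\<lambda>p. \<phi>' (fst p + t * snd p))"
      "continuous_on (U \<times> {-1..1}) (\<lambda>p. b (snd p))"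
      by (intro continuous_on_compose2[OF \<phi>'] continuous_on_compose2[OF b] continuous_intros; use D in auto)+
    then show "continuous_on (U \<times> cbox (- 1) 1) (\<lambda>(x, s). F \<phi>' x s)"
      by (auto simp: case_prod_unfold F_def intro!: continuous_intros)
  qed
  moreover have "at x within U = at x" by (rule at_within_open[OF U(3,1)])
  ultimately show ?thesis by (simp only: bessel_avg_def F_def cbox_interval)
qed

section \<open>The propagators act on plane waves as Fourier multipliers\<close>

text \<open>Two travelling waves plus an average: the general shape of the three propagators, for which
  linearity, limits and regularity are proved at once.\<close>

definition wave_op :: "real \<Rightarrow> complex \<Rightarrow> complex \<Rightarrow> nat \<Rightarrow> nat \<Rightarrow> (real \<Rightarrow> complex)
    \<Rightarrow> (real \<Rightarrow> complex) \<Rightarrow> real \<Rightarrow> real \<Rightarrow> complex" where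
  "wave_op m c1 c2 p r b \<phi> x t = c1 * \<phi> (x + t) + c2 * \<phi> (x - t) + of_real t ^ p * bessel_avg m r b \<phi> x t"

text \<open>The operators with symbols \<open>cos (\<rho> t)\<close>, \<open>sin (\<rho> t) / \<rho>\<close> and \<open>k sin (\<rho> t) / \<rho>\<close>. In the third
  one the factor \<open>k\<close> has been absorbed by an integration by parts in \<open>s\<close>, so that no derivative falls
  on the data.\<close>

definition cos_op :: "real \<Rightarrow> (real \<Rightarrow> complex) \<Rightarrow> real \<Rightarrow> real \<Rightarrow> complex" where
  "cos_op m = wave_op m (1/2) (1/2) 2 1 (\<lambda>s. 1)"

definition sinc_op :: "real \<Rightarrow> (real \<Rightarrow> complex) \<Rightarrow> real \<Rightarrow> real \<Rightarrow> complex" where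
  "sinc_op m = wave_op m 0 0 1 0 (\<lambda>s. 1/2)"

definition dsinc_op :: "real \<Rightarrow> (real \<Rightarrow> complex) \<Rightarrow> real \<Rightarrow> real \<Rightarrow> complex" where
  "dsinc_op m = wave_op m (1/(2*\<i>)) (-1/(2*\<i>)) 2 1 (\<lambda>s. - \<i> * of_real s)"

definition wave :: "real \<Rightarrow> real \<Rightarrow> complex" where
  "wave k z = exp (\<i> * of_real k * of_real z)"

lemma wave_add: "wave k (x + y) = wave k x * wave k y"
  by (simp add: wave_def exp_add[symmetric] algebra_simps)

lemma norm_wave [simp]: "norm (wave k z) = 1"
  by (simp add: wave_def)

lemma wave_eq: "wave k z = of_real (cos (k * z)) + \<i> * of_real (sin (k * z))"
proof -
  have "wave k z = cis (k * z)" by (simp add: wave_def cis_conv_exp mult.assoc)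
  then show ?thesis by (simp add: complex_eq_iff)
qed

lemma wave_deriv: "(wave k has_vector_derivative \<i> * of_real k * wave k z) (at z)"
proof -
  have "((\<lambda>z. exp (\<i> * of_real k * z)) has_field_derivative \<i> * of_real k * wave k z) (at (of_real z))"
    by (auto intro!: derivative_eq_intros simp: wave_def)
  from has_vector_derivative_real_field[OF this] show ?thesis
    unfolding wave_def[abs_def] by simp
qed

lemma wave_continuous [continuous_intros]:
  "continuous_on S f \<Longrightarrow> continuous_on S g \<Longrightarrow> continuous_on S (\<lambda>x. wave (f x) (g x))"
  unfolding wave_def by (intro continuous_intros)

lemma bessel_avg_cmult_fun: "bessel_avg m r b (\<lambda>z. c * \<phi> z) x t = c * bessel_avg m r b \<phi> x t"
proof -
  have "bessel_avg m r b (\<lambda>z. c * \<phi> z) x t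
     = integral {-1..1} (\<lambda>s. c * (b s * of_real (cone_bessel m r t s) * \<phi> (x + t * s)))"
    unfolding bessel_avg_def by (intro integral_cong) (simp add: mult_ac)
  then show ?thesis by (simp only: bessel_avg_def integral_mult_right)
qed

lemma bessel_avg_cmult_weight: "bessel_avg m r (\<lambda>s. c * b s) \<phi> x t = c * bessel_avg m r b \<phi> x t"
proof -
  have "bessel_avg m r (\<lambda>s. c * b s) \<phi> x t
     = integral {-1..1} (\<lambda>s. c * (b s * of_real (cone_bessel m r t s) * \<phi> (x + t * s)))"
    unfolding bessel_avg_def by (intro integral_cong) (simp add: mult_ac)
  then show ?thesis by (simp only: bessel_avg_def integral_mult_right)
qed

lemma bessel_avg_wave_shift: "bessel_avg m r b (wave k) x t = wave k x * bessel_avg m r b (wave k) 0 t"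
proof -
  have "bessel_avg m r b (wave k) x t
     = integral {-1..1} (\<lambda>s. wave k x * (b s * of_real (cone_bessel m r t s) * wave k (0 + t * s)))"
    unfolding bessel_avg_def by (intro integral_cong) (simp add: wave_add)
  then show ?thesis by (simp only: bessel_avg_def integral_mult_right)
qed

lemma wave_op_wave_shift: "wave_op m c1 c2 p r b (wave k) x t = wave k x * wave_op m c1 c2 p r b (wave k) 0 t"
proof -
  have "wave k (x - t) = wave k x * wave k (0 - t)"
    using wave_add[of k x "-t"] by simp
  then show ?thesis
    unfolding wave_op_def by (subst bessel_avg_wave_shift) (simp add: wave_add algebra_simps)
qed

text \<open>The fundamental theorem of calculus in the variable \<open>s\<close> for \<open>c s * bessel m 0 * wave\<close>. With
  \<open>c = 1\<close> it turns the factor \<open>k\<close> into boundary waves, with \<open>c = s\<close> it removes the factor \<open>k\<close> that appears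
  when the wave is differentiated in \<open>t\<close>.\<close>

lemma bessel_avg_by_parts:
  assumes c: "\<And>s. (c has_vector_derivative c' s) (at s)" and c': "continuous_on {-1..1} c'"
  shows "c 1 * wave k t - c (-1) * wave k (-t) =
     bessel_avg m 0 c' (wave k) 0 t - 2 * of_real t ^ 2 * bessel_avg m 1 (\<lambda>s. of_real s * c s) (wave k) 0 t
       + \<i> * of_real k * of_real t * bessel_avg m 0 c (wave k) 0 t"
proof -
  let ?K = "\<lambda>r s. of_real (cone_bessel m r t s) :: complex"
  have cc: "continuous_on S c" for S
    by (meson c continuous_at_imp_continuous_on has_vector_derivative_continuous)
  have int: "(\<lambda>s. d s * ?K r s * wave k (0 + t * s)) integrable_on {-1..1}" if "continuous_on {-1..1} d" for d r
    by (intro integrable_continuous_real bessel_avg_integrand_continuous[OF that, of UNIV] continuous_intros) auto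
  have K: "((\<lambda>s. ?K 0 s) has_vector_derivative of_real (cone_bessel m (Suc 0) t s * (t\<^sup>2 * - (2 * s)))) (at s)" for s
    by (intro has_vector_derivative_of_real) (auto intro!: derivative_eq_intros)
  have W: "((\<lambda>s. wave k (t * s)) has_vector_derivative of_real t * (\<i> * of_real k * wave k (t * s))) (at s)" for s
    by (rule has_vector_derivative_chain_real[where u = "\<lambda>s. t * s", OF wave_deriv])
      (auto intro!: derivative_eq_intros)
  have "((\<lambda>s. c s * (?K 0 s * wave k (t * s))) has_vector_derivative
      c s * (?K 0 s * (of_real t * (\<i> * of_real k * wave k (t * s))) +
        of_real (cone_bessel m (Suc 0) t s * (t\<^sup>2 * - (2 * s))) * wave k (t * s))
      + c' s * (?K 0 s * wave k (t * s))) (at s within {-1..1})" for s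
    by (rule has_vector_derivative_at_within) (intro has_vector_derivative_mult K W c)
  then have "((\<lambda>s. c s * (?K 0 s * (of_real t * (\<i> * of_real k * wave k (t * s))) +
        of_real (cone_bessel m (Suc 0) t s * (t\<^sup>2 * - (2 * s))) * wave k (t * s))
      + c' s * (?K 0 s * wave k (t * s))) has_integral
       c 1 * (?K 0 1 * wave k (t * 1)) - c (-1) * (?K 0 (-1) * wave k (t * (-1)))) {-1..1}"
    by (intro fundamental_theorem_of_calculus) auto
  then have "c 1 * wave k t - c (-1) * wave k (-t) =
     integral {-1..1} (\<lambda>s. c s * (?K 0 s * (of_real t * (\<i> * of_real k * wave k (t * s))) +
        of_real (cone_bessel m (Suc 0) t s * (t\<^sup>2 * - (2 * s))) * wave k (t * s))
      + c' s * (?K 0 s * wave k (t * s)))"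
    by (simp add: integral_unique bessel_0_0)
  also have "\<dots> = integral {-1..1} (\<lambda>s. c' s * ?K 0 s * wave k (0 + t * s)
       - (2 * of_real t ^ 2) * ((of_real s * c s) * ?K 1 s * wave k (0 + t * s))
       + (\<i> * of_real k * of_real t) * (c s * ?K 0 s * wave k (0 + t * s)))"
    by (intro integral_cong) (simp add: algebra_simps)
  also have "\<dots> = integral {-1..1} (\<lambda>s. c' s * ?K 0 s * wave k (0 + t * s))
       - integral {-1..1} (\<lambda>s. (2 * of_real t ^ 2) * ((of_real s * c s) * ?K 1 s * wave k (0 + t * s)))
       + integral {-1..1} (\<lambda>s. (\<i> * of_real k * of_real t) * (c s * ?K 0 s * wave k (0 + t * s)))"
  proof -
    have 1: "(\<lambda>s. c' s * ?K 0 s * wave k (0 + t * s)) integrable_on {-1..1}"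
      by (rule int[OF c'])
    have 2: "(\<lambda>s. (2 * of_real t ^ 2) * ((of_real s * c s) * ?K 1 s * wave k (0 + t * s))) integrable_on {-1..1}"
      by (intro integrable_on_mult_right int continuous_intros cc)
    have 3: "(\<lambda>s. (\<i> * of_real k * of_real t) * (c s * ?K 0 s * wave k (0 + t * s))) integrable_on {-1..1}"
      by (intro integrable_on_mult_right int cc)
    show ?thesis
      by (simp only: integral_add[OF integrable_diff[OF 1 2] 3] integral_diff[OF 1 2])
  qed
  finally show ?thesis
    by (simp only: bessel_avg_def integral_mult_right)
qed

text \<open>At \<open>x = 0\<close> the operators applied to a plane wave satisfy the first-order system of
  \<open>sin (\<rho> t) / \<rho>\<close> and \<open>cos (\<rho> t)\<close>. Bessel's equation enters in the derivative of \<open>C\<close> only.\<close>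

lemma propagator_ode:
  defines "S \<equiv> \<lambda>m k. sinc_op m (wave k) 0" and "C \<equiv> \<lambda>m k. cos_op m (wave k) 0"
    and "X \<equiv> \<lambda>m k. dsinc_op m (wave k) 0"
  shows "X m k t = of_real k * S m k t"
    and "(S m k has_vector_derivative C m k t) (at t)"
    and "(C m k has_vector_derivative - of_real (k\<^sup>2 + m\<^sup>2) * S m k t) (at t)"
proof -
  let ?a = "\<lambda>r b t. bessel_avg m r b (wave k) 0 t"
  have c2: "continuous_on UNIV (\<lambda>z. \<i> * of_real k * wave k z)"
    by (intro continuous_intros)
  have shift: "bessel_avg m r b (\<lambda>z. \<i> * of_real k * wave k z) 0 t = \<i> * of_real k * ?a r b t" for r b t
    by (rule bessel_avg_cmult_fun)
  have W: "wave k (0 + t) = of_real (cos (k * t)) + \<i> * of_real (sin (k * t))"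
    "wave k (0 - t) = of_real (cos (k * t)) - \<i> * of_real (sin (k * t))"
    "wave k t = of_real (cos (k * t)) + \<i> * of_real (sin (k * t))"
    "wave k (- t) = of_real (cos (k * t)) - \<i> * of_real (sin (k * t))" for t
    by (simp_all add: wave_eq)
  have Seq: "S m k t = of_real t * ?a 0 (\<lambda>s. 1) t / 2" for t
    using bessel_avg_cmult_weight[of m 0 "1/2" "\<lambda>s. 1" "wave k" 0 t]
    by (simp add: S_def sinc_op_def wave_op_def)
  have Ceq: "C m k t = of_real (cos (k * t)) + of_real t ^ 2 * ?a 1 (\<lambda>s. 1) t" for t
    unfolding C_def cos_op_def wave_op_def W by (simp add: algebra_simps)
  have Xeq: "X m k t = of_real (sin (k * t)) - \<i> * of_real t ^ 2 * ?a 1 (\<lambda>s. of_real s) t" for t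
    unfolding X_def dsinc_op_def wave_op_def W bessel_avg_cmult_weight by (simp add: field_simps)
  have P1: "wave k t - wave k (- t) = - 2 * of_real t ^ 2 * ?a 1 (\<lambda>s. of_real s) t
       + \<i> * of_real k * of_real t * ?a 0 (\<lambda>s. 1) t" for t
    using bessel_avg_by_parts[of "\<lambda>s. 1" "\<lambda>s. 0" k t m] by (simp add: bessel_avg_def)
  show X: "X m k t = of_real k * S m k t" for t
  proof -
    have "2 * \<i> * of_real (sin (k * t)) = - 2 * of_real t ^ 2 * ?a 1 (\<lambda>s. of_real s) t
       + \<i> * of_real k * of_real t * ?a 0 (\<lambda>s. 1) t"
      using P1[of t] unfolding W by (simp add: algebra_simps)
    then have "(2 * \<i>) * X m k t = (2 * \<i>) * (of_real k * S m k t)"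
      unfolding Xeq Seq by (simp add: algebra_simps)
    then show ?thesis by simp
  qed
  have one: "continuous_on {-1..1} (\<lambda>s::real. 1 :: complex)" by (intro continuous_intros)
  have dt: "((\<lambda>t. ?a r (\<lambda>s. 1) t) has_vector_derivative
      of_real (2 * t) * ?a (Suc r) (\<lambda>s. of_real (1 - s\<^sup>2)) t
       + \<i> * of_real k * ?a r (\<lambda>s. of_real s) t) (at t)" for r t
    using bessel_avg_has_deriv_t[OF one wave_deriv c2 open_UNIV convex_UNIV UNIV_I UNIV_I, where t = t and m = m and r = r and x = 0]
    by (simp only: shift mult_1)
  show "(S m k has_vector_derivative C m k t) (at t)"
  proof -
    have "((\<lambda>t. of_real t ^ 1 * ?a 0 (\<lambda>s. 1) t) has_vector_derivative
       of_real t ^ 1 * (of_real (2 * t) * ?a (Suc 0) (\<lambda>s. of_real (1 - s\<^sup>2)) t + \<i> * of_real k * ?a 0 (\<lambda>s. of_real s) t)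
       + of_nat 1 * of_real t ^ (1 - 1) * ?a 0 (\<lambda>s. 1) t) (at t)"
      by (intro has_vector_derivative_mult dt of_real_power_deriv)
    from has_vector_derivative_mult_right[OF this, of "1/2"]
    have D: "(S m k has_vector_derivative
       (of_real t * (of_real (2 * t) * ?a 1 (\<lambda>s. of_real (1 - s\<^sup>2)) t + \<i> * of_real k * ?a 0 (\<lambda>s. of_real s) t)
       + ?a 0 (\<lambda>s. 1) t) / 2) (at t)"
      unfolding Seq[abs_def] by simp
    have "wave k t + wave k (-t) = ?a 0 (\<lambda>s. 1) t - 2 * of_real t ^ 2 * ?a 1 (\<lambda>s. of_real s * of_real s) t
       + \<i> * of_real k * of_real t * ?a 0 (\<lambda>s. of_real s) t"
      using bessel_avg_by_parts[of "\<lambda>s. of_real s" "\<lambda>s. of_real 1" k t m, OF has_vector_derivative_of_real[OF DERIV_ident]]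
      by simp
    then have 1: "wave k t + wave k (-t) = ?a 0 (\<lambda>s. 1) t - 2 * of_real t ^ 2 * ?a 1 (\<lambda>s. of_real s * of_real s) t
       + of_real t * (\<i> * of_real k * ?a 0 (\<lambda>s. of_real s) t)"
      by (simp only: mult_ac)
    have 2: "?a 1 (\<lambda>s. of_real (1 - s\<^sup>2)) t = ?a 1 (\<lambda>s. 1) t - ?a 1 (\<lambda>s. of_real s * of_real s) t"
      unfolding bessel_avg_def
      by (subst integral_diff[symmetric])
        (auto intro!: integrable_continuous_real continuous_intros integral_cong simp: algebra_simps power2_eq_square)
    have 3: "wave k t + wave k (-t) = 2 * of_real (cos (k * t))"
      by (simp add: W)
    have "(T * (2 * T * y + z) + u) / 2 = c + T\<^sup>2 * v"
      if "w = u - 2 * T\<^sup>2 * y' + T * z" "y = v - y'" "w = 2 * c" for T u v w y y' z c :: complex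
      using that(1,3) unfolding that(2) by (simp add: field_simps power2_eq_square)
    from this[OF 1 2 3]
    have "(of_real t * (2 * of_real t * ?a 1 (\<lambda>s. of_real (1 - s\<^sup>2)) t + \<i> * of_real k * ?a 0 (\<lambda>s. of_real s) t)
       + ?a 0 (\<lambda>s. 1) t) / 2 = C m k t"
      unfolding Ceq .
    then have "(of_real t * (of_real (2 * t) * ?a 1 (\<lambda>s. of_real (1 - s\<^sup>2)) t + \<i> * of_real k * ?a 0 (\<lambda>s. of_real s) t)
       + ?a 0 (\<lambda>s. 1) t) / 2 = C m k t"
      by (simp only: of_real_mult of_real_numeral)
    with D show ?thesis by simp
  qed
  show "(C m k has_vector_derivative - of_real (k\<^sup>2 + m\<^sup>2) * S m k t) (at t)"
  proof -
    have "((\<lambda>t. complex_of_real (cos (k * t))) has_vector_derivative of_real (- sin (k * t) * k)) (at t)"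
      by (intro has_vector_derivative_of_real) (auto intro!: derivative_eq_intros)
    then have D: "(C m k has_vector_derivative of_real (- sin (k * t) * k) +
       (of_real t ^ 2 * (of_real (2 * t) * ?a (Suc 1) (\<lambda>s. of_real (1 - s\<^sup>2)) t + \<i> * of_real k * ?a 1 (\<lambda>s. of_real s) t)
       + of_nat 2 * of_real t ^ (2 - 1) * ?a 1 (\<lambda>s. 1) t)) (at t)"
      unfolding Ceq[abs_def] by (intro has_vector_derivative_add has_vector_derivative_mult dt of_real_power_deriv)
    have "of_real t ^ 2 * ?a (Suc 1) (\<lambda>s. of_real (1 - s\<^sup>2)) t + ?a 1 (\<lambda>s. 1) t = of_real (- (m\<^sup>2 / 4)) * ?a 0 (\<lambda>s. 1) t"
    proof -
      have *: "complex_of_real (t\<^sup>2 * (1 - s\<^sup>2)) * of_real (cone_bessel m (Suc (Suc 0)) t s) +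
          of_real (cone_bessel m (Suc 0) t s) = of_real (- (m\<^sup>2 / 4)) * of_real (cone_bessel m 0 t s)" for s
        unfolding of_real_mult[symmetric] of_real_add[symmetric] bessel_ode ..
      have "of_real t ^ 2 * ?a (Suc 1) (\<lambda>s. of_real (1 - s\<^sup>2)) t + ?a 1 (\<lambda>s. 1) t =
         integral {-1..1} (\<lambda>s. (complex_of_real (t\<^sup>2 * (1 - s\<^sup>2)) * of_real (cone_bessel m (Suc (Suc 0)) t s) +
          of_real (cone_bessel m (Suc 0) t s)) * wave k (0 + t * s))"
        unfolding bessel_avg_def integral_mult_right[symmetric]
        by (subst integral_add[symmetric])
          (auto intro!: integrable_continuous_real continuous_intros integral_cong simp: algebra_simps)
      also have "\<dots> = of_real (- (m\<^sup>2 / 4)) * ?a 0 (\<lambda>s. 1) t"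
        unfolding * bessel_avg_def integral_mult_right[symmetric]
        by (intro integral_cong) simp
      finally show ?thesis .
    qed
    then have "2 * of_real t * (of_real t ^ 2 * ?a (Suc 1) (\<lambda>s. of_real (1 - s\<^sup>2)) t + ?a 1 (\<lambda>s. 1) t) = - of_real (m\<^sup>2) * S m k t"
      unfolding Seq by simp
    moreover have "- of_real k * X m k t = - of_real (k\<^sup>2) * S m k t"
      unfolding X by (simp add: power2_eq_square)
    moreover have "of_real (- sin (k * t) * k) +
       (of_real t ^ 2 * (of_real (2 * t) * ?a (Suc 1) (\<lambda>s. of_real (1 - s\<^sup>2)) t + \<i> * of_real k * ?a 1 (\<lambda>s. of_real s) t)
       + of_nat 2 * of_real t ^ (2 - 1) * ?a 1 (\<lambda>s. 1) t) =
       - of_real k * X m k t + 2 * of_real t * (of_real t ^ 2 * ?a (Suc 1) (\<lambda>s. of_real (1 - s\<^sup>2)) t + ?a 1 (\<lambda>s. 1) t)"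
      unfolding Xeq by (simp add: algebra_simps)
    ultimately have "of_real (- sin (k * t) * k) +
       (of_real t ^ 2 * (of_real (2 * t) * ?a (Suc 1) (\<lambda>s. of_real (1 - s\<^sup>2)) t + \<i> * of_real k * ?a 1 (\<lambda>s. of_real s) t)
       + of_nat 2 * of_real t ^ (2 - 1) * ?a 1 (\<lambda>s. 1) t) = - of_real (k\<^sup>2) * S m k t + - of_real (m\<^sup>2) * S m k t"
      by (simp only:)
    also have "\<dots> = - of_real (k\<^sup>2 + m\<^sup>2) * S m k t"
      by (simp add: algebra_simps)
    finally show ?thesis using D by (simp only:)
  qed
qed

text \<open>The system of \<open>propagator_ode\<close> and its initial values determine the solution: rotating
  \<open>(C, \<rho> S)\<close> by the angle \<open>\<rho> t\<close> gives the conserved quantities \<open>P\<close> and \<open>Q\<close>. The second identity is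
  multiplied by \<open>\<rho>\<close> so that it holds at \<open>\<rho> = 0\<close> too.\<close>

lemma propagator_wave:
  shows "cos_op m (wave k) x t = wave k x * of_real (cos (rho m k * t))"
    and "of_real (rho m k) * sinc_op m (wave k) x t = wave k x * of_real (sin (rho m k * t))"
    and "dsinc_op m (wave k) x t = of_real k * sinc_op m (wave k) x t"
proof -
  define r where "r = rho m k"
  have r2: "r\<^sup>2 = k\<^sup>2 + m\<^sup>2" by (simp add: r_def rho_def)
  define S where "S = sinc_op m (wave k) 0"
  define C where "C = cos_op m (wave k) 0"
  have S: "(S has_vector_derivative C t) (at t)"
    and C: "(C has_vector_derivative - of_real (r * r) * S t) (at t)" for t
    using propagator_ode(2,3)[of m k t] r2 by (simp_all add: S_def C_def power2_eq_square)
  have cosd: "((\<lambda>t. complex_of_real (cos (r * t))) has_vector_derivative of_real (- (sin (r * t) * r))) (at t)"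
    and sind: "((\<lambda>t. complex_of_real (sin (r * t))) has_vector_derivative of_real (cos (r * t) * r)) (at t)" for t
    by (intro has_vector_derivative_of_real; auto intro!: derivative_eq_intros)+
  define P where "P = (\<lambda>t. C t * of_real (cos (r * t)) + of_real r * (S t * of_real (sin (r * t))))"
  define Q where "Q = (\<lambda>t. of_real r * (S t * of_real (cos (r * t))) - C t * of_real (sin (r * t)))"
  have "(P has_vector_derivative (C t * of_real (- (sin (r * t) * r)) + (- of_real (r * r) * S t) * of_real (cos (r * t))) +
     of_real r * (S t * of_real (cos (r * t) * r) + C t * of_real (sin (r * t)))) (at t)" for t
    unfolding P_def
    by (intro has_vector_derivative_add has_vector_derivative_mult has_vector_derivative_mult_right C S cosd sind)
  then have P': "(P has_vector_derivative 0) (at t)" for t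
    by (rule has_vector_derivative_eq_rhs) (simp add: algebra_simps)
  have "(Q has_vector_derivative of_real r * (S t * of_real (- (sin (r * t) * r)) + C t * of_real (cos (r * t))) -
     (C t * of_real (cos (r * t) * r) + (- of_real (r * r) * S t) * of_real (sin (r * t)))) (at t)" for t
    unfolding Q_def
    by (intro has_vector_derivative_diff has_vector_derivative_mult has_vector_derivative_mult_right C S cosd sind)
  then have Q': "(Q has_vector_derivative 0) (at t)" for t
    by (rule has_vector_derivative_eq_rhs) (simp add: algebra_simps)
  have S0: "S 0 = 0" and C0: "C 0 = 1"
    by (simp_all add: S_def C_def sinc_op_def cos_op_def wave_op_def wave_def)
  \<comment> \<open>The rotated quantities are constant, with values \<open>1\<close> and \<open>0\<close> at \<open>t = 0\<close>.\<close>
  have "P t = P 0" for t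
    using has_vector_derivative_zero_constant[of UNIV P] P' by (metis UNIV_I convex_UNIV)
  then have P: "P t = 1" for t by (simp add: P_def S0 C0)
  have "Q t = Q 0" for t
    using has_vector_derivative_zero_constant[of UNIV Q] Q' by (metis UNIV_I convex_UNIV)
  then have Q: "Q t = 0" for t by (simp add: Q_def S0 C0)
  have trig: "complex_of_real (cos u) * of_real (cos u) + of_real (sin u) * of_real (sin u) = 1" for u
    using arg_cong[OF sin_cos_squared_add3[of u], of complex_of_real] by (simp only: of_real_add of_real_mult of_real_1)
  have "C t = C t * (of_real (cos (r * t)) * of_real (cos (r * t)) + of_real (sin (r * t)) * of_real (sin (r * t)))"
    by (simp only: trig mult_1_right)
  also have "\<dots> = P t * of_real (cos (r * t)) - Q t * of_real (sin (r * t))"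
    unfolding P_def Q_def by (simp only: algebra_simps)
  finally have Ct: "C t = of_real (cos (r * t))" by (simp add: P Q)
  have "of_real r * S t = of_real r * S t * (of_real (cos (r * t)) * of_real (cos (r * t)) + of_real (sin (r * t)) * of_real (sin (r * t)))"
    by (simp only: trig mult_1_right)
  also have "\<dots> = P t * of_real (sin (r * t)) + Q t * of_real (cos (r * t))"
    unfolding P_def Q_def by (simp only: algebra_simps)
  finally have St: "of_real r * S t = of_real (sin (r * t))" by (simp add: P Q)
  show "cos_op m (wave k) x t = wave k x * of_real (cos (rho m k * t))"
    using Ct wave_op_wave_shift unfolding C_def cos_op_def r_def by metis
  have "sinc_op m (wave k) x t = wave k x * S t"
    using wave_op_wave_shift unfolding S_def sinc_op_def by metis
  then show "of_real (rho m k) * sinc_op m (wave k) x t = wave k x * of_real (sin (rho m k * t))"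
    using St by (simp add: r_def mult.left_commute)
  show "dsinc_op m (wave k) x t = of_real k * sinc_op m (wave k) x t"
  proof -
    have "dsinc_op m (wave k) x t = wave k x * dsinc_op m (wave k) 0 t"
      unfolding dsinc_op_def by (rule wave_op_wave_shift)
    also have "\<dots> = of_real k * (wave k x * S t)"
      by (simp add: propagator_ode(1) S_def)
    finally show ?thesis
      using \<open>sinc_op m (wave k) x t = wave k x * S t\<close> by simp
  qed
qed

section \<open>Propagated data and the limit of the truncated Fourier integrals\<close>

lemma bessel_avg_continuous:
  fixes \<psi> :: "real \<Rightarrow> real \<Rightarrow> complex" and f g :: "'a::topological_space \<Rightarrow> real"
  assumes b: "continuous_on {-1..1} b" and \<psi>: "continuous_on UNIV (\<lambda>q. \<psi> (fst q) (snd q))"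
    and f: "continuous_on S f" and g: "continuous_on S g"
  shows "continuous_on S (\<lambda>p. bessel_avg m r b (\<psi> (f p)) x (g p))"
proof -
  have f': "continuous_on (S \<times> {-1..1}) (\<lambda>q. f (fst q))" and g': "continuous_on (S \<times> {-1..1}) (\<lambda>q. g (fst q))"
    and b': "continuous_on (S \<times> {-1..1}) (\<lambda>q. b (snd q))"
    by (intro continuous_on_compose2[OF f] continuous_on_compose2[OF g] continuous_on_compose2[OF b]
        continuous_intros; auto)+
  have "continuous_on (S \<times> {-1..1::real}) (\<lambda>q. (f (fst q), x + g (fst q) * snd q))"
    by (intro continuous_intros f' g')
  from continuous_on_compose2[OF \<psi> this]
  have "continuous_on (S \<times> {-1..1}) (\<lambda>q. \<psi> (f (fst q)) (x + g (fst q) * snd q))" by simp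
  then have "continuous_on (S \<times> cbox (-1) 1)
     (\<lambda>(p, s). b s * of_real (cone_bessel m r (g p) s) * \<psi> (f p) (x + g p * s))"
    unfolding case_prod_unfold cbox_interval by (intro continuous_intros f' g' b')
  from integral_continuous_on_param[OF this] show ?thesis
    by (simp only: bessel_avg_def cbox_interval)
qed

lemma wave_op_continuous:
  fixes \<psi> :: "real \<Rightarrow> real \<Rightarrow> complex" and f g :: "'a::topological_space \<Rightarrow> real"
  assumes b: "continuous_on {-1..1} b" and \<psi>: "continuous_on UNIV (\<lambda>q. \<psi> (fst q) (snd q))"
    and f: "continuous_on S f" and g: "continuous_on S g"
  shows "continuous_on S (\<lambda>p. wave_op m c1 c2 n r b (\<psi> (f p)) x (g p))"
proof -
  have "continuous_on S (\<lambda>p. (f p, x + g p))" "continuous_on S (\<lambda>p. (f p, x - g p))"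
    by (intro continuous_intros f g)+
  from this[THEN continuous_on_compose2[OF \<psi>]] show ?thesis
    unfolding wave_op_def by (intro continuous_intros bessel_avg_continuous[OF b \<psi>] f g) auto
qed

lemma wave_op_wave_continuous:
  fixes f g :: "'a::topological_space \<Rightarrow> real"
  assumes "continuous_on {-1..1} b" "continuous_on S f" "continuous_on S g"
  shows "continuous_on S (\<lambda>p. wave_op m c1 c2 n r b (wave (f p)) x (g p))"
  by (rule wave_op_continuous[OF assms(1) _ assms(2,3)]) (intro continuous_intros)

text \<open>The operators act on \<open>z\<close> and not on \<open>k\<close>, so they commute with superposition of plane waves.\<close>

lemma wave_op_superposition:
  assumes b: "continuous_on {-1..1} b" and F: "continuous_on {-A..A} F"
  shows "integral {-A..A} (\<lambda>k. wave_op m c1 c2 n r b (wave k) x t * F k) =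
     wave_op m c1 c2 n r b (\<lambda>z. integral {-A..A} (\<lambda>k. wave k z * F k)) x t"
proof -
  let ?K = "\<lambda>s. of_real (cone_bessel m r t s) :: complex"
  have 1: "(\<lambda>k. c * (wave k z * F k)) integrable_on {-A..A}" for c z
    by (intro integrable_continuous_real continuous_intros F)
  have "continuous_on {-A..A} (\<lambda>k. bessel_avg m r b (wave k) x t)"
    using bessel_avg_continuous[OF b, of wave "{-A..A}" "\<lambda>k. k" "\<lambda>k. t" m r x]
    by (simp add: continuous_intros)
  then have 2: "(\<lambda>k. of_real t ^ n * (bessel_avg m r b (wave k) x t * F k)) integrable_on {-A..A}"
    by (intro integrable_continuous_real continuous_intros F)
  have swap: "integral {-A..A} (\<lambda>k. bessel_avg m r b (wave k) x t * F k)
      = bessel_avg m r b (\<lambda>z. integral {-A..A} (\<lambda>k. wave k z * F k)) x t"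
  proof -
    have "integral {-A..A} (\<lambda>k. bessel_avg m r b (wave k) x t * F k)
      = integral (cbox (-A) A) (\<lambda>k. integral (cbox (-1) 1) (\<lambda>s. b s * ?K s * wave k (x + t * s) * F k))"
      unfolding bessel_avg_def by simp
    also have "\<dots> = integral (cbox (-1) 1) (\<lambda>s. integral (cbox (-A) A) (\<lambda>k. b s * ?K s * wave k (x + t * s) * F k))"
    proof (rule integral_swap_continuous)
      have "continuous_on ({-A..A} \<times> {-1..1}) (\<lambda>p. b (snd p))" "continuous_on ({-A..A} \<times> {-1..1::real}) (\<lambda>p. F (fst p))"
        by (intro continuous_on_compose2[OF b] continuous_on_compose2[OF F] continuous_intros; auto)+
      then show "continuous_on (cbox (- A, - 1) (A, 1)) (\<lambda>(k, s). b s * ?K s * wave k (x + t * s) * F k)"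
        unfolding cbox_Pair_eq unfolding case_prod_unfold cbox_interval by (intro continuous_intros)
    qed
    also have "\<dots> = bessel_avg m r b (\<lambda>z. integral {-A..A} (\<lambda>k. wave k z * F k)) x t"
      unfolding bessel_avg_def cbox_interval integral_mult_right[symmetric] by (simp only: mult.assoc)
    finally show ?thesis .
  qed
  have "integral {-A..A} (\<lambda>k. wave_op m c1 c2 n r b (wave k) x t * F k) =
    integral {-A..A} (\<lambda>k. c1 * (wave k (x + t) * F k) + c2 * (wave k (x - t) * F k)
      + of_real t ^ n * (bessel_avg m r b (wave k) x t * F k))"
    by (intro integral_cong) (simp add: wave_op_def algebra_simps)
  also have "\<dots> = integral {-A..A} (\<lambda>k. c1 * (wave k (x + t) * F k)) + integral {-A..A} (\<lambda>k. c2 * (wave k (x - t) * F k))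
      + integral {-A..A} (\<lambda>k. of_real t ^ n * (bessel_avg m r b (wave k) x t * F k))"
    by (simp only: integral_add[OF integrable_add[OF 1 1] 2] integral_add[OF 1 1])
  also have "\<dots> = wave_op m c1 c2 n r b (\<lambda>z. integral {-A..A} (\<lambda>k. wave k z * F k)) x t"
    by (simp only: integral_mult_right swap wave_op_def)
  finally show ?thesis .
qed

lemma bounded_on_interval:
  fixes f :: "real \<Rightarrow> complex"
  assumes "continuous_on {a..b} f"
  obtains B where "B \<ge> 0" "\<And>s. s \<in> {a..b} \<Longrightarrow> norm (f s) \<le> B"
proof -
  have "compact (f ` {a..b})" by (intro compact_continuous_image assms) auto
  then have "bounded (f ` {a..b})" by (rule compact_imp_bounded)
  then obtain B where B: "\<And>s. s \<in> {a..b} \<Longrightarrow> norm (f s) \<le> B"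
    unfolding bounded_iff by blast
  show ?thesis by (rule that[of "max 0 B"]) (use B in \<open>fastforce+\<close>)
qed

text \<open>For \<open>t < x\<close> every point \<open>x + t s\<close> is positive, so convergence of \<open>\<Phi> A\<close> is needed on the positive
  half-line only.\<close>

lemma wave_op_tendsto:
  fixes \<Phi> :: "real \<Rightarrow> real \<Rightarrow> complex"
  assumes b: "continuous_on {-1..1} b"
    and cont: "\<And>A. A \<ge> 0 \<Longrightarrow> continuous_on UNIV (\<Phi> A)"
    and bd: "\<And>A z. A \<ge> 0 \<Longrightarrow> norm (\<Phi> A z) \<le> B"
    and lim: "\<And>z. z > 0 \<Longrightarrow> ((\<lambda>A. \<Phi> A z) \<longlongrightarrow> L z) at_top"
    and xt: "0 < t" "t < x"
  shows "((\<lambda>A. wave_op m c1 c2 n r b (\<Phi> A) x t) \<longlongrightarrow> wave_op m c1 c2 n r b L x t) at_top"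
proof -
  have bK: "continuous_on {-1..1} (\<lambda>s. b s * of_real (cone_bessel m r t s))"
    by (intro continuous_intros b)
  obtain C where C: "C \<ge> 0" "\<And>s. s \<in> {-1..1} \<Longrightarrow> norm (b s * of_real (cone_bessel m r t s)) \<le> C"
    using bounded_on_interval[OF bK] by blast
  have "B \<ge> 0" using order_trans[OF norm_ge_zero bd[of 0]] by simp
  have pos: "x + t * s > 0" if "s \<in> {-1..1}" for s
  proof -
    have "- t \<le> t * s" using mult_left_mono[of "-1" s t] that xt by simp
    then show ?thesis using xt by simp
  qed
  have "((\<lambda>A. bessel_avg m r b (\<Phi> A) x t) \<longlongrightarrow> bessel_avg m r b L x t) at_top"
    unfolding bessel_avg_def
  proof (rule dominated_convergence_at_top)
    show "(\<lambda>s. b s * of_real (cone_bessel m r t s) * \<Phi> A (x + t * s)) integrable_on {-1..1}" if "A \<ge> 0" for A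
      by (intro integrable_continuous_real bessel_avg_integrand_continuous[OF b cont[OF that]]) auto
    show "(\<lambda>s::real. C * B) integrable_on {-1..1}"
      by (intro integrable_continuous_real continuous_intros)
    show "norm (b s * of_real (cone_bessel m r t s) * \<Phi> A (x + t * s)) \<le> C * B" if "A \<ge> 0" "s \<in> {-1..1}" for A s
      by (subst norm_mult) (intro mult_mono C bd that norm_ge_zero)
    show "((\<lambda>A. b s * of_real (cone_bessel m r t s) * \<Phi> A (x + t * s)) \<longlongrightarrow>
        b s * of_real (cone_bessel m r t s) * L (x + t * s)) at_top" if "s \<in> {-1..1}" for s
      by (intro tendsto_mult tendsto_const lim pos that)
  qed
  then show ?thesis
    unfolding wave_op_def using xt by (intro tendsto_add tendsto_mult tendsto_const lim) auto
qed

lemma partial_inversion_continuous: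
  assumes f: "schwartz_halfline f"
  shows "continuous_on UNIV (partial_inversion A f)"
proof -
  have "continuous_on (UNIV \<times> cbox (-A) A) (\<lambda>(z, k). wave k z * halfline_fourier f k)"
    unfolding case_prod_unfold
    by (intro continuous_intros continuous_on_compose2[OF halfline_fourier_continuous[OF f]]) auto
  from integral_continuous_on_param[OF this] show ?thesis
    by (simp add: partial_inversion_def[abs_def] wave_def)
qed

lemma partial_inversion_wave:
  "integral {-A..A} (\<lambda>k. wave k z * halfline_fourier f k) = partial_inversion A f z"
  by (simp add: partial_inversion_def wave_def)

text \<open>Reflecting the transform amounts to evaluating the inversion at \<open>-z\<close>; for \<open>z > 0\<close> the extension
  of \<open>f\<close> by zero vanishes there.\<close>

lemma partial_inversion_reflected:
  "integral {-A..A} (\<lambda>k. wave k z * halfline_fourier f (-k)) = partial_inversion A f (-z)"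
proof -
  have "integral {-A..A} (\<lambda>k. wave k z * halfline_fourier f (-k))
      = integral {-A..A} (\<lambda>k. wave (-k) (-z) * halfline_fourier f (-k))"
    by (intro integral_cong) (simp add: wave_def)
  also have "\<dots> = partial_inversion A f (-z)"
    using Henstock_Kurzweil_Integration.integral_reflect_real[of A "-A" "\<lambda>k. wave k (-z) * halfline_fourier f k"]
    by (simp add: partial_inversion_wave)
  finally show ?thesis .
qed

lemma wave_op_inversion:
  assumes f: "schwartz_halfline f" and b: "continuous_on {-1..1} b" and xt: "0 < t" "t < x"
  shows "((\<lambda>A. integral {-A..A} (\<lambda>k. wave_op m c1 c2 n r b (wave k) x t * halfline_fourier f k)) \<longlongrightarrow>
      of_real (2 * pi) * wave_op m c1 c2 n r b f x t) at_top"
    and "((\<lambda>A. integral {-A..A} (\<lambda>k. wave_op m c1 c2 n r b (wave k) x t * halfline_fourier f (-k))) \<longlongrightarrow> 0) at_top"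
proof -
  obtain B where B: "B \<ge> 0" "\<And>A z. A \<ge> 0 \<Longrightarrow> norm (partial_inversion A f z) \<le> B"
    using partial_inversion_bounded[OF f] by blast
  note fc = continuous_on_subset[OF halfline_fourier_continuous[OF f] subset_UNIV]
  have fc': "continuous_on S (\<lambda>k. halfline_fourier f (-k))" for S
    by (intro continuous_on_compose2[OF fc[of UNIV]] continuous_intros) auto
  have scale: "wave_op m c1 c2 n r b (\<lambda>z. c * f z) x t = c * wave_op m c1 c2 n r b f x t" for c
    unfolding wave_op_def bessel_avg_cmult_fun by (simp add: algebra_simps)
  show "((\<lambda>A. integral {-A..A} (\<lambda>k. wave_op m c1 c2 n r b (wave k) x t * halfline_fourier f k)) \<longlongrightarrow>
      of_real (2 * pi) * wave_op m c1 c2 n r b f x t) at_top"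
    unfolding wave_op_superposition[OF b fc] partial_inversion_wave scale[symmetric]
    by (rule wave_op_tendsto[OF b partial_inversion_continuous[OF f] B(2) fourier_inversion(1)[OF f] xt])
  have "((\<lambda>A. wave_op m c1 c2 n r b (\<lambda>z. partial_inversion A f (-z)) x t) \<longlongrightarrow> wave_op m c1 c2 n r b (\<lambda>z. 0) x t) at_top"
    by (rule wave_op_tendsto[OF b _ B(2) fourier_inversion(2)[OF f] xt])
      (intro continuous_on_compose2[OF partial_inversion_continuous[OF f]] continuous_intros, auto)
  then show "((\<lambda>A. integral {-A..A} (\<lambda>k. wave_op m c1 c2 n r b (wave k) x t * halfline_fourier f (-k))) \<longlongrightarrow> 0) at_top"
    unfolding wave_op_superposition[OF b fc'] partial_inversion_reflected by (simp add: wave_op_def bessel_avg_def)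
qed

text \<open>A Riemann-Lebesgue lemma: on an interval that the phase \<open>p + q s\<close> maps into the positive numbers the
  primitive of the kernel tends to the constant \<open>\<pi>\<close>, and the terms of an integration by parts
  cancel in the limit.\<close>

lemma riemann_lebesgue_dirichlet:
  assumes d: "\<And>s. s \<in> {a..b} \<Longrightarrow> (\<phi> has_vector_derivative \<phi>' s) (at s within {a..b})"
    and c: "continuous_on {a..b} \<phi>'" and ab: "a \<le> b" and q: "q \<noteq> 0"
    and pos: "\<And>s. s \<in> {a..b} \<Longrightarrow> p + q * s > 0"
  shows "((\<lambda>A. integral {a..b} (\<lambda>s. \<phi> s * dirichlet_kernel A (p + q * s))) \<longlongrightarrow> 0) at_top"
proof -
  let ?S = "\<lambda>A s. dirichlet_primitive A (p + q * s)" and ?D = "\<lambda>A s. dirichlet_kernel A (p + q * s)"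
  obtain B where B: "B \<ge> 0" "\<And>A v. norm (dirichlet_primitive A v) \<le> B"
    using dirichlet_primitive_bounded by blast
  obtain C where C: "C \<ge> 0" "\<And>s. s \<in> {a..b} \<Longrightarrow> norm (\<phi>' s) \<le> C"
    using bounded_on_interval[OF c] by blast
  have \<phi>c: "continuous_on {a..b} \<phi>"
    using d has_vector_derivative_continuous continuous_on_eq_continuous_within by blast
  have parts: "integral {a..b} (\<lambda>s. \<phi> s * ?D A s) =
      (\<phi> b * ?S A b - \<phi> a * ?S A a - integral {a..b} (\<lambda>s. \<phi>' s * ?S A s)) / of_real q" for A
  proof -
    have "((\<lambda>s. \<phi> s * (of_real q * ?D A s) + \<phi>' s * ?S A s) has_integral \<phi> b * ?S A b - \<phi> a * ?S A a) {a..b}"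
    proof (rule fundamental_theorem_of_calculus[OF ab])
      fix s assume s: "s \<in> {a..b}"
      have "(?S A has_vector_derivative of_real q * ?D A s) (at s within {a..b})"
        by (rule has_vector_derivative_chain_real[where u = "\<lambda>s. p + q * s", OF dirichlet_primitive_deriv])
          (auto intro!: derivative_eq_intros)
      then show "((\<lambda>s. \<phi> s * ?S A s) has_vector_derivative \<phi> s * (of_real q * ?D A s) + \<phi>' s * ?S A s) (at s within {a..b})"
        by (intro has_vector_derivative_mult d s)
    qed
    then have "integral {a..b} (\<lambda>s. of_real q * (\<phi> s * ?D A s) + \<phi>' s * ?S A s) = \<phi> b * ?S A b - \<phi> a * ?S A a"
      by (simp add: integral_unique mult.left_commute)
    moreover have "integral {a..b} (\<lambda>s. of_real q * (\<phi> s * ?D A s) + \<phi>' s * ?S A s)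
       = of_real q * integral {a..b} (\<lambda>s. \<phi> s * ?D A s) + integral {a..b} (\<lambda>s. \<phi>' s * ?S A s)"
      unfolding integral_mult_right[symmetric]
      by (intro integral_add integrable_continuous_real continuous_intros \<phi>c c)
    ultimately show ?thesis using q by (simp add: field_simps)
  qed
  have "((\<lambda>A. integral {a..b} (\<lambda>s. \<phi>' s * ?S A s)) \<longlongrightarrow> integral {a..b} (\<lambda>s. \<phi>' s * of_real pi)) at_top"
  proof (rule dominated_convergence_at_top)
    show "(\<lambda>s. \<phi>' s * ?S A s) integrable_on {a..b}" for A
      by (intro integrable_continuous_real continuous_intros c)
    show "(\<lambda>s::real. C * B) integrable_on {a..b}" by (intro integrable_continuous_real continuous_intros)
    show "norm (\<phi>' s * ?S A s) \<le> C * B" if "s \<in> {a..b}" for A s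
      by (subst norm_mult) (intro mult_mono C B that norm_ge_zero)
    show "((\<lambda>A. \<phi>' s * ?S A s) \<longlongrightarrow> \<phi>' s * of_real pi) at_top" if "s \<in> {a..b}" for s
      by (intro tendsto_mult tendsto_const dirichlet_primitive_pos pos that)
  qed
  moreover have "integral {a..b} (\<lambda>s. \<phi>' s * of_real pi) = (\<phi> b - \<phi> a) * of_real pi"
    unfolding integral_mult_left using fundamental_theorem_of_calculus[OF ab d] by (simp add: integral_unique)
  ultimately have "((\<lambda>A. (\<phi> b * ?S A b - \<phi> a * ?S A a - integral {a..b} (\<lambda>s. \<phi>' s * ?S A s)) / of_real q) \<longlongrightarrow>
     (\<phi> b * of_real pi - \<phi> a * of_real pi - (\<phi> b - \<phi> a) * of_real pi) / of_real q) at_top"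
    using ab q by (intro tendsto_intros dirichlet_primitive_pos pos) auto
  then show ?thesis unfolding parts by (simp add: algebra_simps)
qed

section \<open>The boundary source stays inside the light cone\<close>

text \<open>The Bessel factor is bounded because its argument stays in \<open>[0, T\<^sup>2]\<close>. Where the integrand is not
  integrable the average is \<open>0\<close> by convention.\<close>

lemma bessel_avg_bound:
  assumes b: "continuous_on {-1..1} b"
  shows "\<exists>C\<ge>0. \<forall>t\<in>{0..T}. \<forall>\<phi> x M. 0 \<le> M \<longrightarrow> (\<forall>s\<in>{-1..1}. norm (\<phi> (x + t * s)) \<le> M) \<longrightarrow>
      norm (bessel_avg m r b \<phi> x t) \<le> C * M"
proof -
  obtain B where B: "B \<ge> 0" "\<And>s. s \<in> {-1..1} \<Longrightarrow> norm (b s) \<le> B"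
    using bounded_on_interval[OF b] by blast
  have "continuous_on {0..T\<^sup>2} (\<lambda>u. complex_of_real (bessel m r u))"
    by (intro continuous_intros)
  from bounded_on_interval[OF this] obtain K
    where K: "K \<ge> 0" "\<And>u. u \<in> {0..T\<^sup>2} \<Longrightarrow> norm (complex_of_real (bessel m r u)) \<le> K" by blast
  show ?thesis
  proof (intro exI[of _ "B * K * 2"] conjI ballI allI impI)
    show "0 \<le> B * K * 2" using B K by simp
    fix t x M :: real and \<phi> :: "real \<Rightarrow> complex" assume t: "t \<in> {0..T}" and M: "0 \<le> M" "\<forall>s\<in>{-1..1}. norm (\<phi> (x + t * s)) \<le> M"
    let ?f = "\<lambda>s. b s * of_real (cone_bessel m r t s) * \<phi> (x + t * s)"
    have bd: "norm (?f s) \<le> B * K * M" if s: "s \<in> {-1..1}" for s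
    proof -
      have "s\<^sup>2 \<le> 1" using s by (simp add: abs_square_le_1 abs_le_iff)
      moreover have "t\<^sup>2 \<le> T\<^sup>2" using t by (simp add: power_mono)
      moreover have "t\<^sup>2 * (1 - s\<^sup>2) \<le> t\<^sup>2 * 1" by (intro mult_left_mono) auto
      ultimately have "t\<^sup>2 * (1 - s\<^sup>2) \<in> {0..T\<^sup>2}" by auto
      then show ?thesis
        unfolding norm_mult using B(2)[OF s] K B(1) M s by (intro mult_mono) auto
    qed
    show "norm (bessel_avg m r b \<phi> x t) \<le> B * K * 2 * M"
    proof (cases "?f integrable_on {-1..1}")
      case True
      have "norm (integral {-1..1} ?f) \<le> integral {-1..1} (\<lambda>s::real. B * K * M)"
        by (intro integral_norm_bound_integral True bd integrable_continuous_real continuous_intros)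
      then show ?thesis unfolding bessel_avg_def by (simp add: mult_ac)
    next
      case False
      then show ?thesis unfolding bessel_avg_def using B K M by (simp add: not_integrable_integral)
    qed
  qed
qed

lemma light_cone_lower_bound:
  fixes x t s :: real
  assumes "0 \<le> t" "s \<in> {-1..1}" shows "x - t \<le> x + t * s"
  using mult_left_mono[of "-1" s t] assms by simp

text \<open>A source at the origin acting during \<open>[0, t]\<close> produces nothing at \<open>x > t\<close>. In the two travelling
  terms the oscillation is used in \<open>\<tau>\<close>, as their kernels do not converge pointwise; in the averaged term
  it is used in \<open>s\<close> for each fixed \<open>\<tau> < t\<close>, followed by dominated convergence in \<open>\<tau>\<close>. At \<open>\<tau> = t\<close> the
  average degenerates to a multiple of one value of the kernel and has no limit, but there the prefactor
  \<open>(t - \<tau>)\<^sup>n\<close> with \<open>n > 0\<close> vanishes.\<close>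

lemma wave_op_source_vanishes:
  assumes h: "smooth_halfline h" and b: "\<And>s. (b has_vector_derivative b' s) (at s)"
    and b': "continuous_on {-1..1} b'" and n: "n > 0" and xt: "0 < t" "t < x"
  shows "((\<lambda>A. integral {-A..A} (\<lambda>k. integral {0..t} (\<lambda>\<tau>. h \<tau> * wave_op m c1 c2 n r b (wave k) x (t - \<tau>))))
      \<longlongrightarrow> 0) at_top"
proof -
  have bc: "continuous_on {-1..1} b"
    by (meson b continuous_at_imp_continuous_on has_vector_derivative_continuous)
  have hc: "continuous_on {0..t} h" "continuous_on {0..t} (halfline_deriv 1 h)"
    by (intro continuous_on_subset[OF smooth_halfline_continuous] h smooth_halfline_deriv; auto)+
  have hd: "(h has_vector_derivative halfline_deriv 1 h \<tau>) (at \<tau> within {0..t})" if "\<tau> \<in> {0..t}" for \<tau>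
    using that by (intro has_vector_derivative_within_subset[OF smooth_halfline_has_deriv_within[OF h]]) auto
  obtain H where H: "H \<ge> 0" "\<And>\<tau>. \<tau> \<in> {0..t} \<Longrightarrow> norm (h \<tau>) \<le> H"
    using bounded_on_interval[OF hc(1)] by blast
  let ?D = dirichlet_kernel
  let ?I1 = "\<lambda>A. integral {0..t} (\<lambda>\<tau>. h \<tau> * ?D A (x + (t - \<tau>)))"
  let ?I2 = "\<lambda>A. integral {0..t} (\<lambda>\<tau>. h \<tau> * ?D A (x - (t - \<tau>)))"
  let ?I3 = "\<lambda>A. integral {0..t} (\<lambda>\<tau>. h \<tau> * of_real (t - \<tau>) ^ n * bessel_avg m r b (?D A) x (t - \<tau>))"
  have W: "continuous_on {0..t} (\<lambda>\<tau>. h \<tau> * ?D A (x + (t - \<tau>)))"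
    "continuous_on {0..t} (\<lambda>\<tau>. h \<tau> * ?D A (x - (t - \<tau>)))" for A
    by (intro continuous_intros hc)+
  have avgc: "continuous_on {0..t} (\<lambda>\<tau>. bessel_avg m r b (?D A) x (t - \<tau>))" for A
    by (rule bessel_avg_continuous[OF bc, where \<psi> = "\<lambda>_. ?D A" and f = "\<lambda>_. 0"]) (intro continuous_intros)+
  have eq: "integral {-A..A} (\<lambda>k. integral {0..t} (\<lambda>\<tau>. h \<tau> * wave_op m c1 c2 n r b (wave k) x (t - \<tau>))) =
      c1 * ?I1 A + c2 * ?I2 A
       + ?I3 A" if A: "A \<ge> 0" for A
  proof -
    have "integral {-A..A} (\<lambda>k. integral {0..t} (\<lambda>\<tau>. h \<tau> * wave_op m c1 c2 n r b (wave k) x (t - \<tau>))) =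
       integral (cbox (-A) A) (\<lambda>k. integral (cbox 0 t) (\<lambda>\<tau>. h \<tau> * wave_op m c1 c2 n r b (wave k) x (t - \<tau>)))"
      by simp
    also have "\<dots> = integral (cbox 0 t) (\<lambda>\<tau>. integral (cbox (-A) A) (\<lambda>k. h \<tau> * wave_op m c1 c2 n r b (wave k) x (t - \<tau>)))"
    proof (rule integral_swap_continuous)
      have "continuous_on ({-A..A} \<times> {0..t}) (\<lambda>p. h (snd p))"
        by (intro continuous_on_compose2[OF hc(1)] continuous_intros) auto
      then show "continuous_on (cbox (- A, 0) (A, t)) (\<lambda>(k, \<tau>). h \<tau> * wave_op m c1 c2 n r b (wave k) x (t - \<tau>))"
        unfolding cbox_Pair_eq unfolding case_prod_unfold cbox_interval
        by (intro continuous_intros wave_op_wave_continuous bc)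
    qed
    also have "\<dots> = integral {0..t} (\<lambda>\<tau>. h \<tau> * wave_op m c1 c2 n r b (?D A) x (t - \<tau>))"
    proof -
      have "integral {-A..A} (\<lambda>k. wave_op m c1 c2 n r b (wave k) x u) = wave_op m c1 c2 n r b (?D A) x u" for u
        using wave_op_superposition[OF bc, of A "\<lambda>k. 1" m c1 c2 n r x u] integral_exp_eq_dirichlet_kernel[OF A]
        by (simp add: wave_def)
      then show ?thesis by simp
    qed
    also have "\<dots> = integral {0..t} (\<lambda>\<tau>. c1 * (h \<tau> * ?D A (x + (t - \<tau>))) + c2 * (h \<tau> * ?D A (x - (t - \<tau>)))
       + h \<tau> * of_real (t - \<tau>) ^ n * bessel_avg m r b (?D A) x (t - \<tau>))"
      by (intro integral_cong) (simp add: wave_op_def algebra_simps)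
    also have "\<dots> = integral {0..t} (\<lambda>\<tau>. c1 * (h \<tau> * ?D A (x + (t - \<tau>)))) + integral {0..t} (\<lambda>\<tau>. c2 * (h \<tau> * ?D A (x - (t - \<tau>))))
       + ?I3 A"
    proof -
      have 1: "(\<lambda>\<tau>. c1 * (h \<tau> * ?D A (x + (t - \<tau>)))) integrable_on {0..t}"
        and 2: "(\<lambda>\<tau>. c2 * (h \<tau> * ?D A (x - (t - \<tau>)))) integrable_on {0..t}"
        and 3: "(\<lambda>\<tau>. h \<tau> * of_real (t - \<tau>) ^ n * bessel_avg m r b (?D A) x (t - \<tau>)) integrable_on {0..t}"
        by (intro integrable_continuous_real continuous_on_mult_left W;
            intro integrable_continuous_real continuous_intros hc avgc)+
      show ?thesis
        by (simp only: integral_add[OF integrable_add[OF 1 2] 3] integral_add[OF 1 2])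
    qed
    finally show ?thesis by (simp only: integral_mult_right)
  qed
  have L1: "((\<lambda>A. ?I1 A) \<longlongrightarrow> 0) at_top"
    using riemann_lebesgue_dirichlet[of 0 t h "halfline_deriv 1 h" "-1" "x + t", OF hd hc(2)] xt
    by (simp add: algebra_simps)
  have L2: "((\<lambda>A. ?I2 A) \<longlongrightarrow> 0) at_top"
    using riemann_lebesgue_dirichlet[of 0 t h "halfline_deriv 1 h" "1" "x - t", OF hd hc(2)] xt
    by (simp add: algebra_simps)
  have avg0: "((\<lambda>A. bessel_avg m r b (?D A) x u) \<longlongrightarrow> 0) at_top" if u: "0 < u" "u \<le> t" for u
    unfolding bessel_avg_def
  proof (rule riemann_lebesgue_dirichlet)
    fix s :: real assume s: "s \<in> {-1..1}"
    have "((\<lambda>s. complex_of_real (cone_bessel m r u s)) has_vector_derivative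
       of_real (cone_bessel m (Suc r) u s * (u\<^sup>2 * - (2 * s)))) (at s within {-1..1})"
      by (intro has_vector_derivative_of_real) (auto intro!: derivative_eq_intros)
    then show "((\<lambda>s. b s * complex_of_real (cone_bessel m r u s)) has_vector_derivative
        b s * of_real (cone_bessel m (Suc r) u s * (u\<^sup>2 * - (2 * s))) +
        b' s * of_real (cone_bessel m r u s)) (at s within {-1..1})"
      by (intro has_vector_derivative_mult has_vector_derivative_at_within[OF b])
    show "0 < x + u * s" using light_cone_lower_bound[of u s x] u s xt by simp
  next
    show "continuous_on {-1..1} (\<lambda>s. b s * of_real (cone_bessel m (Suc r) u s * (u\<^sup>2 * - (2 * s))) +
        b' s * of_real (cone_bessel m r u s))"
      by (intro continuous_intros bc b')
  qed (use u in auto)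
  obtain C where C: "C \<ge> 0" "\<And>u \<phi> z M. u \<in> {0..t} \<Longrightarrow> 0 \<le> M \<Longrightarrow> (\<forall>s\<in>{-1..1}. norm (\<phi> (z + u * s)) \<le> M) \<Longrightarrow>
      norm (bessel_avg m r b \<phi> z u) \<le> C * M"
    using bessel_avg_bound[OF bc, of t m r] by blast
  have "((\<lambda>A. ?I3 A) \<longlongrightarrow>
     integral {0..t} (\<lambda>\<tau>. 0)) at_top"
  proof (rule dominated_convergence_at_top)
    show "(\<lambda>\<tau>. h \<tau> * of_real (t - \<tau>) ^ n * bessel_avg m r b (?D A) x (t - \<tau>)) integrable_on {0..t}" for A
      by (intro integrable_continuous_real continuous_intros hc avgc)
    show "(\<lambda>\<tau>::real. H * t ^ n * (C * (2 / (x - t)))) integrable_on {0..t}"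
      by (intro integrable_continuous_real continuous_intros)
    show "norm (h \<tau> * of_real (t - \<tau>) ^ n * bessel_avg m r b (?D A) x (t - \<tau>)) \<le> H * t ^ n * (C * (2 / (x - t)))"
      if \<tau>: "\<tau> \<in> {0..t}" for A \<tau>
    proof -
      have "norm (bessel_avg m r b (?D A) x (t - \<tau>)) \<le> C * (2 / (x - t))"
      proof (rule C(2))
        show "t - \<tau> \<in> {0..t}" "0 \<le> 2 / (x - t)" using \<tau> xt by auto
        show "\<forall>s\<in>{- 1..1}. norm (?D A (x + (t - \<tau>) * s)) \<le> 2 / (x - t)"
        proof
          fix s :: real assume "s \<in> {-1..1}"
          then show "norm (?D A (x + (t - \<tau>) * s)) \<le> 2 / (x - t)"
            using light_cone_lower_bound[of "t - \<tau>" s x] \<tau> xt by (intro dirichlet_kernel_bound) auto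
        qed
      qed
      moreover have "norm (of_real (t - \<tau>) ^ n :: complex) \<le> t ^ n"
        unfolding norm_power norm_of_real using \<tau> by (intro power_mono) auto
      ultimately show ?thesis
        unfolding norm_mult using H \<tau> xt by (intro mult_mono) auto
    qed
    show "((\<lambda>A. h \<tau> * of_real (t - \<tau>) ^ n * bessel_avg m r b (?D A) x (t - \<tau>)) \<longlongrightarrow> 0) at_top" if \<tau>: "\<tau> \<in> {0..t}" for \<tau>
    proof (cases "\<tau> = t")
      case True
      then show ?thesis using n by (simp add: zero_power)
    next
      case False
      then have "((\<lambda>A. h \<tau> * of_real (t - \<tau>) ^ n * bessel_avg m r b (?D A) x (t - \<tau>)) \<longlongrightarrow> h \<tau> * of_real (t - \<tau>) ^ n * 0) at_top"
        using \<tau> by (intro tendsto_mult tendsto_const avg0) auto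
      then show ?thesis by simp
    qed
  qed
  then have L3: "((\<lambda>A. ?I3 A) \<longlongrightarrow> 0) at_top"
    by simp
  have "((\<lambda>A. c1 * ?I1 A + c2 * ?I2 A
       + ?I3 A) \<longlongrightarrow> c1 * 0 + c2 * 0 + 0) at_top"
    by (intro tendsto_intros L1 L2 L3)
  then have "((\<lambda>A. c1 * ?I1 A + c2 * ?I2 A
       + ?I3 A) \<longlongrightarrow> 0) at_top"
    by simp
  then show ?thesis
    by (rule Lim_transform_eventually) (rule eventually_mono[OF eventually_ge_at_top[of 0]], simp only: eq)
qed

section \<open>Smooth rapidly decaying fields outside the light cone\<close>

text \<open>The fields generated by Schwartz data through waves of speed at most one and Bessel averages. Allowing all weights \<open>b\<close>, all Bessel indices and all powers of \<open>t\<close> is what makes the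
  class closed under differentiation; constants are absorbed into \<open>c\<close> and \<open>b\<close>.\<close>

inductive kg_class :: "real \<Rightarrow> (real \<Rightarrow> real \<Rightarrow> complex) \<Rightarrow> bool" for m where
  travelling: "schwartz_halfline f \<Longrightarrow> \<epsilon> \<in> {-1..1} \<Longrightarrow> kg_class m (\<lambda>x t. c * f (x + \<epsilon> * t))"
| averaged: "schwartz_halfline f \<Longrightarrow> continuous_on {-1..1} b \<Longrightarrow> kg_class m (\<lambda>x t. of_real t ^ n * bessel_avg m r b f x t)"
| add: "kg_class m F \<Longrightarrow> kg_class m G \<Longrightarrow> kg_class m (\<lambda>x t. F x t + G x t)"

lemma kg_class_cmult: "kg_class m F \<Longrightarrow> kg_class m (\<lambda>x t. c * F x t)"
proof (induction rule: kg_class.induct)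
  case (travelling f \<epsilon> c')
  from kg_class.travelling[OF this, of m "c * c'"] show ?case by (simp add: mult.assoc)
next
  case (averaged f b n r)
  then have "kg_class m (\<lambda>x t. of_real t ^ n * bessel_avg m r (\<lambda>s. c * b s) f x t)"
    by (intro kg_class.averaged continuous_intros)
  then show ?case by (simp add: bessel_avg_cmult_weight mult.left_commute)
next
  case (add F G)
  from kg_class.add[OF add.IH] show ?case by (simp add: distrib_left)
qed

lemma wave_op_kg_class:
  assumes "schwartz_halfline f" "continuous_on {-1..1} b"
  shows "kg_class m (wave_op m c1 c2 n r b f)"
proof -
  have "kg_class m (\<lambda>x t. c1 * f (x + 1 * t) + c2 * f (x + (-1) * t) + of_real t ^ n * bessel_avg m r b f x t)"
    by (intro kg_class.intros assms) auto
  then show ?thesis by (simp add: wave_op_def[abs_def])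
qed

lemma kg_class_deriv_x:
  "kg_class m F \<Longrightarrow> \<exists>G. kg_class m G \<and> (\<forall>x t. 0 < t \<longrightarrow> t < x \<longrightarrow> ((\<lambda>x. F x t) has_vector_derivative G x t) (at x))"
proof (induction rule: kg_class.induct)
  case (travelling f \<epsilon> c)
  show ?case
  proof (intro exI conjI allI impI)
    show "kg_class m (\<lambda>x t. c * halfline_deriv 1 f (x + \<epsilon> * t))"
      by (intro kg_class.travelling schwartz_halfline_deriv travelling)
    fix x t :: real assume xt: "0 < t" "t < x"
    have "x + \<epsilon> * t > 0" using light_cone_lower_bound[of t \<epsilon> x] travelling(2) xt by (simp add: mult.commute)
    then have "((\<lambda>x. f (x + \<epsilon> * t)) has_vector_derivative of_real 1 * halfline_deriv 1 f (x + \<epsilon> * t)) (at x)"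
      by (intro has_vector_derivative_chain_real[where u = "\<lambda>x. x + \<epsilon> * t"]
          smooth_halfline_has_deriv schwartz_halfline_smooth travelling) (auto intro!: derivative_eq_intros)
    from has_vector_derivative_mult_right[OF this]
    show "((\<lambda>x. c * f (x + \<epsilon> * t)) has_vector_derivative c * halfline_deriv 1 f (x + \<epsilon> * t)) (at x)" by simp
  qed
next
  case (averaged f b n r)
  note f' = schwartz_halfline_deriv[OF averaged(1), of 1]
  have d: "(f has_vector_derivative halfline_deriv 1 f z) (at z)" if "z \<in> {0<..}" for z
    using that by (intro smooth_halfline_has_deriv schwartz_halfline_smooth averaged) auto
  have c: "continuous_on {0<..} (halfline_deriv 1 f)"
    by (rule continuous_on_subset[OF smooth_halfline_continuous[OF schwartz_halfline_smooth[OF f']]]) auto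
  show ?case
  proof (intro exI conjI allI impI)
    show "kg_class m (\<lambda>x t. of_real t ^ n * bessel_avg m r b (halfline_deriv 1 f) x t)"
      by (intro kg_class.averaged f' averaged)
    fix x t :: real assume xt: "0 < t" "t < x"
    have "((\<lambda>x. bessel_avg m r b f x t) has_vector_derivative bessel_avg m r b (halfline_deriv 1 f) x t) (at x)"
    proof (rule bessel_avg_has_deriv_x[OF averaged(2) d c])
      show "open {t<..}" "convex {t<..}" "x \<in> {t<..}" using xt by auto
      show "y + t * s \<in> {0<..}" if "y \<in> {t<..}" "s \<in> {-1..1}" for y s
        using light_cone_lower_bound[of t s y] that xt by auto
    qed auto
    then show "((\<lambda>x. of_real t ^ n * bessel_avg m r b f x t) has_vector_derivative
        of_real t ^ n * bessel_avg m r b (halfline_deriv 1 f) x t) (at x)"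
      by (rule has_vector_derivative_mult_right)
  qed
next
  case (add F G)
  then obtain F' G' where *: "kg_class m F'" "kg_class m G'"
    "\<And>x t. 0 < t \<Longrightarrow> t < x \<Longrightarrow> ((\<lambda>x. F x t) has_vector_derivative F' x t) (at x)"
    "\<And>x t. 0 < t \<Longrightarrow> t < x \<Longrightarrow> ((\<lambda>x. G x t) has_vector_derivative G' x t) (at x)"
    by blast
  show ?case
    by (rule exI[of _ "\<lambda>x t. F' x t + G' x t"]) (auto intro!: kg_class.add has_vector_derivative_add *)
qed

text \<open>The members involve the data on \<open>[x - t, x + t]\<close> only, and for \<open>0 < t < x\<close> this interval avoids the
  endpoint \<open>0\<close>, where the data have one-sided derivatives.\<close>

lemma kg_class_deriv_t:
  "kg_class m F \<Longrightarrow> \<exists>G. kg_class m G \<and> (\<forall>x t. 0 < t \<longrightarrow> t < x \<longrightarrow> ((\<lambda>t. F x t) has_vector_derivative G x t) (at t))"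
proof (induction rule: kg_class.induct)
  case (travelling f \<epsilon> c)
  show ?case
  proof (intro exI conjI allI impI)
    show "kg_class m (\<lambda>x t. (c * of_real \<epsilon>) * halfline_deriv 1 f (x + \<epsilon> * t))"
      by (intro kg_class.travelling schwartz_halfline_deriv travelling)
    fix x t :: real assume xt: "0 < t" "t < x"
    have "x + \<epsilon> * t > 0" using light_cone_lower_bound[of t \<epsilon> x] travelling(2) xt by (simp add: mult.commute)
    then have "((\<lambda>t. f (x + \<epsilon> * t)) has_vector_derivative of_real \<epsilon> * halfline_deriv 1 f (x + \<epsilon> * t)) (at t)"
      by (intro has_vector_derivative_chain_real[where u = "\<lambda>t. x + \<epsilon> * t"]
          smooth_halfline_has_deriv schwartz_halfline_smooth travelling) (auto intro!: derivative_eq_intros)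
    from has_vector_derivative_mult_right[OF this]
    show "((\<lambda>t. c * f (x + \<epsilon> * t)) has_vector_derivative (c * of_real \<epsilon>) * halfline_deriv 1 f (x + \<epsilon> * t)) (at t)"
      by (simp add: mult.assoc)
  qed
next
  case (averaged f b n r)
  note f' = schwartz_halfline_deriv[OF averaged(1), of 1]
  have d: "(f has_vector_derivative halfline_deriv 1 f z) (at z)" if "z \<in> {0<..}" for z
    using that by (intro smooth_halfline_has_deriv schwartz_halfline_smooth averaged) auto
  have c: "continuous_on {0<..} (halfline_deriv 1 f)"
    by (rule continuous_on_subset[OF smooth_halfline_continuous[OF schwartz_halfline_smooth[OF f']]]) auto
  let ?b1 = "\<lambda>s. b s * of_real (1 - s\<^sup>2)" and ?b2 = "\<lambda>s. b s * of_real s"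
  have bc: "continuous_on {-1..1} ?b1" "continuous_on {-1..1} ?b2"
    by (intro continuous_intros averaged)+
  show ?case
  proof (intro exI conjI allI impI)
    show "kg_class m (\<lambda>x t. 2 * (of_real t ^ Suc n * bessel_avg m (Suc r) ?b1 f x t) +
        of_real t ^ n * bessel_avg m r ?b2 (halfline_deriv 1 f) x t + of_nat n * (of_real t ^ (n - 1) * bessel_avg m r b f x t))"
      by (intro kg_class.add kg_class_cmult kg_class.averaged f' averaged bc)
    fix x t :: real assume xt: "0 < t" "t < x"
    have "((\<lambda>t. bessel_avg m r b f x t) has_vector_derivative of_real (2 * t) * bessel_avg m (Suc r) ?b1 f x t
       + bessel_avg m r ?b2 (halfline_deriv 1 f) x t) (at t)"
    proof (rule bessel_avg_has_deriv_t[OF averaged(2) d c])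
      show "open {0<..<x}" "convex {0<..<x}" "t \<in> {0<..<x}" using xt by auto
      show "x + u * s \<in> {0<..}" if "u \<in> {0<..<x}" "s \<in> {-1..1}" for u s
        using light_cone_lower_bound[of u s x] that xt by auto
    qed auto
    from has_vector_derivative_mult[OF of_real_power_deriv[of n] this]
    show "((\<lambda>t. of_real t ^ n * bessel_avg m r b f x t) has_vector_derivative
        2 * (of_real t ^ Suc n * bessel_avg m (Suc r) ?b1 f x t) +
        of_real t ^ n * bessel_avg m r ?b2 (halfline_deriv 1 f) x t + of_nat n * (of_real t ^ (n - 1) * bessel_avg m r b f x t)) (at t)"
      by (rule has_vector_derivative_eq_rhs) (simp add: algebra_simps)
  qed
next
  case (add F G)
  then obtain F' G' where *: "kg_class m F'" "kg_class m G'"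
    "\<And>x t. 0 < t \<Longrightarrow> t < x \<Longrightarrow> ((\<lambda>t. F x t) has_vector_derivative F' x t) (at t)"
    "\<And>x t. 0 < t \<Longrightarrow> t < x \<Longrightarrow> ((\<lambda>t. G x t) has_vector_derivative G' x t) (at t)"
    by blast
  show ?case
    by (rule exI[of _ "\<lambda>x t. F' x t + G' x t"]) (auto intro!: kg_class.add has_vector_derivative_add *)
qed

lemma schwartz_halfline_shift_bound:
  assumes f: "schwartz_halfline f"
  shows "\<exists>C\<ge>0. \<forall>x z. 0 < x \<longrightarrow> x / 2 \<le> z \<longrightarrow> norm (f z) \<le> C / x ^ N"
proof -
  obtain C where C: "C \<ge> 0" "\<And>y. y \<ge> 0 \<Longrightarrow> y ^ N * norm (f y) \<le> C"
    using schwartz_halfline_power_bound[OF f] by blast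
  show ?thesis
  proof (intro exI[of _ "2 ^ N * C"] conjI allI impI)
    fix x z :: real assume xz: "0 < x" "x / 2 \<le> z"
    have "(x / 2) ^ N * norm (f z) \<le> z ^ N * norm (f z)"
      using xz by (intro mult_right_mono power_mono) auto
    also have "\<dots> \<le> C" using C(2)[of z] xz by simp
    finally show "norm (f z) \<le> 2 ^ N * C / x ^ N"
      using xz by (simp add: power_divide field_simps)
  qed (use C in simp)
qed

text \<open>For \<open>x \<ge> 2 T\<close> and \<open>t \<le> T\<close> the data are evaluated at points above \<open>x / 2\<close>, so their decay carries over
  with a constant independent of \<open>t\<close>.\<close>

lemma kg_class_decay:
  "kg_class m F \<Longrightarrow> \<exists>C. \<forall>x t. 0 < t \<longrightarrow> t \<le> T \<longrightarrow> 2 * T \<le> x \<longrightarrow> x ^ N * norm (F x t) \<le> C"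
proof (induction rule: kg_class.induct)
  case (travelling f \<epsilon> c)
  obtain C where C: "C \<ge> 0" "\<And>x z. 0 < x \<Longrightarrow> x / 2 \<le> z \<Longrightarrow> norm (f z) \<le> C / x ^ N"
    using schwartz_halfline_shift_bound[OF travelling(1), of N] by blast
  show ?case
  proof (intro exI allI impI)
    fix x t :: real assume xt: "0 < t" "t \<le> T" "2 * T \<le> x"
    then have x: "x > 0" by simp
    have "x / 2 \<le> x + \<epsilon> * t" using light_cone_lower_bound[of t \<epsilon> x] travelling(2) xt by (simp add: mult.commute)
    then have "norm (c * f (x + \<epsilon> * t)) \<le> norm c * (C / x ^ N)"
      unfolding norm_mult by (intro mult_left_mono C x) auto
    then have "x ^ N * norm (c * f (x + \<epsilon> * t)) \<le> x ^ N * (norm c * (C / x ^ N))"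
      using x by (intro mult_left_mono) auto
    then show "x ^ N * norm (c * f (x + \<epsilon> * t)) \<le> norm c * C" using x by simp
  qed
next
  case (averaged f b n r)
  obtain C where C: "C \<ge> 0" "\<And>x z. 0 < x \<Longrightarrow> x / 2 \<le> z \<Longrightarrow> norm (f z) \<le> C / x ^ N"
    using schwartz_halfline_shift_bound[OF averaged(1), of N] by blast
  obtain D where D: "D \<ge> 0" "\<And>u \<phi> z M. u \<in> {0..T} \<Longrightarrow> 0 \<le> M \<Longrightarrow> (\<forall>s\<in>{-1..1}. norm (\<phi> (z + u * s)) \<le> M) \<Longrightarrow>
      norm (bessel_avg m r b \<phi> z u) \<le> D * M"
    using bessel_avg_bound[OF averaged(2), of T m r] by blast
  show ?case
  proof (intro exI allI impI)
    fix x t :: real assume xt: "0 < t" "t \<le> T" "2 * T \<le> x"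
    then have x: "x > 0" by simp
    have "norm (bessel_avg m r b f x t) \<le> D * (C / x ^ N)"
    proof (rule D(2))
      show "t \<in> {0..T}" "0 \<le> C / x ^ N" using xt x C by auto
      show "\<forall>s\<in>{- 1..1}. norm (f (x + t * s)) \<le> C / x ^ N"
      proof
        fix s :: real assume "s \<in> {-1..1}"
        then show "norm (f (x + t * s)) \<le> C / x ^ N"
          using light_cone_lower_bound[of t s x] xt by (intro C x) auto
      qed
    qed
    moreover have "norm (of_real t ^ n :: complex) \<le> T ^ n"
      unfolding norm_power norm_of_real using xt by (intro power_mono) auto
    ultimately have "norm (of_real t ^ n * bessel_avg m r b f x t) \<le> T ^ n * (D * (C / x ^ N))"
      unfolding norm_mult using xt by (intro mult_mono) auto
    then have "x ^ N * norm (of_real t ^ n * bessel_avg m r b f x t) \<le> x ^ N * (T ^ n * (D * (C / x ^ N)))"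
      using x by (intro mult_left_mono) auto
    then show "x ^ N * norm (of_real t ^ n * bessel_avg m r b f x t) \<le> T ^ n * (D * C)" using x by simp
  qed
next
  case (add F G)
  then obtain C D where *: "\<And>x t. 0 < t \<Longrightarrow> t \<le> T \<Longrightarrow> 2 * T \<le> x \<Longrightarrow> x ^ N * norm (F x t) \<le> C"
    "\<And>x t. 0 < t \<Longrightarrow> t \<le> T \<Longrightarrow> 2 * T \<le> x \<Longrightarrow> x ^ N * norm (G x t) \<le> D" by blast
  show ?case
  proof (intro exI allI impI)
    fix x t :: real assume xt: "0 < t" "t \<le> T" "2 * T \<le> x"
    then have "x ^ N * norm (F x t + G x t) \<le> x ^ N * norm (F x t) + x ^ N * norm (G x t)"
      unfolding distrib_left[symmetric] by (intro mult_left_mono norm_triangle_ineq) auto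
    then show "x ^ N * norm (F x t + G x t) \<le> C + D"
      using *[OF xt] by linarith
  qed
qed

lemma partial_t_kg_class:
  assumes "kg_class m G" and eq: "\<And>x t. 0 < t \<Longrightarrow> t < x \<Longrightarrow> F x t = G x t"
  shows "\<exists>G'. kg_class m G' \<and> (\<forall>x t. 0 < t \<longrightarrow> t < x \<longrightarrow>
     partial_t F x t = G' x t \<and> (\<lambda>s. F x s) differentiable (at t))"
proof -
  obtain G' where G': "kg_class m G'"
    "\<And>x t. 0 < t \<Longrightarrow> t < x \<Longrightarrow> ((\<lambda>t. G x t) has_vector_derivative G' x t) (at t)"
    using kg_class_deriv_t[OF assms(1)] by blast
  have "((\<lambda>t. F x t) has_vector_derivative G' x t) (at t)" if "0 < t" "t < x" for x t
    by (rule has_vector_derivative_transform_within_open[OF G'(2)[OF that], of "{0<..<x}"])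
      (use that eq in auto)
  then show ?thesis
    using G'(1) by (intro exI[of _ G'])
      (auto simp: partial_t_def vector_derivative_at intro: differentiableI_vector)
qed

lemma partial_x_kg_class:
  assumes "kg_class m G" and eq: "\<And>x t. 0 < t \<Longrightarrow> t < x \<Longrightarrow> F x t = G x t"
  shows "\<exists>G'. kg_class m G' \<and> (\<forall>x t. 0 < t \<longrightarrow> t < x \<longrightarrow>
     partial_x F x t = G' x t \<and> (\<lambda>y. F y t) differentiable (at x))"
proof -
  obtain G' where G': "kg_class m G'"
    "\<And>x t. 0 < t \<Longrightarrow> t < x \<Longrightarrow> ((\<lambda>x. G x t) has_vector_derivative G' x t) (at x)"
    using kg_class_deriv_x[OF assms(1)] by blast
  have "((\<lambda>x. F x t) has_vector_derivative G' x t) (at x)" if "0 < t" "t < x" for x t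
    by (rule has_vector_derivative_transform_within_open[OF G'(2)[OF that], of "{t<..}"])
      (use that eq in auto)
  then show ?thesis
    using G'(1) by (intro exI[of _ G'])
      (auto simp: partial_x_def vector_derivative_at intro: differentiableI_vector)
qed

text \<open>Agreement on the open set \<open>0 < t < x\<close> suffices, because both one-dimensional derivatives are taken
  along segments that stay inside it.\<close>

lemma mixed_deriv_kg_class:
  assumes G: "kg_class m G" and eq: "\<And>x t. 0 < t \<Longrightarrow> t < x \<Longrightarrow> F x t = G x t"
  shows "\<exists>G'. kg_class m G' \<and> (\<forall>x t. 0 < t \<longrightarrow> t < x \<longrightarrow> mixed_deriv n l F x t = G' x t)"
proof -
  have t: "\<exists>G'. kg_class m G' \<and> (\<forall>x t. 0 < t \<longrightarrow> t < x \<longrightarrow> (partial_t ^^ l) F x t = G' x t)"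
  proof (induction l)
    case 0
    then show ?case using G eq by auto
  next
    case (Suc l)
    then show ?case using partial_t_kg_class[of m _ "(partial_t ^^ l) F"] by (simp, metis)
  qed
  show ?thesis
  proof (induction n)
    case 0
    then show ?case using t by (simp add: mixed_deriv_def)
  next
    case (Suc n)
    then show ?case using partial_x_kg_class[of m _ "mixed_deriv n l F"] by (simp add: mixed_deriv_def, metis)
  qed
qed

lemma mixed_deriv_exists_kg_class:
  assumes G: "kg_class m G" and eq: "\<And>x t. 0 < t \<Longrightarrow> t < x \<Longrightarrow> F x t = G x t"
    and xt: "0 < t" "t < x"
  shows "mixed_deriv_exists n l F x t"
  unfolding mixed_deriv_exists_def
proof (intro conjI allI impI)
  fix j
  obtain G' where "kg_class m G'" "\<And>x t. 0 < t \<Longrightarrow> t < x \<Longrightarrow> mixed_deriv 0 j F x t = G' x t"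
    using mixed_deriv_kg_class[OF G eq] by blast
  from partial_t_kg_class[OF this] show "(\<lambda>s. mixed_deriv 0 j F x s) differentiable (at t)"
    using xt by blast
  obtain G' where "kg_class m G'" "\<And>x t. 0 < t \<Longrightarrow> t < x \<Longrightarrow> mixed_deriv j l F x t = G' x t"
    using mixed_deriv_kg_class[OF G eq] by blast
  from partial_x_kg_class[OF this] show "(\<lambda>y. mixed_deriv j l F y t) differentiable (at x)"
    using xt by blast
qed

lemma mixed_deriv_uniform_decay:
  assumes G: "kg_class m G" and eq: "\<And>x t. 0 < t \<Longrightarrow> t < x \<Longrightarrow> F x t = G x t" and T: "T > 0"
  shows "uniform_limit {0<..T} (\<lambda>x t. x ^ E *\<^sub>R mixed_deriv n l F x t) (\<lambda>t. 0) at_top"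
proof -
  obtain G' where G': "kg_class m G'" "\<And>x t. 0 < t \<Longrightarrow> t < x \<Longrightarrow> mixed_deriv n l F x t = G' x t"
    using mixed_deriv_kg_class[OF G eq] by blast
  obtain C where C: "\<And>x t. 0 < t \<Longrightarrow> t \<le> T \<Longrightarrow> 2 * T \<le> x \<Longrightarrow> x ^ Suc E * norm (G' x t) \<le> C"
    using kg_class_decay[OF G'(1), of T "Suc E"] by blast
  show ?thesis
  proof (rule uniform_limitI)
    fix e :: real assume e: "e > 0"
    show "\<forall>\<^sub>F x in at_top. \<forall>t\<in>{0<..T}. dist (x ^ E *\<^sub>R mixed_deriv n l F x t) 0 < e"
      using eventually_ge_at_top[of "2 * T"] eventually_gt_at_top[of "C / e"]
    proof eventually_elim
      case (elim x)
      show ?case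
      proof
        fix t assume t: "t \<in> {0<..T}"
        have x: "x > 0" using elim T by simp
        have "x * (x ^ E * norm (G' x t)) \<le> C" using C[of t x] t elim by (simp add: mult.assoc)
        also have "C < x * e" using elim e by (simp add: field_simps)
        finally have "x ^ E * norm (G' x t) < e" using x by simp
        then show "dist (x ^ E *\<^sub>R mixed_deriv n l F x t) 0 < e"
          using G'(2)[of t x] t elim x T by simp
      qed
    qed
  qed
qed

section \<open>Convergence of the generalized integrals\<close>

text \<open>The \<open>O\<close>-notation for \<open>k\<close> tending to infinity, with the bound required from \<open>k = 1\<close> on.\<close>

definition decays :: "nat \<Rightarrow> (real \<Rightarrow> complex) \<Rightarrow> bool" where
  "decays n F \<longleftrightarrow> (\<exists>C. \<forall>k\<ge>1. norm (F k) \<le> C / k ^ n)"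

lemma decaysI: "(\<And>k. k \<ge> 1 \<Longrightarrow> norm (F k) \<le> C / k ^ n) \<Longrightarrow> decays n F"
  unfolding decays_def by blast

lemma decays_mult:
  assumes "decays n F" "decays p G" shows "decays (n + p) (\<lambda>k. F k * G k)"
proof -
  obtain C D where *: "\<And>k. k \<ge> 1 \<Longrightarrow> norm (F k) \<le> C / k ^ n" "\<And>k. k \<ge> 1 \<Longrightarrow> norm (G k) \<le> D / k ^ p"
    using assms unfolding decays_def by blast
  show ?thesis
  proof (rule decaysI[where C = "C * D"])
    fix k :: real assume k: "k \<ge> 1"
    have "norm (F k * G k) \<le> (C / k ^ n) * (D / k ^ p)"
      unfolding norm_mult using *[OF k] order_trans[OF norm_ge_zero *(1)[OF k]] by (intro mult_mono) auto
    then show "norm (F k * G k) \<le> C * D / k ^ (n + p)" by (simp add: power_add)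
  qed
qed

lemma decays_add:
  assumes "decays n F" "decays n G" shows "decays n (\<lambda>k. F k + G k)"
proof -
  obtain C D where *: "\<And>k. k \<ge> 1 \<Longrightarrow> norm (F k) \<le> C / k ^ n" "\<And>k. k \<ge> 1 \<Longrightarrow> norm (G k) \<le> D / k ^ n"
    using assms unfolding decays_def by blast
  show ?thesis
  proof (rule decaysI[where C = "C + D"])
    fix k :: real assume k: "k \<ge> 1"
    show "norm (F k + G k) \<le> (C + D) / k ^ n"
      using order_trans[OF norm_triangle_ineq add_mono[OF *[OF k]]] by (simp add: add_divide_distrib)
  qed
qed

lemma decays_mono:
  assumes "decays n F" "p \<le> n" shows "decays p F"
proof -
  obtain C where *: "\<And>k. k \<ge> 1 \<Longrightarrow> norm (F k) \<le> C / k ^ n"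
    using assms unfolding decays_def by blast
  have "C \<ge> 0" using order_trans[OF norm_ge_zero *[of 1]] by simp
  then have "C / k ^ n \<le> C / k ^ p" if "k \<ge> 1" for k :: real
    using that assms(2) by (intro divide_left_mono power_increasing mult_pos_pos) auto
  then show ?thesis using * by (intro decaysI[where C = C]) (meson order_trans)
qed

lemma decays_const: "decays 0 (\<lambda>k. c)"
  by (rule decaysI[where C = "norm c"]) simp

lemma decays_cong: "decays n F \<Longrightarrow> (\<And>k. k \<ge> 1 \<Longrightarrow> F k = G k) \<Longrightarrow> decays n G"
  unfolding decays_def by metis

lemma decays_cmult: "decays n F \<Longrightarrow> decays n (\<lambda>k. c * F k)"
  using decays_mult[OF decays_const[of c], of n F] by simp

lemma decays_inverse: "decays 1 (\<lambda>k. c / of_real k)"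
  by (rule decaysI[where C = "norm c"]) (simp add: norm_divide)

text \<open>Leading coefficients of asymptotic expansions multiply.\<close>

lemma decays_expansion_mult:
  assumes w: "decays 1 (\<lambda>k. w k - w0)" and F: "decays 2 (\<lambda>k. F k - a / of_real k)"
  shows "decays 2 (\<lambda>k. w k * F k - w0 * a / of_real k)"
proof -
  have "decays 2 (\<lambda>k. (w k - w0) * (F k - a / of_real k))"
    by (rule decays_mono[OF decays_mult[OF w F]]) simp
  moreover have "decays (1 + 1) (\<lambda>k. (w k - w0) * (a / of_real k))"
    by (rule decays_mult[OF w decays_inverse])
  moreover have "decays 2 (\<lambda>k. w0 * (F k - a / of_real k))"
    by (rule decays_cmult[OF F])
  ultimately have "decays 2 (\<lambda>k. ((w k - w0) * (F k - a / of_real k) + (w k - w0) * (a / of_real k)) + w0 * (F k - a / of_real k))"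
    by (intro decays_add) (simp_all add: numeral_2_eq_2)
  then show ?thesis by (rule decays_cong) (simp add: algebra_simps)
qed

definition convergent_tail :: "(real \<Rightarrow> complex) \<Rightarrow> bool" where
  "convergent_tail f \<longleftrightarrow> (\<forall>A. f integrable_on {1..A}) \<and> (\<exists>I. ((\<lambda>A. integral {1..A} f) \<longlongrightarrow> I) at_top)"

lemma convergent_tail_add:
  assumes "convergent_tail f" "convergent_tail g"
  shows "convergent_tail (\<lambda>k. f k + g k)"
proof -
  obtain I J where *: "\<And>A. f integrable_on {1..A}" "\<And>A. g integrable_on {1..A}"
    "((\<lambda>A. integral {1..A} f) \<longlongrightarrow> I) at_top" "((\<lambda>A. integral {1..A} g) \<longlongrightarrow> J) at_top"
    using assms unfolding convergent_tail_def by blast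
  have "((\<lambda>A. integral {1..A} (\<lambda>k. f k + g k)) \<longlongrightarrow> I + J) at_top"
    unfolding integral_add[OF *(1,2)] by (intro tendsto_add *)
  then show ?thesis using * unfolding convergent_tail_def by (auto intro: integrable_add)
qed

lemma convergent_tail_cong:
  assumes "convergent_tail f" "\<And>k. k \<ge> 1 \<Longrightarrow> f k = g k"
  shows "convergent_tail g"
proof -
  have "integral {1..A} f = integral {1..A} g" for A using assms(2) by (intro integral_cong) auto
  moreover have "f integrable_on {1..A} \<Longrightarrow> g integrable_on {1..A}" for A
    by (erule integrable_eq) (use assms(2) in auto)
  ultimately show ?thesis using assms(1) unfolding convergent_tail_def by auto
qed

lemma convergent_tail_decays:
  assumes c: "continuous_on {1..} f" and d: "decays 2 f"
  shows "convergent_tail f"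
proof -
  obtain C where C: "\<And>k. k \<ge> 1 \<Longrightarrow> norm (f k) \<le> C / k ^ 2"
    using d unfolding decays_def by blast
  have C0: "C \<ge> 0" using order_trans[OF norm_ge_zero C[of 1]] by simp
  have int: "f integrable_on {1..A}" for A
    by (intro integrable_continuous_real continuous_on_subset[OF c]) auto
  \<comment> \<open>For \<open>k \<ge> 1\<close> one has \<open>1 / k\<^sup>2 \<le> 2 / (1 + k\<^sup>2)\<close>.\<close>
  have h: "(\<lambda>k. (2 * C) * inverse (1 + k\<^sup>2)) integrable_on {1..}"
    using integrable_on_cmult_left[OF inverse_1_plus_square_integrable_on[of 1], of "2 * C"] by simp
  have bd: "norm (f k) \<le> (2 * C) * inverse (1 + k\<^sup>2)" if k: "k \<ge> 1" for k
  proof -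
    have "1 \<le> k\<^sup>2" using k by simp
    then have "C * (1 + k\<^sup>2) \<le> (2 * C) * k\<^sup>2"
      using C0 mult_left_mono[of "1 + k\<^sup>2" "2 * k\<^sup>2" C] by (simp add: mult_ac)
    then have "C / k\<^sup>2 \<le> (2 * C) / (1 + k\<^sup>2)"
      using \<open>1 \<le> k\<^sup>2\<close> by (intro mult_imp_div_pos_le) (auto simp: pos_le_divide_eq add_pos_nonneg)
    then have "C / k\<^sup>2 \<le> (2 * C) * inverse (1 + k\<^sup>2)" by (simp add: divide_inverse)
    then show ?thesis using C[OF k] by simp
  qed
  show ?thesis unfolding convergent_tail_def
    using integrable_on_halfline_dominated(2)[OF int h bd] int by blast
qed

text \<open>Subtracting a multiple of the derivative of \<open>exp (\<i> \<alpha> k) / (\<i> \<alpha> k)\<close>, whose integral converges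
  trivially, removes the leading term \<open>a exp (\<i> \<alpha> k) / k\<close> and leaves an absolutely integrable function.\<close>

lemma convergent_tail_oscillating:
  assumes \<alpha>: "\<alpha> \<noteq> 0" and c: "continuous_on {1..} u" and d: "decays 2 (\<lambda>k. u k - a / of_real k)"
  shows "convergent_tail (\<lambda>k. wave k \<alpha> * u k)"
proof -
  define P where "P = (\<lambda>k. wave k \<alpha> / (\<i> * of_real \<alpha> * of_real k))"
  define P' where "P' = (\<lambda>k. wave k \<alpha> / of_real k - wave k \<alpha> / (\<i> * of_real \<alpha> * of_real k ^ 2))"
  have P': "(P has_vector_derivative P' k) (at k)" if "k \<ge> 1" for k
  proof -
    have "((\<lambda>k. exp (\<i> * k * of_real \<alpha>) / (\<i> * of_real \<alpha> * k)) has_field_derivative P' k) (at (of_real k))"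
      using that \<alpha> by (auto intro!: derivative_eq_intros simp: P'_def wave_def field_simps power2_eq_square)
    from has_vector_derivative_real_field[OF this] show ?thesis
      unfolding P_def wave_def by simp
  qed
  have P'c: "continuous_on {1..} P'"
    unfolding P'_def using \<alpha> by (intro continuous_intros) auto
  have 1: "convergent_tail (\<lambda>k. a * P' k)"
  proof -
    have eq: "integral {1..A} (\<lambda>k. a * P' k) = a * (P A - P 1)" if "A \<ge> 1" for A
      using fundamental_theorem_of_calculus[OF that has_vector_derivative_at_within[OF P']]
      by (simp add: integral_unique)
    have "(P \<longlongrightarrow> 0) at_top"
    proof (rule Lim_null_comparison)
      show "\<forall>\<^sub>F k in at_top. norm (P k) \<le> inverse \<bar>\<alpha>\<bar> * inverse k"
        using eventually_ge_at_top[of 1]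
        by eventually_elim (simp add: P_def norm_divide norm_mult field_simps)
      show "((\<lambda>k. inverse \<bar>\<alpha>\<bar> * inverse k) \<longlongrightarrow> 0) at_top"
        by (intro tendsto_mult_right_zero tendsto_inverse_0_at_top filterlim_ident)
    qed
    then have "((\<lambda>A. a * (P A - P 1)) \<longlongrightarrow> a * (0 - P 1)) at_top"
      by (intro tendsto_intros)
    then have "((\<lambda>A. integral {1..A} (\<lambda>k. a * P' k)) \<longlongrightarrow> a * (0 - P 1)) at_top"
      by (rule Lim_transform_eventually) (rule eventually_mono[OF eventually_ge_at_top[of 1]], simp only: eq)
    moreover have "(\<lambda>k. a * P' k) integrable_on {1..A}" for A
      by (intro integrable_continuous_real continuous_on_mult_left continuous_on_subset[OF P'c]) auto
    ultimately show ?thesis unfolding convergent_tail_def by blast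
  qed
  have 2: "convergent_tail (\<lambda>k. wave k \<alpha> * u k - a * P' k)"
  proof (rule convergent_tail_decays)
    show "continuous_on {1..} (\<lambda>k. wave k \<alpha> * u k - a * P' k)"
      by (intro continuous_intros c P'c)
    have "decays 0 (\<lambda>k. wave k \<alpha>)" by (rule decaysI[where C = 1]) simp
    from decays_mult[OF this d] have "decays 2 (\<lambda>k. wave k \<alpha> * (u k - a / of_real k))" by (simp only: add_0_left)
    moreover have "decays 2 (\<lambda>k. a * (wave k \<alpha> / (\<i> * of_real \<alpha> * of_real k ^ 2)))"
      by (rule decays_cmult, rule decaysI[where C = "inverse \<bar>\<alpha>\<bar>"])
        (simp add: norm_divide norm_mult norm_power divide_simps)
    ultimately have "decays 2 (\<lambda>k. wave k \<alpha> * (u k - a / of_real k) + a * (wave k \<alpha> / (\<i> * of_real \<alpha> * of_real k ^ 2)))"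
      by (rule decays_add)
    then show "decays 2 (\<lambda>k. wave k \<alpha> * u k - a * P' k)"
      by (rule decays_cong) (simp add: P'_def algebra_simps)
  qed
  from convergent_tail_add[OF 2 1] show ?thesis by simp
qed

lemma rho_continuous [continuous_intros]:
  "continuous_on S f \<Longrightarrow> continuous_on S (\<lambda>x. rho m (f x))"
  unfolding rho_def by (intro continuous_intros)

lemma rho_minus [simp]: "rho m (- k) = rho m k"
  by (simp add: rho_def)

lemma rho_nonneg [simp]: "0 \<le> rho m k"
  by (simp add: rho_def)

lemma abs_le_rho: "\<bar>k\<bar> \<le> rho m k" "\<bar>m\<bar> \<le> rho m k"
  by (simp_all add: rho_def real_le_rsqrt)

lemma rho_pos: "k \<ge> 1 \<Longrightarrow> rho m k > 0"
  using abs_le_rho(1)[of k m] by linarith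

lemma rho_nonzero: "k \<ge> 1 \<Longrightarrow> rho m k \<noteq> 0"
  using rho_pos[of k m] by simp

text \<open>All four follow from \<open>0 \<le> \<rho> - k \<le> \<bar>m\<bar>\<close> and \<open>\<rho> - k \<le> m\<^sup>2 / k\<close>. The third says that replacing \<open>\<rho>\<close> by \<open>k\<close>
  in a phase costs a factor \<open>1 + O(1/k)\<close>.\<close>

lemma rho_expansions:
  shows "decays 1 (\<lambda>k. of_real (k / rho m k) - 1)"
    and "decays 1 (\<lambda>k. of_real (m / rho m k))"
    and "decays 1 (\<lambda>k. wave (rho m k - k) z - 1)"
    and "decays 2 (\<lambda>k. of_real (1 / rho m k) - 1 / of_real k)"
proof -
  have ge: "k \<le> rho m k" "rho m k - k \<le> \<bar>m\<bar>" "rho m k - k \<le> m\<^sup>2 / k" "rho m k > 0" if k: "k \<ge> 1" for k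
  proof -
    show 1: "k \<le> rho m k" using abs_le_rho(1)[of k m] k by simp
    show 2: "rho m k > 0" using rho_pos[OF k] .
    have "k\<^sup>2 + m\<^sup>2 \<le> (k + \<bar>m\<bar>)\<^sup>2" using k by (simp add: power2_sum)
    then have "rho m k \<le> k + \<bar>m\<bar>" unfolding rho_def using k by (intro real_le_lsqrt) auto
    then show "rho m k - k \<le> \<bar>m\<bar>" by simp
    have "(rho m k - k) * k \<le> (rho m k - k) * (rho m k + k)"
      using 1 k by (intro mult_left_mono) auto
    also have "\<dots> = m\<^sup>2" by (simp add: algebra_simps power2_eq_square[symmetric] rho_def)
    finally show "rho m k - k \<le> m\<^sup>2 / k" using k by (simp add: field_simps)
  qed
  show a: "decays 1 (\<lambda>k. of_real (k / rho m k) - 1)"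
  proof (rule decaysI[where C = "\<bar>m\<bar>"])
    fix k :: real assume k: "k \<ge> 1"
    have "of_real (k / rho m k) - 1 = complex_of_real (k / rho m k - 1)" by simp
    then have "norm (complex_of_real (k / rho m k) - 1) = \<bar>k / rho m k - 1\<bar>"
      by (metis norm_of_real)
    also have "\<dots> = (rho m k - k) / rho m k" using ge[OF k] by (simp add: field_simps abs_if)
    also have "\<dots> \<le> \<bar>m\<bar> / k" using ge[OF k] k by (intro frac_le) auto
    finally show "norm (complex_of_real (k / rho m k) - 1) \<le> \<bar>m\<bar> / k ^ 1" by simp
  qed
  show "decays 1 (\<lambda>k. of_real (m / rho m k))"
  proof (rule decaysI[where C = "\<bar>m\<bar>"])
    fix k :: real assume k: "k \<ge> 1"
    show "norm (complex_of_real (m / rho m k)) \<le> \<bar>m\<bar> / k ^ 1"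
      unfolding norm_of_real using ge[OF k] k by (simp add: abs_divide frac_le)
  qed
  show "decays 1 (\<lambda>k. wave (rho m k - k) z - 1)"
  proof (rule decaysI[where C = "m\<^sup>2 * \<bar>z\<bar>"])
    fix k :: real assume k: "k \<ge> 1"
    have "norm (wave (rho m k - k) z - 1) \<le> \<bar>(rho m k - k) * z\<bar>"
      using dist_exp_i_1[of "(rho m k - k) * z"] abs_sin_x_le_abs_x[of "(rho m k - k) * z / 2"]
      by (simp add: wave_def mult.assoc)
    also have "\<dots> = (rho m k - k) * \<bar>z\<bar>" using ge(1)[OF k] by (simp add: abs_mult)
    also have "\<dots> \<le> (m\<^sup>2 / k) * \<bar>z\<bar>" using ge(3)[OF k] by (intro mult_right_mono) auto
    finally show "norm (wave (rho m k - k) z - 1) \<le> m\<^sup>2 * \<bar>z\<bar> / k ^ 1" by simp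
  qed
  have "decays (1 + 1) (\<lambda>k. (of_real (k / rho m k) - 1) * (1 / of_real k))"
    by (rule decays_mult[OF a decays_inverse])
  then have "decays 2 (\<lambda>k. (of_real (k / rho m k) - 1) * (1 / of_real k))" by (simp only: one_add_one)
  then show "decays 2 (\<lambda>k. of_real (1 / rho m k) - 1 / of_real k)"
    by (rule decays_cong) (use ge(4) in \<open>simp add: field_simps\<close>)
qed

text \<open>The common form of all factors that multiply the exponentials and transforms in the twelve
  integrals. Writing the constant term as a multiple of \<open>m\<close> keeps the quotient bounded near \<open>k = 0\<close>
  even in the massless case, see \<open>symbol_bounded\<close>.\<close>

definition symbol :: "real \<Rightarrow> complex \<Rightarrow> complex \<Rightarrow> complex \<Rightarrow> real \<Rightarrow> complex" where
  "symbol m c1 c2 c3 k = (c1 * of_real k + c2 * of_real (rho m k) + c3 * of_real m) / of_real (rho m k)"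

lemma symbol_minus: "symbol m c1 c2 c3 (- k) = symbol m (- c1) c2 c3 k"
  by (simp add: symbol_def)

lemma symbol_expansion: "decays 1 (\<lambda>k. symbol m c1 c2 c3 k - (c1 + c2))"
proof -
  have "decays 1 (\<lambda>k. c1 * (of_real (k / rho m k) - 1) + c3 * of_real (m / rho m k))"
    by (intro decays_add decays_cmult rho_expansions)
  then show ?thesis
    by (rule decays_cong) (simp add: symbol_def field_simps rho_nonzero)
qed

lemma symbol_continuous: "continuous_on {1..} (symbol m c1 c2 c3)"
  unfolding symbol_def by (intro continuous_intros) (auto simp: rho_nonzero)

lemma symbol_bounded: "norm (symbol m c1 c2 c3 k) \<le> norm c1 + norm c2 + norm c3"
proof (cases "rho m k = 0")
  case True
  then show ?thesis by (simp add: symbol_def)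
next
  case False
  then have r: "rho m k > 0" using rho_nonneg[of m k] by linarith
  have "norm (c1 * of_real k + c2 * of_real (rho m k) + c3 * of_real m) \<le>
      norm c1 * \<bar>k\<bar> + norm c2 * rho m k + norm c3 * \<bar>m\<bar>"
    by (intro norm_triangle_le add_mono) (auto simp: norm_mult)
  also have "\<dots> \<le> norm c1 * rho m k + norm c2 * rho m k + norm c3 * rho m k"
    by (intro add_mono mult_left_mono abs_le_rho) auto
  finally show ?thesis using r by (simp add: symbol_def norm_divide field_simps)
qed

lemma rho_measurable [measurable]: "rho m \<in> borel_measurable borel"
  unfolding rho_def[abs_def] by measurable

lemma symbol_measurable [measurable]: "symbol m c1 c2 c3 \<in> borel_measurable borel"
  unfolding symbol_def[abs_def] by measurable

abbreviation dispersive :: "real \<Rightarrow> real \<Rightarrow> real \<Rightarrow> complex \<Rightarrow> complex \<Rightarrow> complex \<Rightarrow> real \<Rightarrow> complex" where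
  "dispersive m z q c1 c2 c3 k \<equiv> wave k z * wave (rho m k) q * symbol m c1 c2 c3 k"

text \<open>To leading order the phase \<open>k z + \<rho> q\<close> is \<open>k (z + q)\<close>.\<close>

lemma convergent_tail_dispersive:
  assumes F: "decays 2 (\<lambda>k. F k - a / of_real k)" and Fc: "continuous_on {1..} F" and \<alpha>: "z + q \<noteq> 0"
  shows "convergent_tail (\<lambda>k. dispersive m z q c1 c2 c3 k * F k)"
proof -
  let ?u = "\<lambda>k. wave (rho m k - k) q * (symbol m c1 c2 c3 k * F k)"
  have "convergent_tail (\<lambda>k. wave k (z + q) * ?u k)"
  proof (rule convergent_tail_oscillating[OF \<alpha>])
    show "continuous_on {1..} ?u"
      by (intro continuous_intros symbol_continuous[unfolded symbol_def] symbol_continuous Fc)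
    show "decays 2 (\<lambda>k. ?u k - 1 * ((c1 + c2) * a) / of_real k)"
      by (rule decays_expansion_mult[OF rho_expansions(3) decays_expansion_mult[OF symbol_expansion F]])
  qed
  moreover have "wave k (z + q) * wave (rho m k - k) q = wave k z * wave (rho m k) q" for k
    by (simp add: wave_def exp_add[symmetric] algebra_simps)
  ultimately show ?thesis
    by (elim convergent_tail_cong) (simp add: mult.assoc[symmetric])
qed

text \<open>Two integrations by parts. The term of order \<open>1/k\<close> is due to the jump of the data at the origin; it
  is why the integrals converge only conditionally.\<close>

lemma fourier_expansion:
  assumes f: "schwartz_halfline f" and \<epsilon>: "\<epsilon> = 1 \<or> \<epsilon> = -1"
  shows "decays 2 (\<lambda>k. halfline_fourier f (\<epsilon> * k) - (f 0 / (\<i> * of_real \<epsilon>)) / of_real k)"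
proof -
  note f' = schwartz_halfline_deriv[OF f, of 1]
  note f'' = schwartz_halfline_deriv[OF f', of 1]
  define g where "g = halfline_deriv 1 f"
  define L where "L = integral {0..} (\<lambda>y. norm (halfline_deriv 1 g y))"
  show ?thesis
  proof (rule decaysI[where C = "norm (g 0) + L"])
    fix k :: real assume k: "k \<ge> 1"
    have k0: "\<epsilon> * k \<noteq> 0" using k \<epsilon> by auto
    have "halfline_fourier f (\<epsilon> * k) - (f 0 / (\<i> * of_real \<epsilon>)) / of_real k = halfline_fourier g (\<epsilon> * k) / (\<i> * of_real (\<epsilon> * k))"
      unfolding halfline_fourier_by_parts[OF f k0] g_def by (simp add: add_divide_distrib mult.assoc)
    also have "\<dots> = - (g 0 + halfline_fourier (halfline_deriv 1 g) (\<epsilon> * k)) / of_real k ^ 2"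
    proof -
      have "(\<i> * complex_of_real (\<epsilon> * k)) * (\<i> * of_real (\<epsilon> * k)) = - (of_real k ^ 2)"
        using \<epsilon> by (auto simp: power2_eq_square algebra_simps)
      then show ?thesis
        unfolding halfline_fourier_by_parts[OF f' k0, folded g_def]
        by (simp only: divide_divide_eq_left divide_minus_right minus_divide_left)
    qed
    also have "norm \<dots> \<le> (norm (g 0) + L) / k ^ 2"
      unfolding norm_divide norm_power norm_minus_cancel using k halfline_fourier_bounded(1)[OF f''[folded g_def], of "\<epsilon> * k"]
      by (auto simp: L_def intro!: divide_right_mono order_trans[OF norm_triangle_ineq])
    finally show "norm (halfline_fourier f (\<epsilon> * k) - (f 0 / (\<i> * of_real \<epsilon>)) / of_real k) \<le> (norm (g 0) + L) / k ^ 2" .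
  qed
qed

text \<open>A bounded measurable function is integrable on bounded intervals; measurability rather than continuity
  is needed because for \<open>m = 0\<close> the integrands jump at \<open>k = 0\<close>.\<close>

lemma gen_integrable_criterion:
  assumes m: "f \<in> borel_measurable borel" and bd: "\<And>k. norm (f k) \<le> B"
    and tails: "convergent_tail f" "convergent_tail (\<lambda>k. f (- k))"
  shows "gen_integrable f"
proof -
  have int: "f integrable_on {a..b}" if "f \<in> borel_measurable borel" "\<And>k. norm (f k) \<le> B" for a b and f :: "real \<Rightarrow> complex"
  proof -
    have "set_integrable lborel {a..b} f"
      unfolding set_integrable_def using that
      by (intro integrableI_bounded_set_indicator[where B = B]) (auto simp: emeasure_lborel_Icc_eq)
    then show ?thesis by (rule set_borel_integral_eq_integral)
  qed
  have lim: "\<exists>I. ((\<lambda>A. integral {0..A} f) \<longlongrightarrow> I) at_top" if t: "convergent_tail f"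
    and fi: "\<And>a b. f integrable_on {a..b}" for f :: "real \<Rightarrow> complex"
  proof -
    obtain I where I: "((\<lambda>A. integral {1..A} f) \<longlongrightarrow> I) at_top"
      using t unfolding convergent_tail_def by blast
    have "((\<lambda>A. integral {0..1} f + integral {1..A} f) \<longlongrightarrow> integral {0..1} f + I) at_top"
      by (intro tendsto_add tendsto_const I)
    then have "((\<lambda>A. integral {0..A} f) \<longlongrightarrow> integral {0..1} f + I) at_top"
    proof (rule Lim_transform_eventually)
      show "\<forall>\<^sub>F A in at_top. integral {0..1} f + integral {1..A} f = integral {0..A} f"
        using eventually_ge_at_top[of 1]
        by eventually_elim (rule Henstock_Kurzweil_Integration.integral_combine, auto intro: fi)
    qed
    then show ?thesis by blast
  qed
  have m': "(\<lambda>k. f (-k)) \<in> borel_measurable borel" using m by measurable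
  have "integral {-A..0} f = integral {0..A} (\<lambda>k. f (- k))" for A
    using Henstock_Kurzweil_Integration.integral_reflect_real[of A 0 "\<lambda>k. f (- k)"] by simp
  then show ?thesis
    unfolding gen_integrable_def
    using lim[OF tails(1) int[OF m bd]] lim[OF tails(2) int[OF m' bd]] int[OF m bd] by simp
qed

lemma gen_integrable_fourier:
  assumes f: "schwartz_halfline f" and \<epsilon>: "\<epsilon> = 1 \<or> \<epsilon> = -1" and xt: "x + q \<noteq> 0" "- x + q \<noteq> 0"
  shows "gen_integrable (\<lambda>k. dispersive m x q c1 c2 c3 k * halfline_fourier f (\<epsilon> * k))"
proof (rule gen_integrable_criterion)
  note fc = halfline_fourier_continuous[OF f]
  have fc': "continuous_on S (\<lambda>k. halfline_fourier f (\<epsilon> * k))" for S \<epsilon>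
    by (intro continuous_on_compose2[OF fc] continuous_intros) auto
  have [measurable]: "(\<lambda>k. halfline_fourier f (\<epsilon> * k)) \<in> borel_measurable borel"
    by (intro borel_measurable_continuous_onI fc')
  have [measurable]: "(\<lambda>k. wave k x) \<in> borel_measurable borel" "(\<lambda>k. wave (rho m k) q) \<in> borel_measurable borel"
    by (intro borel_measurable_continuous_onI continuous_intros)+
  show "(\<lambda>k. dispersive m x q c1 c2 c3 k * halfline_fourier f (\<epsilon> * k)) \<in> borel_measurable borel"
    by measurable
  show "norm (dispersive m x q c1 c2 c3 k * halfline_fourier f (\<epsilon> * k)) \<le>
      (norm c1 + norm c2 + norm c3) * integral {0..} (\<lambda>y. norm (f y))" for k
    unfolding norm_mult norm_wave mult_1
    by (intro mult_mono symbol_bounded halfline_fourier_bounded f) auto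
  show "convergent_tail (\<lambda>k. dispersive m x q c1 c2 c3 k * halfline_fourier f (\<epsilon> * k))"
    by (rule convergent_tail_dispersive[OF fourier_expansion[OF f \<epsilon>] fc' xt(1)])
  have "convergent_tail (\<lambda>k. dispersive m (- x) q (- c1) c2 c3 k * halfline_fourier f ((- \<epsilon>) * k))"
    by (rule convergent_tail_dispersive[OF fourier_expansion[OF f] fc' xt(2)]) (use \<epsilon> in auto)
  then show "convergent_tail (\<lambda>k. wave (- k) x * wave (rho m (- k)) q * symbol m c1 c2 c3 (- k) * halfline_fourier f (\<epsilon> * - k))"
    by (simp add: symbol_minus wave_def)
qed

text \<open>The two endpoints of the source interval contribute separate terms, one of which cancels the factor
  \<open>exp (\<mp> \<i> \<rho> t)\<close> in front of the integral: this produces the frequencies \<open>\<plusminus>x\<close> besides \<open>\<plusminus>x \<mp> t\<close>.\<close>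

lemma source_integral_expansion:
  fixes m :: real
  assumes h: "smooth_halfline h" and t: "t > 0" and s: "s = 1 \<or> s = -1"
  defines "J \<equiv> \<lambda>k. integral {0..t} (\<lambda>\<tau>. h \<tau> * wave (rho m k) (s * \<tau>))"
  shows "\<exists>R. continuous_on {1..} R \<and> decays 2 R \<and>
     (\<forall>k\<ge>1. J k = (h t * wave (rho m k) (s * t) - h 0) * (of_real (1 / rho m k) / (\<i> * of_real s)) + R k)"
proof -
  have by_parts: "integral {0..t} (\<lambda>\<tau>. f \<tau> * wave (rho m k) (s * \<tau>)) =
      (f t * wave (rho m k) (s * t) - f 0 - integral {0..t} (\<lambda>\<tau>. halfline_deriv 1 f \<tau> * wave (rho m k) (s * \<tau>)))
        * (of_real (1 / rho m k) / (\<i> * of_real s))" if f: "smooth_halfline f" and k: "k \<ge> 1" for f k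
  proof -
    define c where "c = \<i> * complex_of_real (s * rho m k)"
    have c0: "c \<noteq> 0" using s rho_nonzero[OF k, of m] by (auto simp: c_def)
    have fc: "continuous_on {0..t} f" "continuous_on {0..t} (halfline_deriv 1 f)"
      by (intro continuous_on_subset[OF smooth_halfline_continuous] f smooth_halfline_deriv; auto)+
    have "((\<lambda>\<tau>. f \<tau> * (c * wave (rho m k) (s * \<tau>)) + halfline_deriv 1 f \<tau> * wave (rho m k) (s * \<tau>)) has_integral
        f t * wave (rho m k) (s * t) - f 0 * wave (rho m k) (s * 0)) {0..t}"
    proof (rule fundamental_theorem_of_calculus)
      fix \<tau> assume \<tau>: "\<tau> \<in> {0..t}"
      have "((\<lambda>\<tau>. wave (rho m k) (s * \<tau>)) has_vector_derivative of_real s * (\<i> * of_real (rho m k) * wave (rho m k) (s * \<tau>)))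
          (at \<tau> within {0..t})"
        by (rule has_vector_derivative_chain_real[where u = "\<lambda>\<tau>. s * \<tau>", OF wave_deriv]) (auto intro!: derivative_eq_intros)
      then have W: "((\<lambda>\<tau>. wave (rho m k) (s * \<tau>)) has_vector_derivative c * wave (rho m k) (s * \<tau>)) (at \<tau> within {0..t})"
        by (rule has_vector_derivative_eq_rhs) (simp add: c_def)
      have "(f has_vector_derivative halfline_deriv 1 f \<tau>) (at \<tau> within {0..t})"
        using \<tau> by (intro has_vector_derivative_within_subset[OF smooth_halfline_has_deriv_within[OF f]]) auto
      then show "((\<lambda>\<tau>. f \<tau> * wave (rho m k) (s * \<tau>)) has_vector_derivative
          f \<tau> * (c * wave (rho m k) (s * \<tau>)) + halfline_deriv 1 f \<tau> * wave (rho m k) (s * \<tau>)) (at \<tau> within {0..t})"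
        by (intro has_vector_derivative_mult W)
    qed (use t in simp)
    then have "f t * wave (rho m k) (s * t) - f 0 =
       integral {0..t} (\<lambda>\<tau>. c * (f \<tau> * wave (rho m k) (s * \<tau>)) + halfline_deriv 1 f \<tau> * wave (rho m k) (s * \<tau>))"
      by (simp add: integral_unique mult.left_commute wave_def[of _ 0])
    also have "\<dots> = c * integral {0..t} (\<lambda>\<tau>. f \<tau> * wave (rho m k) (s * \<tau>)) +
        integral {0..t} (\<lambda>\<tau>. halfline_deriv 1 f \<tau> * wave (rho m k) (s * \<tau>))"
      unfolding integral_mult_right[symmetric]
      by (intro integral_add integrable_continuous_real continuous_intros fc)
    finally have "integral {0..t} (\<lambda>\<tau>. f \<tau> * wave (rho m k) (s * \<tau>)) =
       (f t * wave (rho m k) (s * t) - f 0 - integral {0..t} (\<lambda>\<tau>. halfline_deriv 1 f \<tau> * wave (rho m k) (s * \<tau>))) * (1 / c)"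
      using c0 by (simp add: field_simps)
    also have "1 / c = of_real (1 / rho m k) / (\<i> * of_real s)"
      by (simp add: c_def)
    finally show ?thesis .
  qed
  \<comment> \<open>A second integration by parts shows that the remainder gains one more factor \<open>1/k\<close>.\<close>
  define D where "D = (\<lambda>k. integral {0..t} (\<lambda>\<tau>. halfline_deriv 1 h \<tau> * wave (rho m k) (s * \<tau>)))"
  define R where "R = (\<lambda>k. - D k * (of_real (1 / rho m k) / (\<i> * of_real s)))"
  note h' = smooth_halfline_deriv[OF h, of 1]
  have J: "J k = (h t * wave (rho m k) (s * t) - h 0) * (of_real (1 / rho m k) / (\<i> * of_real s)) + R k" if "k \<ge> 1" for k
    using by_parts[OF h that] by (simp add: J_def R_def D_def algebra_simps)
  have Dc: "continuous_on {1..} D"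
  proof -
    have "continuous_on {0..t} (halfline_deriv 1 h)"
      by (intro continuous_on_subset[OF smooth_halfline_continuous] h'; auto)
    then have "continuous_on ({1..} \<times> {0..t}) (\<lambda>p. halfline_deriv 1 h (snd p))"
      by (rule continuous_on_compose2) (auto intro!: continuous_intros)
    then have "continuous_on ({1..} \<times> cbox 0 t) (\<lambda>(k, \<tau>). halfline_deriv 1 h \<tau> * wave (rho m k) (s * \<tau>))"
      unfolding case_prod_unfold cbox_interval by (intro continuous_intros)
    from integral_continuous_on_param[OF this] show ?thesis by (simp add: D_def)
  qed
  have inv: "norm (complex_of_real (1 / rho m k) / (\<i> * of_real s)) \<le> 1 / k" if "k \<ge> 1" for k
  proof -
    have "norm (complex_of_real (1 / rho m k) / (\<i> * of_real s)) = 1 / rho m k"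
      using s by (auto simp: norm_divide norm_mult)
    also have "\<dots> \<le> 1 / k" using abs_le_rho(1)[of k m] that by (intro divide_left_mono) (auto intro: rho_pos mult_pos_pos)
    finally show ?thesis .
  qed
  have c1: "continuous_on {0..t} (halfline_deriv 1 (halfline_deriv 1 h))"
    by (intro continuous_on_subset[OF smooth_halfline_continuous] smooth_halfline_deriv h; auto)
  obtain B where B: "B \<ge> 0" "\<And>\<tau>. \<tau> \<in> {0..t} \<Longrightarrow> norm (halfline_deriv 1 (halfline_deriv 1 h) \<tau>) \<le> B"
    using bounded_on_interval[OF c1] by blast
  define C where "C = norm (halfline_deriv 1 h t) + norm (halfline_deriv 1 h 0) + B * t"
  have Db: "norm (D k) \<le> C * (1 / k)" if k: "k \<ge> 1" for k
  proof -
    let ?I = "integral {0..t} (\<lambda>\<tau>. halfline_deriv 1 (halfline_deriv 1 h) \<tau> * wave (rho m k) (s * \<tau>))"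
    have "norm ?I \<le> integral {0..t} (\<lambda>\<tau>. B)"
    proof (rule integral_norm_bound_integral)
      show "(\<lambda>\<tau>. halfline_deriv 1 (halfline_deriv 1 h) \<tau> * wave (rho m k) (s * \<tau>)) integrable_on {0..t}"
        by (intro integrable_continuous_real continuous_intros c1)
    qed (use B in \<open>auto simp: norm_mult\<close>)
    then have I: "norm ?I \<le> B * t" using t by (simp add: mult.commute)
    have "norm (halfline_deriv 1 h t * wave (rho m k) (s * t) - halfline_deriv 1 h 0 - ?I) \<le>
        norm (halfline_deriv 1 h t * wave (rho m k) (s * t)) + norm (halfline_deriv 1 h 0) + norm ?I"
      by (intro order_trans[OF norm_triangle_ineq4] add_mono norm_triangle_ineq4 order_refl)
    also have "\<dots> \<le> C" using I by (simp add: C_def norm_mult)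
    finally show ?thesis
      unfolding D_def by_parts[OF h' k] norm_mult using inv[OF k] B t k
      by (intro mult_mono) (auto simp: C_def)
  qed
  have "C \<ge> 0" using B t by (simp add: C_def)
  have "decays 2 R"
  proof (rule decaysI[where C = C])
    fix k :: real assume k: "k \<ge> 1"
    have "norm (R k) \<le> (C * (1 / k)) * (1 / k)"
      unfolding R_def norm_mult norm_minus_cancel using Db[OF k] inv[OF k] \<open>C \<ge> 0\<close> k by (intro mult_mono) auto
    then show "norm (R k) \<le> C / k ^ 2" by (simp add: power2_eq_square)
  qed
  moreover have "continuous_on {1..} R"
    unfolding R_def using s by (intro continuous_intros Dc) (auto simp: rho_nonzero)
  ultimately show ?thesis using J by blast
qed

lemma gen_integrable_source:
  assumes h: "smooth_halfline h" and xt: "0 < t" "t < x" and s: "s = 1 \<or> s = -1"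
  shows "gen_integrable (\<lambda>k. dispersive m x (- s * t) c1 c2 c3 k *
     integral {0..t} (\<lambda>\<tau>. h \<tau> * wave (rho m k) (s * \<tau>)))"
proof -
  define J where "J = (\<lambda>k. integral {0..t} (\<lambda>\<tau>. h \<tau> * wave (rho m k) (s * \<tau>)))"
  obtain R where R: "continuous_on {1..} R" "decays 2 R"
     "\<And>k. k \<ge> 1 \<Longrightarrow> J k = (h t * wave (rho m k) (s * t) - h 0) * (of_real (1 / rho m k) / (\<i> * of_real s)) + R k"
    using source_integral_expansion[OF h xt(1) s, of m] unfolding J_def by blast
  have hc: "continuous_on {0..t} h"
    by (intro continuous_on_subset[OF smooth_halfline_continuous] h; auto)
  obtain B where B: "B \<ge> 0" "\<And>\<tau>. \<tau> \<in> {0..t} \<Longrightarrow> norm (h \<tau>) \<le> B"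
    using bounded_on_interval[OF hc] by blast
  have Jc: "continuous_on UNIV J"
  proof -
    have "continuous_on (UNIV \<times> {0..t}) (\<lambda>p. h (snd p))"
      by (rule continuous_on_compose2[OF hc]) (auto intro!: continuous_intros)
    then have "continuous_on (UNIV \<times> cbox 0 t) (\<lambda>(k, \<tau>). h \<tau> * wave (rho m k) (s * \<tau>))"
      unfolding case_prod_unfold cbox_interval by (intro continuous_intros)
    from integral_continuous_on_param[OF this] show ?thesis by (simp add: J_def)
  qed
  have Jb: "norm (J k) \<le> B * t" for k
  proof -
    have "norm (J k) \<le> integral {0..t} (\<lambda>\<tau>. B)"
      unfolding J_def
    proof (rule integral_norm_bound_integral)
      show "(\<lambda>\<tau>. h \<tau> * wave (rho m k) (s * \<tau>)) integrable_on {0..t}"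
        by (intro integrable_continuous_real continuous_intros hc)
    qed (use B in \<open>auto simp: norm_mult\<close>)
    then show ?thesis using xt by (simp add: mult.commute)
  qed
  have inv_c: "continuous_on {1..} (\<lambda>k. c * complex_of_real (1 / rho m k))" for c
    by (intro continuous_intros) (auto simp: rho_nonzero)
  have inv_d: "decays 2 (\<lambda>k. c * of_real (1 / rho m k) - c / of_real k)" for c
    using decays_cmult[OF rho_expansions(4)[of m], of c] by (simp add: right_diff_distrib)
  have tail: "convergent_tail (\<lambda>k. dispersive m z (- s * t) c1 c2 c3 k * J k)"
    if z: "z = x \<or> z = - x" for z c1
  proof -
    let ?a = "h t / (\<i> * of_real s)" and ?b = "- h 0 / (\<i> * of_real s)"
    \<comment> \<open>The endpoint \<open>\<tau> = t\<close> has lost its dispersive phase; the endpoint \<open>\<tau> = 0\<close> keeps it.\<close>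
    have 1: "convergent_tail (\<lambda>k. dispersive m z 0 c1 c2 c3 k * (?a * of_real (1 / rho m k)))"
      by (rule convergent_tail_dispersive[OF inv_d inv_c]) (use z xt in auto)
    have "decays 2 (\<lambda>k. (?b * of_real (1 / rho m k) - ?b / of_real k) + R k)"
      by (intro decays_add inv_d R)
    then have 2: "decays 2 (\<lambda>k. (?b * of_real (1 / rho m k) + R k) - ?b / of_real k)"
      by (rule decays_cong) simp
    have 3: "convergent_tail (\<lambda>k. dispersive m z (- s * t) c1 c2 c3 k * (?b * of_real (1 / rho m k) + R k))"
      by (rule convergent_tail_dispersive[OF 2 continuous_on_add[OF inv_c R(1)]]) (use z s xt in auto)
    from convergent_tail_add[OF 1 3] show ?thesis
    proof (rule convergent_tail_cong)
      fix k :: real assume k: "k \<ge> 1"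
      have w: "wave (rho m k) (- s * t) * wave (rho m k) (s * t) = 1" "wave (rho m k) 0 = 1"
        unfolding wave_add[symmetric] by (simp_all add: wave_def)
      have "dispersive m z (- s * t) c1 c2 c3 k * J k =
         wave k z * (wave (rho m k) (- s * t) * wave (rho m k) (s * t)) * symbol m c1 c2 c3 k * (?a * of_real (1 / rho m k)) +
         dispersive m z (- s * t) c1 c2 c3 k * (?b * of_real (1 / rho m k) + R k)"
      proof -
        have "A * B * S * ((p * w - q) * (r / d) + y) = A * (B * w) * S * (p / d * r) + A * B * S * (- q / d * r + y)"
          for A B S p w q r d y :: complex
          by (simp add: divide_inverse algebra_simps)
        then show ?thesis unfolding R(3)[OF k] .
      qed
      then show "dispersive m z 0 c1 c2 c3 k * (?a * of_real (1 / rho m k)) +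
         dispersive m z (- s * t) c1 c2 c3 k * (?b * of_real (1 / rho m k) + R k) =
         dispersive m z (- s * t) c1 c2 c3 k * J k"
        by (simp only: w)
    qed
  qed
  have "gen_integrable (\<lambda>k. dispersive m x (- s * t) c1 c2 c3 k * J k)"
  proof (rule gen_integrable_criterion)
    have [measurable]: "J \<in> borel_measurable borel"
      by (intro borel_measurable_continuous_onI Jc)
    have [measurable]: "(\<lambda>k. wave k x) \<in> borel_measurable borel" "(\<lambda>k. wave (rho m k) (- s * t)) \<in> borel_measurable borel"
      by (intro borel_measurable_continuous_onI continuous_intros)+
    show "(\<lambda>k. dispersive m x (- s * t) c1 c2 c3 k * J k) \<in> borel_measurable borel"
      by measurable
    show "norm (dispersive m x (- s * t) c1 c2 c3 k * J k) \<le>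
        (norm c1 + norm c2 + norm c3) * (B * t)" for k
      unfolding norm_mult norm_wave mult_1
      by (intro mult_mono symbol_bounded Jb) auto
    show "convergent_tail (\<lambda>k. dispersive m x (- s * t) c1 c2 c3 k * J k)"
      by (rule tail) simp
    have "J (- k) = J k" for k by (simp add: J_def)
    moreover have "wave (- k) x = wave k (- x)" for k by (simp add: wave_def)
    ultimately show "convergent_tail (\<lambda>k. wave (- k) x * wave (rho m (- k)) (- s * t) * symbol m c1 c2 c3 (- k) * J (- k))"
      using tail[of "- x" "- c1"] by (simp add: symbol_minus)
  qed
  then show ?thesis by (simp add: J_def)
qed

section \<open>The twelve integrals of the problem\<close>

lemma gen_integrable_add:
  assumes "gen_integrable f" "gen_integrable g"
  shows "gen_integrable (\<lambda>k. f k + g k)"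
proof -
  obtain I J I' J' where *: "\<And>A. A > 0 \<Longrightarrow> f integrable_on {0..A}" "\<And>A. A > 0 \<Longrightarrow> f integrable_on {-A..0}"
    "\<And>A. A > 0 \<Longrightarrow> g integrable_on {0..A}" "\<And>A. A > 0 \<Longrightarrow> g integrable_on {-A..0}"
    "((\<lambda>A. integral {0..A} f) \<longlongrightarrow> I) at_top" "((\<lambda>A. integral {-A..0} f) \<longlongrightarrow> J) at_top"
    "((\<lambda>A. integral {0..A} g) \<longlongrightarrow> I') at_top" "((\<lambda>A. integral {-A..0} g) \<longlongrightarrow> J') at_top"
    using assms unfolding gen_integrable_def by blast
  have "((\<lambda>A. integral {0..A} (\<lambda>k. f k + g k)) \<longlongrightarrow> I + I') at_top"
    by (rule Lim_transform_eventually[OF tendsto_add[OF *(5,7)]])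
      (rule eventually_mono[OF eventually_gt_at_top[of 0]], simp add: integral_add *)
  moreover have "((\<lambda>A. integral {-A..0} (\<lambda>k. f k + g k)) \<longlongrightarrow> J + J') at_top"
    by (rule Lim_transform_eventually[OF tendsto_add[OF *(6,8)]])
      (rule eventually_mono[OF eventually_gt_at_top[of 0]], simp add: integral_add *)
  ultimately show ?thesis
    unfolding gen_integrable_def using * by (auto intro: integrable_add)
qed

lemma gen_integral_tendsto:
  assumes "gen_integrable f"
  shows "((\<lambda>A. integral {-A..A} f) \<longlongrightarrow> gen_integral f) at_top"
proof -
  obtain I J where *: "\<And>A. A > 0 \<Longrightarrow> f integrable_on {0..A}" "\<And>A. A > 0 \<Longrightarrow> f integrable_on {-A..0}"
    "((\<lambda>A. integral {0..A} f) \<longlongrightarrow> I) at_top" "((\<lambda>A. integral {-A..0} f) \<longlongrightarrow> J) at_top"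
    using assms unfolding gen_integrable_def by blast
  have "gen_integral f = I + J"
    unfolding gen_integral_def using tendsto_Lim[OF _ *(3)] tendsto_Lim[OF _ *(4)] by simp
  moreover have "((\<lambda>A. integral {0..A} f + integral {-A..0} f) \<longlongrightarrow> I + J) at_top"
    by (intro tendsto_add *)
  then have "((\<lambda>A. integral {-A..A} f) \<longlongrightarrow> I + J) at_top"
  proof (rule Lim_transform_eventually)
    show "\<forall>\<^sub>F A in at_top. integral {0..A} f + integral {-A..0} f = integral {-A..A} f"
      using eventually_gt_at_top[of 0]
    proof eventually_elim
      case (elim A)
      have "f integrable_on {-A..A}"
        by (rule Henstock_Kurzweil_Integration.integrable_combine[of "-A" 0 A]) (use elim * in auto)
      then show ?case
        using Henstock_Kurzweil_Integration.integral_combine[of "-A" 0 A f] elim by (simp add: add.commute)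
    qed
  qed
  ultimately show ?thesis by simp
qed

lemma gen_integrable_on_symmetric:
  assumes "gen_integrable f" "A > 0" shows "f integrable_on {-A..A}"
  using assms unfolding gen_integrable_def
  by (intro Henstock_Kurzweil_Integration.integrable_combine[of "-A" 0 A]) auto

lemma exp_phase:
  "exp (\<i> * of_real k * of_real x - omega1 m k * of_real t) = wave k x * wave (rho m k) (- t)"
  "exp (\<i> * of_real k * of_real x - omega2 m k * of_real t) = wave k x * wave (rho m k) t"
  "exp (omega1 m k * of_real t) = wave (rho m k) t"
  "exp (omega2 m k * of_real t) = wave (rho m k) (- t)"
  by (simp_all add: wave_def omega1_def omega2_def exp_add[symmetric] algebra_simps)

lemma i_omega:
  "\<i> * omega1 m k = - of_real (rho m k)" "\<i> * omega2 m k = of_real (rho m k)"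
  by (simp_all add: omega1_def omega2_def)

lemma gen_integrable_initial:
  assumes g: "schwartz_halfline g1" "schwartz_halfline g2" and xt: "0 < t" "t < x"
  shows "gen_integrable (G11 m g1 g2 x t)" "gen_integrable (G12 m g1 g2 x t)"
    "gen_integrable (G13 m g1 g2 x t)" "gen_integrable (G14 m g1 g2 x t)"
    "gen_integrable (G21 m g1 g2 x t)" "gen_integrable (G22 m g1 g2 x t)"
    "gen_integrable (G23 m g1 g2 x t)" "gen_integrable (G24 m g1 g2 x t)"
proof -
  have main: "gen_integrable (\<lambda>k. wave k x * wave (rho m k) q * symbol m (1/2) 0 0 k * halfline_fourier f (\<epsilon> * k) +
     wave k x * wave (rho m k) q * symbol m 0 c2 c3 k * halfline_fourier g (\<epsilon> * k))"
    if "schwartz_halfline f" "schwartz_halfline g" "q = t \<or> q = - t" "\<epsilon> = 1 \<or> \<epsilon> = -1" for f g q \<epsilon> c2 c3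
    using that xt by (intro gen_integrable_add gen_integrable_fourier) auto
  have eq: "wave k x * w * symbol m (1/2) 0 0 k * u + wave k x * w * symbol m 0 c2 c3 k * v =
      wave k x * w * (of_real k * u + (2 * c2 * of_real (rho m k) + 2 * c3 * of_real m) * v) / of_real (2 * rho m k)" for k w u v c2 c3
    by (cases "rho m k = 0") (simp_all add: symbol_def field_simps)
  note main = main[unfolded eq]
  show "gen_integrable (G11 m g1 g2 x t)"
    using main[of g2 g1 "-t" 1 "1/2" "1/2"] g unfolding G11_def[abs_def] exp_phase i_omega by (simp add: algebra_simps)
  show "gen_integrable (G12 m g1 g2 x t)"
    using main[of g2 g1 "-t" "-1" "-1/2" "-1/2"] g unfolding G12_def[abs_def] exp_phase i_omega by (simp add: algebra_simps)
  show "gen_integrable (G13 m g1 g2 x t)"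
    using main[of g2 g1 t 1 "-1/2" "1/2"] g unfolding G13_def[abs_def] exp_phase i_omega by (simp add: algebra_simps)
  show "gen_integrable (G14 m g1 g2 x t)"
    using main[of g2 g1 t "-1" "1/2" "-1/2"] g unfolding G14_def[abs_def] exp_phase i_omega by (simp add: algebra_simps)
  show "gen_integrable (G21 m g1 g2 x t)"
    using main[of g1 g2 "-t" 1 "1/2" "-1/2"] g unfolding G21_def[abs_def] exp_phase i_omega by (simp add: algebra_simps)
  show "gen_integrable (G22 m g1 g2 x t)"
    using main[of g1 g2 "-t" "-1" "-1/2" "1/2"] g unfolding G22_def[abs_def] exp_phase i_omega by (simp add: algebra_simps)
  show "gen_integrable (G23 m g1 g2 x t)"
    using main[of g1 g2 t 1 "-1/2" "-1/2"] g unfolding G23_def[abs_def] exp_phase i_omega by (simp add: algebra_simps)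
  show "gen_integrable (G24 m g1 g2 x t)"
    using main[of g1 g2 t "-1" "1/2" "1/2"] g unfolding G24_def[abs_def] exp_phase i_omega by (simp add: algebra_simps)
qed

lemma gen_integrable_boundary:
  assumes h: "smooth_halfline h1" and xt: "0 < t" "t < x"
  shows "gen_integrable (H11 m h1 x t)" "gen_integrable (H12 m h1 x t)"
    "gen_integrable (H21 m h1 x t)" "gen_integrable (H22 m h1 x t)"
proof -
  note 1 = gen_integrable_source[OF h xt, of 1, simplified]
  note 2 = gen_integrable_source[OF h xt, of "-1", simplified]
  have eq: "wave k x * w * u * s / of_real (rho m k) = wave k x * w * (s / of_real (rho m k)) * u" for k w u s
    by simp
  show "gen_integrable (H11 m h1 x t)"
    using 1[of m 1 0 0] unfolding H11_def[abs_def] exp_phase eq by (simp add: symbol_def)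
  show "gen_integrable (H12 m h1 x t)"
    using 2[of m 1 0 0] unfolding H12_def[abs_def] exp_phase eq by (simp add: symbol_def)
  show "gen_integrable (H21 m h1 x t)"
    using 1[of m 0 "-1" 1] unfolding H21_def[abs_def] exp_phase eq i_omega by (simp add: symbol_def)
  show "gen_integrable (H22 m h1 x t)"
    using 2[of m 0 1 1] unfolding H22_def[abs_def] exp_phase eq i_omega by (simp add: symbol_def)
qed

section \<open>The explicit solution and its decay\<close>

text \<open>Once the separate convergence on the two half-lines is known, symmetric truncation gives the same
  value, and only for symmetric truncation do the reflections \<open>k \<mapsto> -k\<close> and the Dirichlet kernel apply.\<close>

definition has_pv_integral :: "(real \<Rightarrow> complex) \<Rightarrow> complex \<Rightarrow> bool" where
  "has_pv_integral f I \<longleftrightarrow>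
     (\<forall>A>0. f integrable_on {-A..A}) \<and> ((\<lambda>A. integral {-A..A} f) \<longlongrightarrow> I) at_top"

lemma has_pv_integral_add:
  assumes "has_pv_integral f I" "has_pv_integral g J"
  shows "has_pv_integral (\<lambda>k. f k + g k) (I + J)"
proof -
  have "((\<lambda>A. integral {-A..A} f + integral {-A..A} g) \<longlongrightarrow> I + J) at_top"
    using assms unfolding has_pv_integral_def by (intro tendsto_add) auto
  then have "((\<lambda>A. integral {-A..A} (\<lambda>k. f k + g k)) \<longlongrightarrow> I + J) at_top"
  proof (rule Lim_transform_eventually)
    show "\<forall>\<^sub>F A in at_top. integral {-A..A} f + integral {-A..A} g = integral {-A..A} (\<lambda>k. f k + g k)"
      using eventually_gt_at_top[of 0]
      by eventually_elim (use assms in \<open>simp add: has_pv_integral_def integral_add\<close>)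
  qed
  then show ?thesis using assms unfolding has_pv_integral_def by (auto intro: integrable_add)
qed

lemma has_pv_integral_cmult:
  assumes "has_pv_integral f I" shows "has_pv_integral (\<lambda>k. c * f k) (c * I)"
  using assms unfolding has_pv_integral_def
  by (auto intro: tendsto_mult_left integrable_on_mult_right)

lemma has_pv_integral_diff:
  assumes "has_pv_integral f I" "has_pv_integral g J"
  shows "has_pv_integral (\<lambda>k. f k - g k) (I - J)"
  using has_pv_integral_add[OF assms(1) has_pv_integral_cmult[OF assms(2), of "-1"]] by simp

lemma has_pv_integral_gen_integral:
  "gen_integrable f \<Longrightarrow> has_pv_integral f (gen_integral f)"
  unfolding has_pv_integral_def by (auto intro: gen_integral_tendsto gen_integrable_on_symmetric)

text \<open>The exception \<open>k = 0\<close> is needed for \<open>m = 0\<close>, where the integrands carry the value of a division by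
  zero at that point.\<close>

lemma has_pv_integral_unique:
  assumes "has_pv_integral f I" "has_pv_integral g J" "\<And>k. k \<noteq> 0 \<Longrightarrow> f k = g k"
  shows "I = J"
proof (rule tendsto_unique[OF trivial_limit_at_top_linorder])
  show "((\<lambda>A. integral {-A..A} f) \<longlongrightarrow> I) at_top"
    using assms(1) by (simp add: has_pv_integral_def)
  have "integral {-A..A} f = integral {-A..A} g" for A
    by (rule integral_spike[of "{0}"]) (use assms(3) in auto)
  then show "((\<lambda>A. integral {-A..A} f) \<longlongrightarrow> J) at_top"
    using assms(2) by (simp add: has_pv_integral_def)
qed

lemma has_pv_integral_continuous:
  assumes "continuous_on UNIV f" "((\<lambda>A. integral {-A..A} f) \<longlongrightarrow> I) at_top"
  shows "has_pv_integral f I"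
  using assms unfolding has_pv_integral_def
  by (auto intro: integrable_continuous_real continuous_on_subset)

lemma propagator_cases:
  assumes "op \<in> {cos_op m, sinc_op m, dsinc_op m}"
  obtains c1 c2 n r b c where "op = wave_op m c1 c2 n r b" "n > 0"
    "\<And>s. (b has_vector_derivative c) (at s)"
proof -
  have const: "((\<lambda>s::real. c) has_vector_derivative (0::complex)) (at s)" for c s
    by (auto intro!: derivative_eq_intros)
  have linear: "((\<lambda>s::real. - \<i> * of_real s) has_vector_derivative - \<i> * of_real 1) (at s)" for s
    by (intro has_vector_derivative_mult_right has_vector_derivative_of_real DERIV_ident)
  from assms consider "op = cos_op m" | "op = sinc_op m" | "op = dsinc_op m" by auto
  then show ?thesis
  proof cases
    case 1
    show ?thesis by (rule that[OF 1[unfolded cos_op_def] _ const]) simp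
  next
    case 2
    show ?thesis by (rule that[OF 2[unfolded sinc_op_def] _ const]) simp
  next
    case 3
    show ?thesis by (rule that[OF 3[unfolded dsinc_op_def] _ linear]) simp
  qed
qed

lemma propagator_pv:
  assumes op: "op \<in> {cos_op m, sinc_op m, dsinc_op m}" and xt: "0 < t" "t < x"
  shows "schwartz_halfline f \<Longrightarrow> has_pv_integral (\<lambda>k. op (wave k) x t * halfline_fourier f k) (of_real (2 * pi) * op f x t)"
    and "schwartz_halfline f \<Longrightarrow> has_pv_integral (\<lambda>k. op (wave k) x t * halfline_fourier f (- k)) 0"
    and "smooth_halfline h \<Longrightarrow> has_pv_integral (\<lambda>k. integral {0..t} (\<lambda>\<tau>. h \<tau> * op (wave k) x (t - \<tau>))) 0"
proof -
  obtain c1 c2 n r b c where *: "op = wave_op m c1 c2 n r b" "n > 0"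
    "\<And>s. (b has_vector_derivative c) (at s)"
    using propagator_cases[OF op] by blast
  have bc: "continuous_on {-1..1} b"
    by (meson *(3) continuous_at_imp_continuous_on has_vector_derivative_continuous)
  have W: "continuous_on UNIV (\<lambda>k. op (wave k) x t)"
    unfolding * by (intro wave_op_wave_continuous bc continuous_intros)
  show "has_pv_integral (\<lambda>k. op (wave k) x t * halfline_fourier f k) (of_real (2 * pi) * op f x t)"
    if f: "schwartz_halfline f"
    by (rule has_pv_integral_continuous)
      (intro continuous_on_mult W halfline_fourier_continuous f, unfold *, rule wave_op_inversion(1)[OF f bc xt])
  show "has_pv_integral (\<lambda>k. op (wave k) x t * halfline_fourier f (- k)) 0"
    if f: "schwartz_halfline f"
  proof (rule has_pv_integral_continuous)
    have "continuous_on UNIV (\<lambda>k. halfline_fourier f (- k))"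
      by (intro continuous_on_compose2[OF halfline_fourier_continuous[OF f]] continuous_intros) auto
    then show "continuous_on UNIV (\<lambda>k. op (wave k) x t * halfline_fourier f (- k))"
      by (intro continuous_on_mult W)
    show "((\<lambda>A. integral {- A..A} (\<lambda>k. op (wave k) x t * halfline_fourier f (- k))) \<longlongrightarrow> 0) at_top"
      unfolding * by (rule wave_op_inversion(2)[OF f bc xt])
  qed
  show "has_pv_integral (\<lambda>k. integral {0..t} (\<lambda>\<tau>. h \<tau> * op (wave k) x (t - \<tau>))) 0"
    if h: "smooth_halfline h"
  proof (rule has_pv_integral_continuous)
    have hc: "continuous_on {0..t} h"
      by (intro continuous_on_subset[OF smooth_halfline_continuous] h; auto)
    have "continuous_on (UNIV \<times> {0..t}) (\<lambda>p. h (snd p))"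
      by (rule continuous_on_compose2[OF hc]) (auto intro!: continuous_intros)
    then have "continuous_on (UNIV \<times> cbox 0 t) (\<lambda>(k, \<tau>). h \<tau> * op (wave k) x (t - \<tau>))"
      unfolding case_prod_unfold cbox_interval *
      by (intro continuous_intros wave_op_wave_continuous bc)
    from integral_continuous_on_param[OF this]
    show "continuous_on UNIV (\<lambda>k. integral {0..t} (\<lambda>\<tau>. h \<tau> * op (wave k) x (t - \<tau>)))" by simp
    show "((\<lambda>A. integral {- A..A} (\<lambda>k. integral {0..t} (\<lambda>\<tau>. h \<tau> * op (wave k) x (t - \<tau>)))) \<longlongrightarrow> 0) at_top"
      unfolding * by (rule wave_op_source_vanishes[OF h *(3) _ *(2) xt]) (intro continuous_intros)
  qed
qed

lemma propagator_kg_class: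
  assumes "schwartz_halfline f"
  shows "kg_class m (cos_op m f)" "kg_class m (sinc_op m f)" "kg_class m (dsinc_op m f)"
  unfolding cos_op_def sinc_op_def dsinc_op_def
  by (intro wave_op_kg_class assms continuous_intros)+

text \<open>Expanding \<open>exp (\<plusminus> \<i> \<rho> t)\<close> into cosine and sine, the terms that are odd in \<open>\<rho>\<close> cancel; what remains
  are the three propagator symbols.\<close>

lemma initial_integrands_sum:
  assumes k: "k \<noteq> 0"
  shows "G11 m g1 g2 x t k + G12 m g1 g2 x t k - G13 m g1 g2 x t k - G14 m g1 g2 x t k =
      (cos_op m (wave k) x t * halfline_fourier g1 k - \<i> * of_real m * (sinc_op m (wave k) x t * halfline_fourier g1 k)
        - \<i> * (dsinc_op m (wave k) x t * halfline_fourier g2 k))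
      + (\<i> * of_real m * (sinc_op m (wave k) x t * halfline_fourier g1 (- k)) - cos_op m (wave k) x t * halfline_fourier g1 (- k)
        - \<i> * (dsinc_op m (wave k) x t * halfline_fourier g2 (- k)))" (is ?first)
    and "G21 m g1 g2 x t k - G22 m g1 g2 x t k - G23 m g1 g2 x t k + G24 m g1 g2 x t k =
      (cos_op m (wave k) x t * halfline_fourier g2 k + \<i> * of_real m * (sinc_op m (wave k) x t * halfline_fourier g2 k)
        - \<i> * (dsinc_op m (wave k) x t * halfline_fourier g1 k))
      + (\<i> * of_real m * (sinc_op m (wave k) x t * halfline_fourier g2 (- k)) + cos_op m (wave k) x t * halfline_fourier g2 (- k)
        + \<i> * (dsinc_op m (wave k) x t * halfline_fourier g1 (- k)))" (is ?second)
proof -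
  define r where "r = complex_of_real (rho m k)"
  have r: "r \<noteq> 0" using abs_le_rho(1)[of k m] k by (auto simp: r_def)
  define W where "W = wave k x"
  define c where "c = complex_of_real (cos (rho m k * t))"
  define s where "s = complex_of_real (sin (rho m k * t))"
  have ops: "cos_op m (wave k) x t = W * c" "sinc_op m (wave k) x t = W * s / r"
     "dsinc_op m (wave k) x t = of_real k * (W * s / r)"
    using propagator_wave[of m k x t] r unfolding W_def c_def s_def r_def[symmetric]
    by (simp_all add: field_simps)
  have w: "wave (rho m k) t = c + \<i> * s" "wave (rho m k) (- t) = c - \<i> * s"
    by (simp_all add: wave_eq c_def s_def)
  note defs = G11_def G12_def G13_def G14_def G21_def G22_def G23_def G24_def
  show ?first
    unfolding defs exp_phase i_omega ops w W_def[symmetric] of_real_mult of_real_numeral r_def[symmetric]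
    using r by (simp add: divide_simps) (simp add: algebra_simps)
  show ?second
    unfolding defs exp_phase i_omega ops w W_def[symmetric] of_real_mult of_real_numeral r_def[symmetric]
    using r by (simp add: divide_simps) (simp add: algebra_simps)
qed

lemma boundary_integrands_sum:
  assumes k: "k \<noteq> 0" and h: "smooth_halfline h1" and xt: "0 < t" "t < x"
  shows "H11 m h1 x t k - H12 m h1 x t k =
      - 2 * \<i> * integral {0..t} (\<lambda>\<tau>. h1 \<tau> * dsinc_op m (wave k) x (t - \<tau>))" (is ?first)
    and "- H21 m h1 x t k + H22 m h1 x t k =
      2 * integral {0..t} (\<lambda>\<tau>. h1 \<tau> * cos_op m (wave k) x (t - \<tau>)) +
      2 * \<i> * of_real m * integral {0..t} (\<lambda>\<tau>. h1 \<tau> * sinc_op m (wave k) x (t - \<tau>))" (is ?second)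
proof -
  define r where "r = complex_of_real (rho m k)"
  have r: "r \<noteq> 0" using abs_le_rho(1)[of k m] k by (auto simp: r_def)
  have hc: "continuous_on {0..t} h1"
    by (intro continuous_on_subset[OF smooth_halfline_continuous] h; auto)
  let ?W = "wave k x" and ?c = "\<lambda>\<tau>. complex_of_real (cos (rho m k * (t - \<tau>)))"
    and ?s = "\<lambda>\<tau>. complex_of_real (sin (rho m k * (t - \<tau>)))"
  define Ic where "Ic = integral {0..t} (\<lambda>\<tau>. h1 \<tau> * ?c \<tau>)"
  define Is where "Is = integral {0..t} (\<lambda>\<tau>. h1 \<tau> * ?s \<tau>)"
  have ops: "cos_op m (wave k) x u = ?W * of_real (cos (rho m k * u))"
    "sinc_op m (wave k) x u = (?W / r) * of_real (sin (rho m k * u))"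
     "dsinc_op m (wave k) x u = (of_real k * ?W / r) * of_real (sin (rho m k * u))" for u
    using propagator_wave[of m k x u] r unfolding r_def[symmetric]
    by (simp_all add: field_simps)
  have pull: "integral {0..t} (\<lambda>\<tau>. h1 \<tau> * (d * ?c \<tau>)) = d * Ic"
    "integral {0..t} (\<lambda>\<tau>. h1 \<tau> * (d * ?s \<tau>)) = d * Is" for d
    unfolding Ic_def Is_def integral_mult_right[symmetric] by (simp_all add: mult.left_commute)
  have shift: "wave (rho m k) (- t) * integral {0..t} (\<lambda>\<tau>. h1 \<tau> * wave (rho m k) \<tau>) = Ic - \<i> * Is"
    "wave (rho m k) t * integral {0..t} (\<lambda>\<tau>. h1 \<tau> * wave (rho m k) (- \<tau>)) = Ic + \<i> * Is"
  proof -
    have minus: "wave (rho m k) (- t) * wave (rho m k) \<tau> = ?c \<tau> - \<i> * ?s \<tau>" for \<tau>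
    proof -
      have "wave (rho m k) (- t) * wave (rho m k) \<tau> = wave (rho m k) (- (t - \<tau>))"
        unfolding wave_add[symmetric] by simp
      also have "\<dots> = ?c \<tau> - \<i> * ?s \<tau>"
        unfolding wave_eq mult_minus_right cos_minus sin_minus by simp
      finally show ?thesis .
    qed
    have plus: "wave (rho m k) t * wave (rho m k) (- \<tau>) = ?c \<tau> + \<i> * ?s \<tau>" for \<tau>
    proof -
      have "wave (rho m k) t * wave (rho m k) (- \<tau>) = wave (rho m k) (t - \<tau>)"
        unfolding wave_add[symmetric] by simp
      then show ?thesis unfolding wave_eq[of _ "t - \<tau>"] .
    qed
    have int: "(\<lambda>\<tau>. h1 \<tau> * ?c \<tau>) integrable_on {0..t}" "(\<lambda>\<tau>. \<i> * (h1 \<tau> * ?s \<tau>)) integrable_on {0..t}"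
      by (intro integrable_continuous_real continuous_intros hc)+
    have "wave (rho m k) (- t) * integral {0..t} (\<lambda>\<tau>. h1 \<tau> * wave (rho m k) \<tau>) =
        integral {0..t} (\<lambda>\<tau>. h1 \<tau> * (wave (rho m k) (- t) * wave (rho m k) \<tau>))"
      unfolding integral_mult_right[symmetric] by (simp only: mult.left_commute)
    also have "\<dots> = integral {0..t} (\<lambda>\<tau>. h1 \<tau> * ?c \<tau> - \<i> * (h1 \<tau> * ?s \<tau>))"
      unfolding minus by (simp only: right_diff_distrib mult.left_commute)
    finally show "wave (rho m k) (- t) * integral {0..t} (\<lambda>\<tau>. h1 \<tau> * wave (rho m k) \<tau>) = Ic - \<i> * Is"
      unfolding integral_diff[OF int] Ic_def Is_def integral_mult_right .
    have "wave (rho m k) t * integral {0..t} (\<lambda>\<tau>. h1 \<tau> * wave (rho m k) (- \<tau>)) =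
        integral {0..t} (\<lambda>\<tau>. h1 \<tau> * (wave (rho m k) t * wave (rho m k) (- \<tau>)))"
      unfolding integral_mult_right[symmetric] by (simp only: mult.left_commute)
    also have "\<dots> = integral {0..t} (\<lambda>\<tau>. h1 \<tau> * ?c \<tau> + \<i> * (h1 \<tau> * ?s \<tau>))"
      unfolding plus by (simp only: distrib_left mult.left_commute)
    finally show "wave (rho m k) t * integral {0..t} (\<lambda>\<tau>. h1 \<tau> * wave (rho m k) (- \<tau>)) = Ic + \<i> * Is"
      unfolding integral_add[OF int] Ic_def Is_def integral_mult_right .
  qed
  have assoc: "A * B * I * D / E = A * (B * I) * D / E" for A B I D E :: complex by simp
  note defs = H11_def H12_def H21_def H22_def
  show ?first
    unfolding defs exp_phase i_omega ops pull assoc shift r_def[symmetric]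
    using r by (simp add: divide_simps) (simp add: algebra_simps)
  show ?second
    unfolding defs exp_phase i_omega ops pull assoc shift r_def[symmetric]
    using r by (simp add: divide_simps) (simp add: algebra_simps)
qed

text \<open>The representation outside the light cone: reflected transforms and boundary source have
  limit \<open>0\<close>, and only the propagators applied to the initial data remain. In particular the fields do
  not depend on \<open>h1\<close> there.\<close>

theorem psi_explicit:
  assumes g: "schwartz_halfline g1" "schwartz_halfline g2" and h: "smooth_halfline h1" and xt: "0 < t" "t < x"
  shows "psi1 m g1 g2 h1 x t = cos_op m g1 x t + (- \<i> * of_real m) * sinc_op m g1 x t + (- \<i>) * dsinc_op m g2 x t"
    and "psi2 m g1 g2 h1 x t = cos_op m g2 x t + (\<i> * of_real m) * sinc_op m g2 x t + (- \<i>) * dsinc_op m g1 x t"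
proof -
  note gi = gen_integrable_initial[OF g xt, of m, THEN has_pv_integral_gen_integral]
    and hi = gen_integrable_boundary[OF h xt, of m, THEN has_pv_integral_gen_integral]
  have ops: "cos_op m \<in> {cos_op m, sinc_op m, dsinc_op m}" "sinc_op m \<in> {cos_op m, sinc_op m, dsinc_op m}"
    "dsinc_op m \<in> {cos_op m, sinc_op m, dsinc_op m}" by auto
  note pv = ops[THEN propagator_pv(1), OF xt] and reflected = ops[THEN propagator_pv(2), OF xt]
    and src = ops[THEN propagator_pv(3), OF xt h]
  let ?f = "halfline_fourier" and ?C = "\<lambda>k. cos_op m (wave k) x t" and ?S = "\<lambda>k. sinc_op m (wave k) x t"
    and ?X = "\<lambda>k. dsinc_op m (wave k) x t"
  let ?p = "of_real (2 * pi) :: complex"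
  have "?p * psi1 m g1 g2 h1 x t = (gen_integral (G11 m g1 g2 x t) + gen_integral (G12 m g1 g2 x t)
      - gen_integral (G13 m g1 g2 x t) - gen_integral (G14 m g1 g2 x t)) +
      (gen_integral (H11 m h1 x t) - gen_integral (H12 m h1 x t))"
    unfolding psi1_def by (simp del: of_real_mult add: add_diff_eq)
  then have lhs1: "has_pv_integral (\<lambda>k. (G11 m g1 g2 x t k + G12 m g1 g2 x t k - G13 m g1 g2 x t k - G14 m g1 g2 x t k)
     + (H11 m h1 x t k - H12 m h1 x t k)) (?p * psi1 m g1 g2 h1 x t)"
    using has_pv_integral_add[OF has_pv_integral_diff[OF has_pv_integral_diff[OF
      has_pv_integral_add[OF gi(1,2)] gi(3)] gi(4)] has_pv_integral_diff[OF hi(1,2)]]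
    by (simp only:)
  have rhs1: "has_pv_integral (\<lambda>k. ((?C k * ?f g1 k - \<i> * of_real m * (?S k * ?f g1 k) - \<i> * (?X k * ?f g2 k))
      + (\<i> * of_real m * (?S k * ?f g1 (- k)) - ?C k * ?f g1 (- k) - \<i> * (?X k * ?f g2 (- k))))
      + - 2 * \<i> * integral {0..t} (\<lambda>\<tau>. h1 \<tau> * dsinc_op m (wave k) x (t - \<tau>)))
     (((?p * cos_op m g1 x t - \<i> * of_real m * (?p * sinc_op m g1 x t) - \<i> * (?p * dsinc_op m g2 x t))
      + (\<i> * of_real m * 0 - 0 - \<i> * 0)) + - 2 * \<i> * 0)"
    by (intro has_pv_integral_add has_pv_integral_diff has_pv_integral_cmult pv reflected src g)
  have "?p * psi1 m g1 g2 h1 x t = ((?p * cos_op m g1 x t - \<i> * of_real m * (?p * sinc_op m g1 x t) - \<i> * (?p * dsinc_op m g2 x t))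
      + (\<i> * of_real m * 0 - 0 - \<i> * 0)) + - 2 * \<i> * 0"
    by (rule has_pv_integral_unique[OF lhs1 rhs1])
      (rule arg_cong2[where f = "(+)", OF initial_integrands_sum(1) boundary_integrands_sum(1)[OF _ h xt]])
  also have "\<dots> = ?p * (cos_op m g1 x t + (- \<i> * of_real m) * sinc_op m g1 x t + (- \<i>) * dsinc_op m g2 x t)"
    by (simp add: algebra_simps)
  finally show "psi1 m g1 g2 h1 x t = cos_op m g1 x t + (- \<i> * of_real m) * sinc_op m g1 x t + (- \<i>) * dsinc_op m g2 x t"
    by simp
  have "?p * psi2 m g1 g2 h1 x t = (gen_integral (G21 m g1 g2 x t) - gen_integral (G22 m g1 g2 x t)
      - gen_integral (G23 m g1 g2 x t) + gen_integral (G24 m g1 g2 x t)) +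
      (-1 * gen_integral (H21 m h1 x t) + gen_integral (H22 m h1 x t))"
    unfolding psi2_def by (simp del: of_real_mult add: add_diff_eq)
  then have lhs2: "has_pv_integral (\<lambda>k. (G21 m g1 g2 x t k - G22 m g1 g2 x t k - G23 m g1 g2 x t k + G24 m g1 g2 x t k)
     + (- H21 m h1 x t k + H22 m h1 x t k)) (?p * psi2 m g1 g2 h1 x t)"
    using has_pv_integral_add[OF has_pv_integral_add[OF has_pv_integral_diff[OF has_pv_integral_diff[OF
      gi(5,6)] gi(7)] gi(8)] has_pv_integral_add[OF has_pv_integral_cmult[OF hi(3), of "-1"] hi(4)]]
    by (simp only: mult_minus1)
  have rhs2: "has_pv_integral (\<lambda>k. ((?C k * ?f g2 k + \<i> * of_real m * (?S k * ?f g2 k) - \<i> * (?X k * ?f g1 k))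
      + (\<i> * of_real m * (?S k * ?f g2 (- k)) + ?C k * ?f g2 (- k) + \<i> * (?X k * ?f g1 (- k))))
      + (2 * integral {0..t} (\<lambda>\<tau>. h1 \<tau> * cos_op m (wave k) x (t - \<tau>)) +
         2 * \<i> * of_real m * integral {0..t} (\<lambda>\<tau>. h1 \<tau> * sinc_op m (wave k) x (t - \<tau>))))
     (((?p * cos_op m g2 x t + \<i> * of_real m * (?p * sinc_op m g2 x t) - \<i> * (?p * dsinc_op m g1 x t))
      + (\<i> * of_real m * 0 + 0 + \<i> * 0)) + (2 * 0 + 2 * \<i> * of_real m * 0))"
    by (intro has_pv_integral_add has_pv_integral_diff has_pv_integral_cmult pv reflected src g)
  have "?p * psi2 m g1 g2 h1 x t = ((?p * cos_op m g2 x t + \<i> * of_real m * (?p * sinc_op m g2 x t) - \<i> * (?p * dsinc_op m g1 x t))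
      + (\<i> * of_real m * 0 + 0 + \<i> * 0)) + (2 * 0 + 2 * \<i> * of_real m * 0)"
    by (rule has_pv_integral_unique[OF lhs2 rhs2])
      (rule arg_cong2[where f = "(+)", OF initial_integrands_sum(2) boundary_integrands_sum(2)[OF _ h xt]])
  also have "\<dots> = ?p * (cos_op m g2 x t + (\<i> * of_real m) * sinc_op m g2 x t + (- \<i>) * dsinc_op m g1 x t)"
    by (simp add: algebra_simps)
  finally show "psi2 m g1 g2 h1 x t = cos_op m g2 x t + (\<i> * of_real m) * sinc_op m g2 x t + (- \<i>) * dsinc_op m g1 x t"
    by simp
qed

theorem theorem3:
  fixes m T :: real and g1 g2 h1 :: "real \<Rightarrow> complex" and n l E :: nat
  assumes "m \<ge> 0"
    and "schwartz_halfline g1" and "schwartz_halfline g2"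
    and "smooth_halfline h1"
    and "T > 0"
  shows "(\<forall>\<^sub>F x in at_top. \<forall>t\<in>{0<..T}.
           psi_well_defined m g1 g2 h1 x t \<and>
           mixed_deriv_exists n l (psi1 m g1 g2 h1) x t \<and>
           mixed_deriv_exists n l (psi2 m g1 g2 h1) x t) \<and>
         uniform_limit {0<..T}
           (\<lambda>x t. x ^ E *\<^sub>R mixed_deriv n l (psi1 m g1 g2 h1) x t) (\<lambda>t. 0) at_top \<and>
         uniform_limit {0<..T}
           (\<lambda>x t. x ^ E *\<^sub>R mixed_deriv n l (psi2 m g1 g2 h1) x t) (\<lambda>t. 0) at_top"
proof -
  note g = assms(2,3) and h = assms(4)
  have kg: "kg_class m (\<lambda>x t. cos_op m f x t + a * sinc_op m f x t + b * dsinc_op m f' x t)"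
    if "schwartz_halfline f" "schwartz_halfline f'" for f f' a b
    by (intro kg_class.add kg_class_cmult propagator_kg_class that)
  show ?thesis
  proof (intro conjI)
    show "\<forall>\<^sub>F x in at_top. \<forall>t\<in>{0<..T}.
           psi_well_defined m g1 g2 h1 x t \<and>
           mixed_deriv_exists n l (psi1 m g1 g2 h1) x t \<and>
           mixed_deriv_exists n l (psi2 m g1 g2 h1) x t"
      using eventually_gt_at_top[of T]
    proof eventually_elim
      case (elim x)
      show ?case
      proof (intro ballI conjI)
        fix t assume "t \<in> {0<..T}"
        then have xt: "0 < t" "t < x" using elim by auto
        show "psi_well_defined m g1 g2 h1 x t"
          unfolding psi_well_defined_def
          by (intro conjI gen_integrable_initial gen_integrable_boundary g h xt)
        show "mixed_deriv_exists n l (psi1 m g1 g2 h1) x t"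
          by (rule mixed_deriv_exists_kg_class[OF kg[OF g] psi_explicit(1)[OF g h] xt])
        show "mixed_deriv_exists n l (psi2 m g1 g2 h1) x t"
          by (rule mixed_deriv_exists_kg_class[OF kg[OF g(2,1)] psi_explicit(2)[OF g h] xt])
      qed
    qed
    show "uniform_limit {0<..T} (\<lambda>x t. x ^ E *\<^sub>R mixed_deriv n l (psi1 m g1 g2 h1) x t) (\<lambda>t. 0) at_top"
      by (rule mixed_deriv_uniform_decay[OF kg[OF g] psi_explicit(1)[OF g h] assms(5)])
    show "uniform_limit {0<..T} (\<lambda>x t. x ^ E *\<^sub>R mixed_deriv n l (psi2 m g1 g2 h1) x t) (\<lambda>t. 0) at_top"
      by (rule mixed_deriv_uniform_decay[OF kg[OF g(2,1)] psi_explicit(2)[OF g h] assms(5)])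
  qed
qed

end
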